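(* Consider $\min_{u\in\mathbb R^d}\sum_{i=1}^m F_i(u)$ with $F_i=\frac1n\sum_{j=1}^n f_{ij}$, where: each $f_{ij}:\mathbb R^d\to\mathbb R$ is convex and $L_{ij}$-smooth; each $F_i$ is $L$-smooth and $\mu$-strongly convex ($\mu>0$); and the gossip matrices $W(k)$ satisfy the gossip assumption with constant $\chi\ge 1$ (see context). Let $\overline L=\max_i \frac1n\sum_{j=1}^nL_{ij}$ and let the batch size $b$ satisfy $b\ge \overline L/L$. Then, with a suitable choice of its scalar parameters (depending only on $L,\overline L,\mu,\chi,n,b$), algorithm ADOM+VR described in the context yields, for every $\varepsilon>0$, an iterate $x^N$ with $\mathbb E\|x^N-x^*\|^2\le\varepsilon$ after $$N=\mathcal O\left(\left(\frac nb+\left(\frac{\sqrt n}{b}+\frac{n\overline L}{b^2L}+\chi\right)\sqrt{\frac L\mu}\right)\log\frac1\varepsilon\right)$$ iterations.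
   Context: Notation: $g$ is $\ell$-smooth if $\|\nabla g(u)-\nabla g(v)\|\le \ell\|u-v\|$ for all $u,v$. Variables of the algorithm are $x=(x_1,\dots,x_m)\in(\mathbb R^d)^m$, $x_i$ held by node $i$, with the Euclidean norm. $\mathcal L=\{x: x_1=\dots=x_m\}$, $\mathcal L^\perp=\{x:\sum_i x_i=0\}$. $x^*=(u^*,\dots,u^* )\in\mathcal L$, where $u^*$ is the minimizer of $\sum_i F_i$. Gossip assumption with constant $\chi\ge1$: there are graphs $\mathcal G^k=(\{1,\dots,m\},\mathcal E^k)$, $k=0,1,2,\dots$, and matrices $W(k)\in\mathbb R^{m\times m}$ such that for every $k$: (1) $[W(k)]_{ij}\ne0$ iff $(i,j)\in\mathcal E^k$ or $i=j$; (2) $\ker W(k)\supset\{(c,\dots,c):c\in\mathbb R\}$; (3) $\mathrm{range}\,W(k)\subset\{a\in\mathbb R^m:\sum_i a_i=0\}$; (4) $\|(W(k)\otimes I_d)x-x\|^2\le(1-\chi^{-1})\|x\|^2$ for all $x\in\mathcal L^\perp$. Algorithm ADOM+VR. Scalar parameters: $\eta,\alpha,\nu,\tau_0,\tau_1,\tau_2,\theta,\beta,\sigma_1,\sigma_2,\gamma,\delta,\zeta,p_1,p_2$; integer batch size $b$. Input $x^0,y^0,m^0\in(\mathbb R^d)^m$, $z^0\in\mathcal L^\perp$; set $x_f^0=\omega^0=x^0$, $y_f^0=y^0$, $z_f^0=z^0$. For $k=0,1,\dots,N-1$: $x_g^k=\tau_1x^k+\tau_0\omega^k+(1-\tau_1-\tau_0)x_f^k$;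 each node $i$ samples a batch $S_i^k$ of $b$ independent indices from $\{1,\dots,n\}$ with $\Pr(j)=p_{ij}=L_{ij}/\sum_{l=1}^nL_{il}$, and sets $(\nabla^k)_i=\frac1b\sum_{j\in S_i^k}\frac1{np_{ij}}[\nabla f_{ij}(x_{g,i}^k)-\nabla f_{ij}(\omega_i^k)]+\nabla F_i(\omega_i^k)$; $x^{k+1}=x^k+\eta\alpha(x_g^k-x^{k+1})-\eta[\nabla^k-\nu x_g^k-y^{k+1}]$; $x_f^{k+1}=x_g^k+\tau_2(x^{k+1}-x^k)$; $\omega_i^{k+1}=x_{f,i}^k$ with probability $p_1$, $x_{g,i}^k$ with probability $p_2$, $\omega_i^k$ with probability $1-p_1-p_2$; $y_g^k=\sigma_1y^k+(1-\sigma_1)y_f^k$; $y^{k+1}=y^k+\theta\beta(\nabla^k-\nu x_g^k-y^{k+1})-\theta[\nu^{-1}(y_g^k+z_g^k)+x^{k+1}]$; $y_f^{k+1}=y_g^k+\sigma_2(y^{k+1}-y^k)$; $z_g^k=\sigma_1z^k+(1-\sigma_1)z_f^k$; $z^{k+1}=z^k+\gamma\delta(z_g^k-z^k)-(W(k)\otimes I_d)[\gamma\nu^{-1}(y_g^k+z_g^k)+m^k]$; $m^{k+1}=\gamma\nu^{-1}(y_g^k+z_g^k)+m^k-(W(k)\otimes I_d)[\gamma\nu^{-1}(y_g^k+z_g^k)+m^k]$; $z_f^{k+1}=z_g^k-\zeta(W(k)\otimes I_d)(y_g^k+z_g^k)$. (The updates of $x^{k+1}$ and $y^{k+1}$ are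 implicit and form a linear system in $(x^{k+1},y^{k+1})$.) Output $x^N$. Convention: $\mathcal O(A\log\frac1\varepsilon)$ means at most $cA\log(C/\varepsilon)$, where $c$ is an absolute constant and $C>0$ may depend on the problem and the initial point but not on $\varepsilon$. *)

theory Defs
  imports "HOL-Analysis.Analysis" "HOL-Probability.Probability"
begin

section \<open>Euclidean spaces of all dimensions inside one type\<close>

text \<open>
  The constant hidden in the complexity bound and the parameters of the algorithm must not depend
  on the dimension \<open>d\<close>, so \<open>d\<close> has to be a term and not a type.  We use the inner product space of
  finitely supported real sequences; \<open>Rd d\<close> is the subspace of the sequences supported in
  \<open>{..<d}\<close>, which is Euclidean \<open>d\<close>-space with its usual inner product and norm.
\<close>

typedef fseq = "{v :: nat \<Rightarrow> real. finite {i. v i \<noteq> 0}}"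
  morphisms coord Abs_fseq
  by (rule exI[of _ "\<lambda>_. 0"]) simp

setup_lifting type_definition_fseq

lemma finite_support: "finite {i. coord v i \<noteq> 0}"
  using coord by blast

lemma fseq_eqI: "(\<And>i. coord u i = coord v i) \<Longrightarrow> u = v"
  by (metis coord_inject ext)

instantiation fseq :: real_vector
begin

lift_definition zero_fseq :: fseq is "\<lambda>_. 0" by simp

lift_definition plus_fseq :: "fseq \<Rightarrow> fseq \<Rightarrow> fseq" is "\<lambda>u v i. u i + v i"
proof -
  fix u v :: "nat \<Rightarrow> real"
  assume "finite {i. u i \<noteq> 0}" "finite {i. v i \<noteq> 0}"
  then show "finite {i. u i + v i \<noteq> 0}"
    by (rule finite_subset[rotated, OF finite_UnI]) auto
qed

lift_definition minus_fseq :: "fseq \<Rightarrow> fseq \<Rightarrow> fseq" is "\<lambda>u v i. u i - v i"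
proof -
  fix u v :: "nat \<Rightarrow> real"
  assume "finite {i. u i \<noteq> 0}" "finite {i. v i \<noteq> 0}"
  then show "finite {i. u i - v i \<noteq> 0}"
    by (rule finite_subset[rotated, OF finite_UnI]) auto
qed

lift_definition uminus_fseq :: "fseq \<Rightarrow> fseq" is "\<lambda>u i. - u i"
  by simp

lift_definition scaleR_fseq :: "real \<Rightarrow> fseq \<Rightarrow> fseq" is "\<lambda>r u i. r * u i"
  by (erule rev_finite_subset) auto

instance
  by standard (transfer; simp add: fun_eq_iff algebra_simps)+

end

lemma coord_simps [simp]:
  "coord 0 i = 0" "coord (u + v) i = coord u i + coord v i" "coord (u - v) i = coord u i - coord v i"
  "coord (- u) i = - coord u i" "coord (r *\<^sub>R u) i = r * coord u i"
  by (transfer; simp)+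

instantiation fseq :: real_inner
begin

definition inner_fseq :: "fseq \<Rightarrow> fseq \<Rightarrow> real" where
  "inner_fseq u v = (\<Sum>i | coord u i \<noteq> 0. coord u i * coord v i)"

definition norm_fseq :: "fseq \<Rightarrow> real" where
  "norm_fseq u = sqrt (inner u u)"

definition sgn_fseq :: "fseq \<Rightarrow> fseq" where
  "sgn_fseq u = u /\<^sub>R norm u"

definition dist_fseq :: "fseq \<Rightarrow> fseq \<Rightarrow> real" where
  "dist_fseq u v = norm (u - v)"

definition uniformity_fseq :: "(fseq \<times> fseq) filter" where
  "uniformity_fseq = (INF e\<in>{0<..}. principal {(u, v). dist u v < e})"

definition open_fseq :: "fseq set \<Rightarrow> bool" where
  "open_fseq U \<longleftrightarrow> (\<forall>x\<in>U. \<forall>\<^sub>F (x', y) in uniformity. x' = x \<longrightarrow> y \<in> U)"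

lemma inner_fseq_superset:
  assumes "finite A" "{i. coord u i \<noteq> 0} \<subseteq> A"
  shows "inner u v = (\<Sum>i\<in>A. coord u i * coord v i)"
  unfolding inner_fseq_def using assms by (intro sum.mono_neutral_left) auto

instance
proof
  fix u v w :: fseq and r :: real
  let ?A = "{i. coord u i \<noteq> 0} \<union> {i. coord v i \<noteq> 0}"
  have fin: "finite ?A" using finite_support by simp
  show "inner u v = inner v u"
    using inner_fseq_superset[OF fin, of u v] inner_fseq_superset[OF fin, of v u]
    by (simp add: mult.commute)
  have "inner (u + v) w = (\<Sum>i\<in>?A. coord (u + v) i * coord w i)"
    by (rule inner_fseq_superset[OF fin]) auto
  moreover have "inner u w = (\<Sum>i\<in>?A. coord u i * coord w i)"
    by (rule inner_fseq_superset[OF fin]) auto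
  moreover have "inner v w = (\<Sum>i\<in>?A. coord v i * coord w i)"
    by (rule inner_fseq_superset[OF fin]) auto
  ultimately show "inner (u + v) w = inner u w + inner v w"
    by (simp add: sum.distrib distrib_right)
  have "inner (r *\<^sub>R u) v = (\<Sum>i | coord u i \<noteq> 0. coord (r *\<^sub>R u) i * coord v i)"
    by (rule inner_fseq_superset[OF finite_support]) auto
  then show "inner (r *\<^sub>R u) v = r * inner u v"
    by (simp add: inner_fseq_def sum_distrib_left mult.assoc)
  show "0 \<le> inner u u"
    unfolding inner_fseq_def by (intro sum_nonneg) simp
  show "inner u u = 0 \<longleftrightarrow> u = 0"
  proof
    assume "inner u u = 0"
    then have "\<forall>i\<in>{i. coord u i \<noteq> 0}. coord u i * coord u i = 0"
      unfolding inner_fseq_def by (subst (asm) sum_nonneg_eq_0_iff[OF finite_support]) auto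
    then show "u = 0" by (intro fseq_eqI) auto
  qed (simp add: inner_fseq_def)
  show "norm u = sqrt (inner u u)" by (rule norm_fseq_def)
  show "sgn u = u /\<^sub>R norm u" by (rule sgn_fseq_def)
  show "dist u v = norm (u - v)" by (rule dist_fseq_def)
  show "(uniformity :: (fseq \<times> fseq) filter) = (INF e\<in>{0<..}. principal {(u, v). dist u v < e})"
    by (rule uniformity_fseq_def)
  show "open U = (\<forall>x\<in>U. \<forall>\<^sub>F (x', y) in uniformity. x' = x \<longrightarrow> y \<in> U)" for U :: "fseq set"
    by (rule open_fseq_def)
qed

end

definition Rd :: "nat \<Rightarrow> fseq set" where
  "Rd d = {v. \<forall>i\<ge>d. coord v i = 0}"

lemma subspace_Rd: "subspace (Rd d)"
  by (auto simp: subspace_def Rd_def)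

lemma inner_Rd: "u \<in> Rd d \<Longrightarrow> inner u v = (\<Sum>i<d. coord u i * coord v i)"
  by (rule inner_fseq_superset) (auto simp: Rd_def intro: leI)

lemma norm_Rd: "u \<in> Rd d \<Longrightarrow> norm u = L2_set (coord u) {..<d}"
  by (simp add: norm_eq_sqrt_inner inner_Rd L2_set_def power2_eq_square)


section \<open>Gradients, smoothness, strong convexity\<close>

text \<open>Functions on \<open>d\<close>-space are only looked at on \<^term>\<open>Rd d\<close>; hence derivatives are taken
  within that subspace.\<close>

definition has_gradient :: "nat \<Rightarrow> (fseq \<Rightarrow> real) \<Rightarrow> fseq \<Rightarrow> fseq \<Rightarrow> bool" where
  "has_gradient d g G u \<longleftrightarrow>
     G \<in> Rd d \<and> (g has_derivative (\<lambda>h. inner G h)) (at u within Rd d)"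

definition grad :: "nat \<Rightarrow> (fseq \<Rightarrow> real) \<Rightarrow> fseq \<Rightarrow> fseq" where
  "grad d g u = (THE G. has_gradient d g G u)"

definition smooth :: "nat \<Rightarrow> real \<Rightarrow> (fseq \<Rightarrow> real) \<Rightarrow> bool" where
  "smooth d l g \<longleftrightarrow>
     (\<forall>u\<in>Rd d. g differentiable (at u within Rd d)) \<and>
     (\<forall>u\<in>Rd d. \<forall>v\<in>Rd d. norm (grad d g u - grad d g v) \<le> l * norm (u - v))"

definition strongly_convex :: "nat \<Rightarrow> real \<Rightarrow> (fseq \<Rightarrow> real) \<Rightarrow> bool" where
  "strongly_convex d \<mu> g \<longleftrightarrow>
     (\<forall>u\<in>Rd d. \<forall>v\<in>Rd d. g v \<ge> g u + inner (grad d g u) (v - u) + \<mu> / 2 * (norm (v - u))\<^sup>2)"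

lemma has_gradient_unique:
  assumes "u \<in> Rd d" "has_gradient d g G u" "has_gradient d g H u"
  shows "G = H"
proof -
  have GH: "G - H \<in> Rd d"
    using assms by (simp add: has_gradient_def subspace_diff subspace_Rd)
  have "((\<lambda>_. 0 :: real) has_derivative (\<lambda>h. inner (G - H) h)) (at u within Rd d)"
    using has_derivative_diff[of g "inner G" "at u within Rd d" g "inner H"] assms
    by (simp add: has_gradient_def inner_diff_left)
  then have "((\<lambda>_. 0 :: real) has_derivative (\<lambda>h. inner (G - H) h))
      (at u within (\<lambda>t. u + t *\<^sub>R (G - H)) ` UNIV)"
    by (rule has_derivative_subset)
       (use GH assms(1) in \<open>auto intro!: subspace_add subspace_scale subspace_Rd\<close>)
  moreover have "((\<lambda>t::real. u + t *\<^sub>R (G - H)) has_derivative (\<lambda>t. t *\<^sub>R (G - H))) (at 0)"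
    by (auto intro!: derivative_eq_intros)
  ultimately have "((\<lambda>t::real. 0 :: real) has_derivative (\<lambda>t. inner (G - H) (t *\<^sub>R (G - H)))) (at 0)"
    using has_derivative_in_compose[of "\<lambda>t::real. u + t *\<^sub>R (G - H)" "\<lambda>t. t *\<^sub>R (G - H)" 0 UNIV
        "\<lambda>_. 0 :: real" "inner (G - H)"] by simp
  then have "(\<lambda>t::real. inner (G - H) (t *\<^sub>R (G - H))) = (\<lambda>_. 0)"
    by (rule has_derivative_unique) simp
  then have "inner (G - H) (1 *\<^sub>R (G - H)) = 0" by meson
  then show ?thesis by simp
qed

lemma has_gradient_grad:
  assumes "u \<in> Rd d" "g differentiable (at u within Rd d)"
  shows "has_gradient d g (grad d g u) u"
proof -
  obtain g' where g': "(g has_derivative g') (at u within Rd d)"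
    using assms(2) by (auto simp: differentiable_def)
  interpret g': bounded_linear g' using g' by (rule has_derivative_bounded_linear)
  define e where "e i = Abs_fseq (\<lambda>j. if j = i then 1 else 0)" for i :: nat
  have coord_e: "coord (e i) j = (if j = i then 1 else 0)" for i j
    unfolding e_def by (subst Abs_fseq_inverse) auto
  have coord_sum: "coord (\<Sum>i<k. c i *\<^sub>R e i) j = (if j < k then c j else 0)"
    for c :: "nat \<Rightarrow> real" and k :: nat and j
    by (induction k) (auto simp: coord_e less_Suc_eq)
  define G where "G = (\<Sum>i<d. g' (e i) *\<^sub>R e i)"
  have G: "G \<in> Rd d" by (auto simp: Rd_def G_def coord_sum)
  have eq: "g' h = inner G h" if "h \<in> Rd d" for h
  proof -
    have "h = (\<Sum>i<d. coord h i *\<^sub>R e i)"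
      using that by (intro fseq_eqI) (auto simp: coord_sum Rd_def)
    then have "g' h = g' (\<Sum>i<d. coord h i *\<^sub>R e i)" by simp
    also have "\<dots> = (\<Sum>i<d. coord h i * g' (e i))"
      by (simp add: g'.sum g'.scaleR)
    also have "\<dots> = inner G h"
      by (subst inner_Rd[OF G]) (auto simp: G_def coord_sum mult.commute intro!: sum.cong)
    finally show ?thesis .
  qed
  have "(g has_derivative (\<lambda>h. inner G h)) (at u within Rd d)"
    unfolding has_derivative_within
  proof
    show "bounded_linear (inner G)" by (rule bounded_linear_inner_right)
    have "((\<lambda>y. (1 / norm (y - u)) *\<^sub>R (g y - (g u + g' (y - u)))) \<longlongrightarrow> 0) (at u within Rd d)"
      using g' by (simp add: has_derivative_within)
    then show "((\<lambda>y. (1 / norm (y - u)) *\<^sub>R (g y - (g u + inner G (y - u)))) \<longlongrightarrow> 0) (at u within Rd d)"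
      by (rule Lim_transform_within[where d = 1])
         (use assms(1) in \<open>auto simp: eq subspace_diff subspace_Rd\<close>)
  qed
  with G have "has_gradient d g G u" by (simp add: has_gradient_def)
  then show ?thesis
    unfolding grad_def using has_gradient_unique[OF assms(1)] by (metis theI)
qed


section \<open>Gossip matrices\<close>

text \<open>Nodes are \<open>{..<m}\<close>.  For real entries \<open>mix m A\<close> is the matrix-vector product with \<open>A\<close>, for
  entries in \<open>d\<close>-space it is the product with the Kronecker product of \<open>A\<close> and the identity.\<close>

definition mix :: "nat \<Rightarrow> (nat \<Rightarrow> nat \<Rightarrow> real) \<Rightarrow> (nat \<Rightarrow> 'a::real_vector) \<Rightarrow> nat \<Rightarrow> 'a" where
  "mix m A x i = (\<Sum>j<m. A i j *\<^sub>R x j)"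

definition gossip ::
  "nat \<Rightarrow> nat \<Rightarrow> real \<Rightarrow> (nat \<Rightarrow> (nat \<times> nat) set) \<Rightarrow> (nat \<Rightarrow> nat \<Rightarrow> nat \<Rightarrow> real) \<Rightarrow> bool" where
  "gossip d m chi E W \<longleftrightarrow> (\<forall>k.
     E k \<subseteq> {..<m} \<times> {..<m} \<and>
     (\<forall>i<m. \<forall>j<m. W k i j \<noteq> 0 \<longleftrightarrow> (i, j) \<in> E k \<or> i = j) \<and>
     (\<forall>c::real. \<forall>i<m. mix m (W k) (\<lambda>_. c) i = 0) \<and>
     (\<forall>a::nat \<Rightarrow> real. (\<Sum>i<m. mix m (W k) a i) = 0) \<and>
     (\<forall>x. (\<forall>i<m. x i \<in> Rd d) \<and> (\<Sum>i<m. x i) = 0 \<longrightarrow>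
        (\<Sum>i<m. (norm (mix m (W k) x i - x i))\<^sup>2) \<le> (1 - 1 / chi) * (\<Sum>i<m. (norm (x i))\<^sup>2)))"


section \<open>The algorithm\<close>

record adom_params =
  p_eta :: real
  p_alpha :: real
  p_nu :: real
  p_tau0 :: real
  p_tau1 :: real
  p_tau2 :: real
  p_theta :: real
  p_beta :: real
  p_sigma1 :: real
  p_sigma2 :: real
  p_gamma :: real
  p_delta :: real
  p_zeta :: real
  p_prob1 :: real
  p_prob2 :: real

record adom_state =
  s_x :: "nat \<Rightarrow> fseq"
  s_xf :: "nat \<Rightarrow> fseq"
  s_w :: "nat \<Rightarrow> fseq"
  s_y :: "nat \<Rightarrow> fseq"
  s_yf :: "nat \<Rightarrow> fseq"
  s_z :: "nat \<Rightarrow> fseq"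
  s_zf :: "nat \<Rightarrow> fseq"
  s_m :: "nat \<Rightarrow> fseq"

text \<open>The parameters for which the algorithm is well defined: \<open>\<nu>\<close> can be inverted, the reference
  point is drawn from a probability distribution, and the linear system for the implicit updates
  is regular (its determinant is the last expression, see \<open>implicit_xy_unique\<close>).\<close>

definition admissible :: "adom_params \<Rightarrow> bool" where
  "admissible P \<longleftrightarrow>
     p_nu P \<noteq> 0 \<and> 0 \<le> p_prob1 P \<and> 0 \<le> p_prob2 P \<and> p_prob1 P + p_prob2 P \<le> 1 \<and>
     (1 + p_eta P * p_alpha P) * (1 + p_theta P * p_beta P) + p_eta P * p_theta P \<noteq> 0"

definition F_node :: "nat \<Rightarrow> (nat \<Rightarrow> nat \<Rightarrow> fseq \<Rightarrow> real) \<Rightarrow> nat \<Rightarrow> fseq \<Rightarrow> real" where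
  "F_node n f i u = (1 / real n) * (\<Sum>j<n. f i j u)"

definition index_prob :: "nat \<Rightarrow> (nat \<Rightarrow> nat \<Rightarrow> real) \<Rightarrow> nat \<Rightarrow> nat \<Rightarrow> real" where
  "index_prob n Lf i j = Lf i j / (\<Sum>l<n. Lf i l)"

definition index_pmf :: "nat \<Rightarrow> (nat \<Rightarrow> nat \<Rightarrow> real) \<Rightarrow> nat \<Rightarrow> nat pmf" where
  "index_pmf n Lf i = embed_pmf (\<lambda>j. if j < n then index_prob n Lf i j else 0)"

text \<open>\<open>S (i, s)\<close> is the \<open>s\<close>-th index sampled by node \<open>i\<close>.\<close>

definition batch_pmf :: "nat \<Rightarrow> nat \<Rightarrow> nat \<Rightarrow> (nat \<Rightarrow> nat \<Rightarrow> real) \<Rightarrow> (nat \<times> nat \<Rightarrow> nat) pmf" where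
  "batch_pmf m n b Lf = Pi_pmf ({..<m} \<times> {..<b}) 0 (\<lambda>(i, s). index_pmf n Lf i)"

datatype ref_choice = Take_f | Take_g | Keep

definition choice_pmf :: "adom_params \<Rightarrow> ref_choice pmf" where
  "choice_pmf P = embed_pmf (\<lambda>c. case c of
     Take_f \<Rightarrow> p_prob1 P | Take_g \<Rightarrow> p_prob2 P | Keep \<Rightarrow> 1 - p_prob1 P - p_prob2 P)"

definition choices_pmf :: "nat \<Rightarrow> adom_params \<Rightarrow> (nat \<Rightarrow> ref_choice) pmf" where
  "choices_pmf m P = Pi_pmf {..<m} Keep (\<lambda>_. choice_pmf P)"

definition stoch_grad ::
  "nat \<Rightarrow> nat \<Rightarrow> nat \<Rightarrow> (nat \<Rightarrow> nat \<Rightarrow> fseq \<Rightarrow> real) \<Rightarrow> (nat \<Rightarrow> nat \<Rightarrow> real) \<Rightarrow>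
    (nat \<times> nat \<Rightarrow> nat) \<Rightarrow> (nat \<Rightarrow> fseq) \<Rightarrow> (nat \<Rightarrow> fseq) \<Rightarrow> nat \<Rightarrow> fseq" where
  "stoch_grad d n b f Lf S xg w i =
     (1 / real b) *\<^sub>R (\<Sum>s<b. let j = S (i, s) in
        (1 / (real n * index_prob n Lf i j)) *\<^sub>R (grad d (f i j) (xg i) - grad d (f i j) (w i)))
     + grad d (F_node n f i) (w i)"

text \<open>The linear system that defines the new \<open>x\<close> and \<open>y\<close>, here called \<open>x'\<close> and \<open>y'\<close>, decouples
  over the nodes; all arguments below are components at one node.\<close>

definition implicit_xy ::
  "adom_params \<Rightarrow> fseq \<Rightarrow> fseq \<Rightarrow> fseq \<Rightarrow> fseq \<Rightarrow> fseq \<Rightarrow> fseq \<Rightarrow> fseq \<times> fseq \<Rightarrow> bool" where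
  "implicit_xy P x xg G y yg zg = (\<lambda>(x', y').
     x' = x + (p_eta P * p_alpha P) *\<^sub>R (xg - x') - p_eta P *\<^sub>R (G - p_nu P *\<^sub>R xg - y') \<and>
     y' = y + (p_theta P * p_beta P) *\<^sub>R (G - p_nu P *\<^sub>R xg - y')
            - p_theta P *\<^sub>R (inverse (p_nu P) *\<^sub>R (yg + zg) + x'))"

definition update ::
  "nat \<Rightarrow> nat \<Rightarrow> nat \<Rightarrow> nat \<Rightarrow> (nat \<Rightarrow> nat \<Rightarrow> fseq \<Rightarrow> real) \<Rightarrow> (nat \<Rightarrow> nat \<Rightarrow> real) \<Rightarrow> adom_params \<Rightarrow>
    (nat \<Rightarrow> nat \<Rightarrow> real) \<Rightarrow> (nat \<times> nat \<Rightarrow> nat) \<Rightarrow> (nat \<Rightarrow> ref_choice) \<Rightarrow> adom_state \<Rightarrow> adom_state"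
where
  "update d m n b f Lf P A S ch st =
    (let
       xg = (\<lambda>i. p_tau1 P *\<^sub>R s_x st i + p_tau0 P *\<^sub>R s_w st i
                 + (1 - p_tau1 P - p_tau0 P) *\<^sub>R s_xf st i);
       G = stoch_grad d n b f Lf S xg (s_w st);
       yg = (\<lambda>i. p_sigma1 P *\<^sub>R s_y st i + (1 - p_sigma1 P) *\<^sub>R s_yf st i);
       zg = (\<lambda>i. p_sigma1 P *\<^sub>R s_z st i + (1 - p_sigma1 P) *\<^sub>R s_zf st i);
       xy = (\<lambda>i. THE q. implicit_xy P (s_x st i) (xg i) (G i) (s_y st i) (yg i) (zg i) q);
       x' = (\<lambda>i. fst (xy i));
       y' = (\<lambda>i. snd (xy i));
       r = (\<lambda>i. (p_gamma P * inverse (p_nu P)) *\<^sub>R (yg i + zg i) + s_m st i)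
     in
       \<lparr> s_x = x',
         s_xf = (\<lambda>i. xg i + p_tau2 P *\<^sub>R (x' i - s_x st i)),
         s_w = (\<lambda>i. case ch i of Take_f \<Rightarrow> s_xf st i | Take_g \<Rightarrow> xg i | Keep \<Rightarrow> s_w st i),
         s_y = y',
         s_yf = (\<lambda>i. yg i + p_sigma2 P *\<^sub>R (y' i - s_y st i)),
         s_z = (\<lambda>i. s_z st i + (p_gamma P * p_delta P) *\<^sub>R (zg i - s_z st i) - mix m A r i),
         s_zf = (\<lambda>i. zg i - p_zeta P *\<^sub>R mix m A (\<lambda>j. yg j + zg j) i),
         s_m = (\<lambda>i. r i - mix m A r i) \<rparr>)"

text \<open>All random choices, over all nodes and iterations, are independent.  The law of the state
  after \<open>k\<close> iterations is the following distribution (with finite support).\<close>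

primrec adom_vr ::
  "nat \<Rightarrow> nat \<Rightarrow> nat \<Rightarrow> nat \<Rightarrow> (nat \<Rightarrow> nat \<Rightarrow> fseq \<Rightarrow> real) \<Rightarrow> (nat \<Rightarrow> nat \<Rightarrow> real) \<Rightarrow> adom_params \<Rightarrow>
    (nat \<Rightarrow> nat \<Rightarrow> nat \<Rightarrow> real) \<Rightarrow>
    (nat \<Rightarrow> fseq) \<Rightarrow> (nat \<Rightarrow> fseq) \<Rightarrow> (nat \<Rightarrow> fseq) \<Rightarrow> (nat \<Rightarrow> fseq) \<Rightarrow> nat \<Rightarrow> adom_state pmf"
where
  "adom_vr d m n b f Lf P W x0 y0 z0 m0 0 = return_pmf
     \<lparr> s_x = x0, s_xf = x0, s_w = x0, s_y = y0, s_yf = y0, s_z = z0, s_zf = z0, s_m = m0 \<rparr>"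
| "adom_vr d m n b f Lf P W x0 y0 z0 m0 (Suc k) =
     bind_pmf (adom_vr d m n b f Lf P W x0 y0 z0 m0 k) (\<lambda>st.
       map_pmf (\<lambda>(S, ch). update d m n b f Lf P (W k) S ch st)
         (pair_pmf (batch_pmf m n b Lf) (choices_pmf m P)))"

definition mean_sq_error :: "nat \<Rightarrow> adom_state pmf \<Rightarrow> fseq \<Rightarrow> real" where
  "mean_sq_error m p u = measure_pmf.expectation p (\<lambda>st. \<Sum>i<m. (norm (s_x st i - u))\<^sup>2)"

definition complexity :: "nat \<Rightarrow> nat \<Rightarrow> real \<Rightarrow> real \<Rightarrow> real \<Rightarrow> real \<Rightarrow> real" where
  "complexity n b L Lbar \<mu> chi =
     real n / real b
     + (sqrt (real n) / real b + real n * Lbar / ((real b)\<^sup>2 * L) + chi) * sqrt (L / \<mu>)"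

lemma implicit_xy_unique:
  assumes "admissible P"
  shows "\<exists>!q. implicit_xy P x xg G y yg zg q"
proof -
  define a e t h where "a = 1 + p_eta P * p_alpha P" and "e = p_eta P"
    and "t = p_theta P" and "h = 1 + p_theta P * p_beta P"
  define r where "r = x + (a - 1) *\<^sub>R xg - e *\<^sub>R (G - p_nu P *\<^sub>R xg)"
  define s where "s = y + (h - 1) *\<^sub>R (G - p_nu P *\<^sub>R xg) - t *\<^sub>R (inverse (p_nu P) *\<^sub>R (yg + zg))"
  define D where "D = a * h + e * t"
  have D: "D \<noteq> 0" using assms by (simp add: admissible_def D_def a_def e_def t_def h_def)
  have sys: "implicit_xy P x xg G y yg zg (u, v) \<longleftrightarrow>
      a *\<^sub>R u - e *\<^sub>R v = r \<and> h *\<^sub>R v + t *\<^sub>R u = s" for u v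
    unfolding implicit_xy_def r_def s_def a_def e_def t_def h_def prod.case
    by (rule arg_cong2[where f = "(\<and>)"]) (auto simp: algebra_simps)
  show ?thesis
  proof (rule ex1I[of _ "((1 / D) *\<^sub>R (h *\<^sub>R r + e *\<^sub>R s), (1 / D) *\<^sub>R (a *\<^sub>R s - t *\<^sub>R r))"])
    have "a *\<^sub>R (h *\<^sub>R r + e *\<^sub>R s) - e *\<^sub>R (a *\<^sub>R s - t *\<^sub>R r) = D *\<^sub>R r"
      "h *\<^sub>R (a *\<^sub>R s - t *\<^sub>R r) + t *\<^sub>R (h *\<^sub>R r + e *\<^sub>R s) = D *\<^sub>R s"
      by (simp_all add: D_def algebra_simps)
    then have "(1 / D) *\<^sub>R (a *\<^sub>R (h *\<^sub>R r + e *\<^sub>R s) - e *\<^sub>R (a *\<^sub>R s - t *\<^sub>R r)) = r"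
      "(1 / D) *\<^sub>R (h *\<^sub>R (a *\<^sub>R s - t *\<^sub>R r) + t *\<^sub>R (h *\<^sub>R r + e *\<^sub>R s)) = s"
      using D by simp_all
    then show "implicit_xy P x xg G y yg zg
        ((1 / D) *\<^sub>R (h *\<^sub>R r + e *\<^sub>R s), (1 / D) *\<^sub>R (a *\<^sub>R s - t *\<^sub>R r))"
      unfolding sys by (simp add: scaleR_add_right scaleR_diff_right mult.commute)
  next
    fix q assume "implicit_xy P x xg G y yg zg q"
    then obtain u v where q: "q = (u, v)" and rs: "r = a *\<^sub>R u - e *\<^sub>R v" "s = h *\<^sub>R v + t *\<^sub>R u"
      using sys by (cases q) auto
    have "h *\<^sub>R r + e *\<^sub>R s = D *\<^sub>R u" "a *\<^sub>R s - t *\<^sub>R r = D *\<^sub>R v"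
      unfolding rs D_def by (simp_all add: algebra_simps)
    then show "q = ((1 / D) *\<^sub>R (h *\<^sub>R r + e *\<^sub>R s), (1 / D) *\<^sub>R (a *\<^sub>R s - t *\<^sub>R r))"
      using D q by simp
  qed
qed

lemma pmf_index_pmf:
  assumes "\<forall>j<n. 0 \<le> Lf i j" "0 < (\<Sum>l<n. Lf i l)"
  shows "pmf (index_pmf n Lf i) j = (if j < n then index_prob n Lf i j else 0)"
  unfolding index_pmf_def
proof (rule pmf_embed_pmf)
  show "0 \<le> (if j < n then index_prob n Lf i j else 0)" for j
    using assms by (simp add: index_prob_def)
  have "(\<integral>\<^sup>+ j. ennreal (if j < n then index_prob n Lf i j else 0) \<partial>count_space UNIV)
      = (\<Sum>j<n. ennreal (index_prob n Lf i j))"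
    by (subst nn_integral_count_space'[of "{..<n}"]) auto
  also have "\<dots> = ennreal (\<Sum>j<n. index_prob n Lf i j)"
    using assms by (intro sum_ennreal) (auto simp: index_prob_def)
  also have "(\<Sum>j<n. index_prob n Lf i j) = 1"
    using assms(2) by (simp add: index_prob_def flip: sum_divide_distrib)
  finally show "(\<integral>\<^sup>+ j. ennreal (if j < n then index_prob n Lf i j else 0) \<partial>count_space UNIV) = 1"
    by simp
qed

lemma pmf_choice_pmf:
  assumes "admissible P"
  shows "pmf (choice_pmf P) c = (case c of
     Take_f \<Rightarrow> p_prob1 P | Take_g \<Rightarrow> p_prob2 P | Keep \<Rightarrow> 1 - p_prob1 P - p_prob2 P)"
  unfolding choice_pmf_def
proof (rule pmf_embed_pmf)
  let ?p = "\<lambda>c. case c of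
     Take_f \<Rightarrow> p_prob1 P | Take_g \<Rightarrow> p_prob2 P | Keep \<Rightarrow> 1 - p_prob1 P - p_prob2 P"
  show nn: "0 \<le> ?p c" for c
    using assms by (cases c) (auto simp: admissible_def)
  have U: "(UNIV :: ref_choice set) = {Take_f, Take_g, Keep}"
    by (auto intro: ref_choice.exhaust)
  have "(\<integral>\<^sup>+ c. ennreal (?p c) \<partial>count_space UNIV) = (\<Sum>c\<in>{Take_f, Take_g, Keep}. ennreal (?p c))"
    by (rule nn_integral_count_space') (auto simp flip: U, simp add: U)
  also have "\<dots> = ennreal (\<Sum>c\<in>{Take_f, Take_g, Keep}. ?p c)"
    by (rule sum_ennreal) (rule nn)
  finally show "(\<integral>\<^sup>+ c. ennreal (?p c) \<partial>count_space UNIV) = 1"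
    by simp
qed

end

theory Submission
  imports Defs
begin

text \<open>
  Stack the vectors of the nodes, put \<open>\<nu> = \<mu> / 2\<close> and \<open>f(x) = (\<Sum>i. F\<^sub>i(x\<^sub>i)) - \<nu> / 2 *
  |x|\<^sup>2\<close>; the function \<open>f\<close> is still \<open>\<mu> / 2\<close>-strongly convex and its Bregman distances are at most
  those of an \<open>L\<close>-smooth function. Minimizing \<open>\<Sum>i. F\<^sub>i\<close> over consensus vectors is the saddle
  point problem \<open>min\<^sub>x max\<^sub>y\<^sub>,\<^sub>z f(x) - \<langle>y, x\<rangle> - |y + z|\<^sup>2 / (2 * \<nu>)\<close> in which the components of
  \<open>z\<close> sum to zero. Its solution is \<open>x\<^sup>* = (u, \<dots>, u)\<close>, \<open>y\<^sup>* = \<nabla>f(x\<^sup>*)\<close>, \<open>z\<^sup>* = - \<nabla>F(x\<^sup>*)\<close>, where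
  \<open>y\<^sup>* + z\<^sup>* = - \<nu> * x\<^sup>*\<close>. The algorithm runs an accelerated method on all three blocks at once.

  Four inequalities describe one iteration. \<open>primal_step\<close> is the acceleration argument for \<open>f\<close>.
  \<open>dual_step\<close> uses the term \<open>\<beta>\<close>, which pulls \<open>y\<close> towards the gradient and acts like strong
  concavity in \<open>y\<close>. \<open>consensus_step\<close> treats \<open>z\<close>: a gossip matrix is only a rough substitute for
  the orthogonal projection onto the vectors with sum zero, but the error memory \<open>m\<close> repairs this,
  because \<open>z\<close> minus the projection of \<open>m\<close> performs an exact projected gradient step, up to
  damping, while that projection itself shrinks by a factor governed by \<open>\<chi>\<close>. \<open>coupling_step\<close> is
  the acceleration argument for \<open>|y + z|\<^sup>2\<close>, where one multiplication by a gossip matrix still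
  gains a fraction \<open>1 / \<chi>\<close> of the component that is not in consensus. The bilinear terms cancel
  when the inequalities are added, and with the chosen parameters the sum is a contraction of a
  Lyapunov function (\<open>lyapunov_combine\<close>, \<open>pathwise_descent\<close>) up to the noise of the gradient
  estimator.

  The noise has mean zero, and by cocoercivity of the single components its variance is at most \<open>4
  * L\<close> times the Bregman distance from the query point to the reference point (\<open>noise_variance\<close>);
  this is where \<open>b \<ge> Lbar / L\<close> enters. The weight \<open>\<tau>\<^sub>0 = 1 / 2\<close> of the reference point in the
  query point leaves a negative multiple of the same Bregman distance in \<open>primal_step\<close>, and the
  parameters make both multiples equal.

  The bound counts iterations only, so the reference point may be renewed in each of them: with
  \<open>p\<^sub>1 = 1\<close> it is always the previous \<open>x\<^sub>f\<close>, and the batches remain as the only source of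
  randomness. With \<open>t = sqrt (\<mu> / L) / 2\<close> the expected Lyapunov function then shrinks in every
  iteration by the factor \<open>1 - \<rho>\<close> with \<open>\<rho> = t / (256 * \<chi>)\<close>, and \<open>1 / \<rho> = 512 * \<chi> * sqrt (L / \<mu>)\<close>
  is \<open>512\<close> times one of the summands of the claimed complexity.
\<close>

section \<open>One iteration in an inner product space\<close>

lemma norm_add_sq:
  fixes a b :: "'a::real_inner"
  shows "(norm (a + b))\<^sup>2 = (norm a)\<^sup>2 + (norm b)\<^sup>2 + 2 * inner a b"
  by (simp add: power2_norm_eq_inner inner_simps inner_commute)

lemma norm_diff_sq_le:
  fixes a b :: "'a::real_inner"
  shows "(norm (a - b))\<^sup>2 \<le> 2 * (norm a)\<^sup>2 + 2 * (norm b)\<^sup>2"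
proof -
  have "(norm (a - b))\<^sup>2 + (norm (a + b))\<^sup>2 = 2 * (norm a)\<^sup>2 + 2 * (norm b)\<^sup>2"
    by (simp add: power2_norm_eq_inner inner_simps inner_commute)
  then show ?thesis by (smt (verit) zero_le_power2)
qed

lemma norm_scaleR_sq:
  fixes a :: "'a::real_normed_vector"
  shows "(norm (c *\<^sub>R a))\<^sup>2 = c\<^sup>2 * (norm a)\<^sup>2"
  by (simp add: power_mult_distrib)

lemma three_point_norm:
  fixes x x' s :: "'a::real_inner"
  shows "(norm (x' - s))\<^sup>2 = (norm (x - s))\<^sup>2 - (norm (x' - x))\<^sup>2 + 2 * inner (x' - x) (x' - s)"
  by (simp add: power2_norm_eq_inner inner_simps inner_commute algebra_simps)

lemma inner_diff_norms:
  fixes a b s :: "'a::real_inner"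
  shows "2 * inner (a - b) (b - s) = (norm (a - s))\<^sup>2 - (norm (b - s))\<^sup>2 - (norm (a - b))\<^sup>2"
  by (simp add: power2_norm_eq_inner inner_simps inner_commute algebra_simps)

lemma young_inner:
  fixes a b :: "'a::real_inner"
  assumes "0 < c"
  shows "2 * inner a b \<le> c * (norm a)\<^sup>2 + (1 / c) * (norm b)\<^sup>2"
proof -
  have "0 \<le> (norm (c *\<^sub>R a - b))\<^sup>2" by simp
  also have "\<dots> = c * (c * (norm a)\<^sup>2 + (1 / c) * (norm b)\<^sup>2 - 2 * inner a b)"
    using assms by (simp add: power2_norm_eq_inner inner_simps inner_commute algebra_simps)
  finally show ?thesis using assms by (simp add: zero_le_mult_iff)
qed

text \<open>
  Here \<open>gx\<close> is the gradient of \<open>f\<close> at the query point \<open>xg\<close>, \<open>\<xi>\<close> the noise, and the numbers \<open>Df\<close>,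
  \<open>Df'\<close>, \<open>Dw\<close>, \<open>Dg\<close> are Bregman distances of \<open>f\<close> to the solution at \<open>xf\<close>, \<open>xf'\<close>, \<open>w\<close>, \<open>xg\<close>; \<open>B\<close> is
  the one between the reference point \<open>w\<close> and \<open>xg\<close>. The convex combination \<open>xg\<close> turns the gradient
  at \<open>xg\<close> into differences of these numbers, and \<open>1 / \<tau> = 1 / t + 1 / 2\<close> is chosen so that exactly
  \<open>- Dg\<close> survives. The reference point is kept as an equality: it contributes \<open>- B\<close>, which later
  pays for the variance.
\<close>

lemma primal_step:
  fixes x x' xg xf xf' w xs y' ys gx \<xi> :: "'a::real_inner"
  assumes pos: "0 < L" "0 < t" "t \<le> 1 / 2"
    and par: "\<eta> = 1 / (8 * L * t)" "\<alpha> = 2 * L * t\<^sup>2" "\<tau> > 0" "1 / \<tau> = 1 / t + 1 / 2"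
    and step: "x' = x + (\<eta> * \<alpha>) *\<^sub>R (xg - x') - \<eta> *\<^sub>R (gx + \<xi> - y')"
    and xg: "xg = \<tau> *\<^sub>R x + (1 / 2) *\<^sub>R w + (1 / 2 - \<tau>) *\<^sub>R xf"
    and xf': "xf' = xg + t *\<^sub>R (x' - x)"
    and opt: "inner (gx - ys) (xg - xs) \<ge> Dg + L * t\<^sup>2 * (norm (xg - xs))\<^sup>2"
    and ref: "inner (gx - ys) (w - xg) = Dw - Dg - B"
    and old: "inner (gx - ys) (xf - xg) \<le> Df - Dg"
    and new: "inner (gx - ys) (xf' - xg) \<ge> Df' - Dg - L / 2 * (norm (xf' - xg))\<^sup>2"
  shows "(1 / \<eta> + \<alpha>) * (norm (x' - xs))\<^sup>2 + 2 / t * Df'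
    \<le> 1 / \<eta> * (norm (x - xs))\<^sup>2 + (1 / t - 3 / 2) * Df + (1 / t + 1 / 2) * (Dw - B) - Dg
      + 2 * \<eta> * (norm \<xi>)\<^sup>2 - 2 * inner \<xi> (x - xs) + 2 * inner (y' - ys) (x' - xs)"
proof -
  have eta: "\<eta> > 0" "1 / \<eta> = 8 * L * t" using pos par by simp_all
  have tau: "1 / 2 - \<tau> \<ge> 0"
  proof -
    have "1 / t \<ge> 2" using pos by (simp add: field_simps)
    then have "1 / \<tau> \<ge> 2" using par(4) by linarith
    then show ?thesis using par(3) by (simp add: field_simps)
  qed
  have diff: "x' - x = \<eta> *\<^sub>R (\<alpha> *\<^sub>R (xg - x') - (gx + \<xi> - y'))"
    by (subst step) (simp add: algebra_simps)
  have "(1 / \<eta>) *\<^sub>R (x' - x) = \<alpha> *\<^sub>R (xg - x') - (gx + \<xi> - y')"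
    using eta(1) by (subst diff) simp
  then have "1 / \<eta> * inner (x' - x) (x' - xs)
      = inner (\<alpha> *\<^sub>R (xg - x') - (gx + \<xi> - y')) (x' - xs)"
    by (metis inner_scaleR_left)
  also have "\<dots> = \<alpha> * inner (xg - x') (x' - xs) - inner (gx - ys) (x - xs) - inner (gx - ys) (x' - x)
      - inner \<xi> (x - xs) - inner \<xi> (x' - x) + inner (y' - ys) (x' - xs)"
    by (simp add: inner_simps algebra_simps)
  finally have split: "1 / \<eta> * inner (x' - x) (x' - xs) = \<dots>" .
  have prox: "2 * (\<alpha> * inner (xg - x') (x' - xs)) \<le> \<alpha> * (norm (xg - xs))\<^sup>2 - \<alpha> * (norm (x' - xs))\<^sup>2"
  proof -
    have "\<alpha> * (norm (xg - x'))\<^sup>2 \<ge> 0" using par pos by simp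
    moreover have "2 * (\<alpha> * inner (xg - x') (x' - xs)) = \<alpha> * (2 * inner (xg - x') (x' - xs))" by simp
    ultimately show ?thesis unfolding inner_diff_norms by (simp add: algebra_simps)
  qed
  have lin: "inner (gx - ys) (x - xs) \<ge> Dg + L * t\<^sup>2 * (norm (xg - xs))\<^sup>2
      + (1 / \<tau>) * (1 / 2 * (Dg + B - Dw) + (1 / 2 - \<tau>) * (Dg - Df))"
  proof -
    have "\<tau> *\<^sub>R (x - xg) = (1 / 2) *\<^sub>R (xg - w) + (1 / 2 - \<tau>) *\<^sub>R (xg - xf)"
    proof -
      have "\<tau> *\<^sub>R (x - xg) - ((1 / 2) *\<^sub>R (xg - w) + (1 / 2 - \<tau>) *\<^sub>R (xg - xf))
          = \<tau> *\<^sub>R x + (1 / 2) *\<^sub>R w + (1 / 2 - \<tau>) *\<^sub>R xf - ((1/2) *\<^sub>R xg + (1/2) *\<^sub>R xg)"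
        by (simp add: algebra_simps)
      also have "\<dots> = 0" using xg by (simp flip: scaleR_add_left)
      finally show ?thesis by simp
    qed
    then have "\<tau> * inner (gx - ys) (x - xg)
        = 1 / 2 * inner (gx - ys) (xg - w) + (1 / 2 - \<tau>) * inner (gx - ys) (xg - xf)"
      by (metis inner_add_right inner_scaleR_right)
    moreover have "inner (gx - ys) (xg - w) = Dg + B - Dw"
      using ref by (simp add: inner_diff_right)
    moreover have "(1 / 2 - \<tau>) * inner (gx - ys) (xg - xf) \<ge> (1 / 2 - \<tau>) * (Dg - Df)"
      using old by (intro mult_left_mono tau) (simp add: inner_diff_right)
    ultimately have "\<tau> * inner (gx - ys) (x - xg) \<ge> 1 / 2 * (Dg + B - Dw) + (1 / 2 - \<tau>) * (Dg - Df)"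
      by simp
    then have "inner (gx - ys) (x - xg) \<ge> (1 / \<tau>) * (1 / 2 * (Dg + B - Dw) + (1 / 2 - \<tau>) * (Dg - Df))"
      using par(3) by (simp add: pos_divide_le_eq mult.commute)
    moreover have "inner (gx - ys) (x - xs) = inner (gx - ys) (x - xg) + inner (gx - ys) (xg - xs)"
      by (simp add: inner_diff_right)
    ultimately show ?thesis using opt by linarith
  qed
  have lin2: "(1 / \<tau>) * (1 / 2 * (Dg + B - Dw) + (1 / 2 - \<tau>) * (Dg - Df))
     = 1 / 2 * (1 / t + 1 / 2) * (Dg + B - Dw) + (1 / 2 * (1 / t + 1 / 2) - 1) * (Dg - Df)"
  proof -
    have "(1 / \<tau>) * \<tau> = 1" using par(3) by simp
    then have "(1 / \<tau>) * (1 / 2 - \<tau>) = 1 / 2 * (1 / t + 1 / 2) - 1"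
      unfolding par(4)[symmetric] by (simp add: algebra_simps)
    then show ?thesis unfolding par(4)[symmetric] distrib_left mult.assoc[symmetric] by simp
  qed
  have desc: "2 * inner (gx - ys) (x' - x) \<ge> 2 / t * (Df' - Dg) - L * t * (norm (x' - x))\<^sup>2"
  proof -
    have "inner (gx - ys) (x' - x) = (1 / t) * inner (gx - ys) (xf' - xg)"
      using xf' pos by simp
    moreover have "(1 / t) * inner (gx - ys) (xf' - xg) \<ge> (1 / t) * (Df' - Dg - L / 2 * (norm (xf' - xg))\<^sup>2)"
      using new pos by (intro mult_left_mono) auto
    moreover
    have "(norm (xf' - xg))\<^sup>2 = t * (t * (norm (x' - x))\<^sup>2)"
      using xf' by (simp add: power_mult_distrib power2_eq_square)
    then have "(1 / t) * (Df' - Dg - L / 2 * (norm (xf' - xg))\<^sup>2)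
        = 1 / t * (Df' - Dg) - L / 2 * t * (norm (x' - x))\<^sup>2"
      using pos by (simp add: field_simps)
    moreover have "2 / t * (Df' - Dg) = 2 * (1 / t * (Df' - Dg))" by simp
    moreover have "L / 2 * t * (norm (x' - x))\<^sup>2 * 2 = L * t * (norm (x' - x))\<^sup>2" by simp
    ultimately show ?thesis by linarith
  qed
  have noise: "- 2 * inner \<xi> (x' - x) \<le> 2 * \<eta> * (norm \<xi>)\<^sup>2 + 1 / (2 * \<eta>) * (norm (x' - x))\<^sup>2"
    using young_inner[of "2 * \<eta>" "- \<xi>" "x' - x"] eta by simp
  have "1 / \<eta> * (norm (x' - xs))\<^sup>2
      = 1 / \<eta> * (norm (x - xs))\<^sup>2 - 1 / \<eta> * (norm (x' - x))\<^sup>2 + 2 * (1 / \<eta> * inner (x' - x) (x' - xs))"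
    unfolding three_point_norm[of x' xs x] by (simp add: algebra_simps)
  moreover define Q where "Q = Dg + L * t\<^sup>2 * (norm (xg - xs))\<^sup>2
      + (1 / 2 * (1 / t + 1 / 2) * (Dg + B - Dw) + (1 / 2 * (1 / t + 1 / 2) - 1) * (Dg - Df))"
  moreover from lin have "Q \<le> inner (gx - ys) (x - xs)" unfolding lin2 Q_def .
  ultimately have "1 / \<eta> * (norm (x' - xs))\<^sup>2 + \<alpha> * (norm (x' - xs))\<^sup>2 + 2 / t * (Df' - Dg)
     \<le> 1 / \<eta> * (norm (x - xs))\<^sup>2 - 1 / \<eta> * (norm (x' - x))\<^sup>2
       + \<alpha> * (norm (xg - xs))\<^sup>2 
       - 2 * Q
       + L * t * (norm (x' - x))\<^sup>2 - 2 * inner \<xi> (x - xs) + 2 * \<eta> * (norm \<xi>)\<^sup>2 + 1 / (2 * \<eta>) * (norm (x' - x))\<^sup>2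
       + 2 * inner (y' - ys) (x' - xs)"
    using split prox desc noise by linarith
  moreover have "- 1 / \<eta> * (norm (x' - x))\<^sup>2 + L * t * (norm (x' - x))\<^sup>2 + 1 / (2 * \<eta>) * (norm (x' - x))\<^sup>2 \<le> 0"
  proof -
    have "1 / (2 * \<eta>) = (1 / \<eta>) / 2" by simp
    then have "1 / (2 * \<eta>) = 4 * L * t" unfolding eta(2) by simp
    moreover have "- 1 / \<eta> = - (8 * L * t)" using eta(2) by simp
    ultimately have "- 1 / \<eta> * (norm (x' - x))\<^sup>2 + L * t * (norm (x' - x))\<^sup>2 + 1 / (2 * \<eta>) * (norm (x' - x))\<^sup>2
      = (- 3 * L * t) * (norm (x' - x))\<^sup>2"
      by (simp only:) (simp add: algebra_simps)
    also have "\<dots> \<le> 0" using pos by (intro mult_nonpos_nonneg) auto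
    finally show ?thesis .
  qed
  moreover have "\<alpha> * (norm (xg - xs))\<^sup>2 = 2 * (L * t\<^sup>2 * (norm (xg - xs))\<^sup>2)" using par by simp
  moreover have "2 * Q = 2 * Dg + 2 * (L * t\<^sup>2 * (norm (xg - xs))\<^sup>2)
      + (1 / t + 1 / 2) * (Dg + B - Dw) + (1 / t - 3 / 2) * (Dg - Df)"
  proof -
    have "2 * (Dg + X + (1 / 2 * (k + 1 / 2) * (Dg + B - Dw) + (1 / 2 * (k + 1 / 2) - 1) * (Dg - Df)))
        = 2 * Dg + 2 * X + (k + 1 / 2) * (Dg + B - Dw) + (k - 3 / 2) * (Dg - Df)" for k X :: real
      by (simp add: field_simps)
    then show ?thesis unfolding Q_def .
  qed
  ultimately have "1 / \<eta> * (norm (x' - xs))\<^sup>2 + \<alpha> * (norm (x' - xs))\<^sup>2 + 2 / t * (Df' - Dg)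
    \<le> 1 / \<eta> * (norm (x - xs))\<^sup>2 - (2 * Dg + (1 / t + 1 / 2) * (Dg + B - Dw) + (1 / t - 3 / 2) * (Dg - Df))
      - 2 * inner \<xi> (x - xs) + 2 * \<eta> * (norm \<xi>)\<^sup>2 + 2 * inner (y' - ys) (x' - xs)"
    by linarith
  moreover have "2 * k * (Df' - Dg) + (2 * Dg + (k + 1 / 2) * (Dg + B - Dw) + (k - 3 / 2) * (Dg - Df))
    = 2 * k * Df' - (k - 3 / 2) * Df - (k + 1 / 2) * (Dw - B) + Dg" for k :: real
    by (simp add: field_simps)
  from this[of "1 / t"] have "2 / t * (Df' - Dg) + (2 * Dg + (1 / t + 1 / 2) * (Dg + B - Dw) + (1 / t - 3 / 2) * (Dg - Df))
    = 2 / t * Df' - (1 / t - 3 / 2) * Df - (1 / t + 1 / 2) * (Dw - B) + Dg"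
    by simp
  ultimately show ?thesis unfolding distrib_right by linarith
qed

text \<open>
  The momentum part of an accelerated step for the quadratic \<open>|y - s|\<^sup>2\<close>: since \<open>y - yg\<close> is a
  multiple of \<open>yg - yf\<close>, convexity compares the values at \<open>yg\<close> and \<open>yf\<close>.
\<close>

lemma momentum_inner_ge:
  fixes y yg yf s :: "'a::real_inner"
  assumes "\<tau> > 0" "1 / \<tau> \<ge> 1" "yg = \<tau> *\<^sub>R y + (1 - \<tau>) *\<^sub>R yf"
  shows "2 * inner (y - yg) (yg - s) \<ge> (1 / \<tau> - 1) * ((norm (yg - s))\<^sup>2 - (norm (yf - s))\<^sup>2)"
proof -
  have "\<tau> *\<^sub>R (y - yg) = (1 - \<tau>) *\<^sub>R (yg - yf)"
    using assms(3) by (simp add: algebra_simps)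
  then have "\<tau> * (2 * inner (y - yg) (yg - s)) = (1 - \<tau>) * (2 * inner (yg - yf) (yg - s))"
    by (metis inner_scaleR_left mult.left_commute)
  also have "2 * inner (yg - yf) (yg - s) = (norm (yg - s))\<^sup>2 - (norm (yf - s))\<^sup>2 + (norm (yg - yf))\<^sup>2"
    by (simp add: power2_norm_eq_inner inner_simps inner_commute algebra_simps)
  finally have "2 * inner (y - yg) (yg - s)
      = (1 / \<tau> - 1) * ((norm (yg - s))\<^sup>2 - (norm (yf - s))\<^sup>2 + (norm (yg - yf))\<^sup>2)"
    using assms(1) by (simp add: field_simps)
  moreover have "(1 / \<tau> - 1) * (norm (yg - yf))\<^sup>2 \<ge> 0"
    using assms(2) by simp
  ultimately show ?thesis by (simp add: algebra_simps)
qed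

text \<open>
  The term \<open>\<beta>\<close> of the update produces \<open>- \<beta> * |y' - ys|\<^sup>2\<close>. One half of it contracts \<open>y\<close>. The other
  half goes through an acceleration argument for the quadratic \<open>|y - ys|\<^sup>2\<close> and becomes \<open>- \<beta> / 4 *
  |yg - ys|\<^sup>2\<close>, a bound on the extrapolated point that \<open>consensus_step\<close> needs.
\<close>

lemma dual_step:
  fixes y y' yg yf yf' ys gx \<xi> sg ss x' xs :: "'a::real_inner"
  assumes pos: "0 < \<theta>" "0 < \<beta>" "0 < \<sigma>" "\<sigma> \<le> 1" "0 < \<nu>"
    and par: "\<tau> > 0" "1 / \<tau> = 1 / \<sigma> + 1 / 2"
    and step: "y' = y + (\<theta> * \<beta>) *\<^sub>R (gx + \<xi> - y') - \<theta> *\<^sub>R ((1 / \<nu>) *\<^sub>R sg + x')"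
    and fixpt: "(1 / \<nu>) *\<^sub>R ss + xs = 0"
    and yg: "yg = \<tau> *\<^sub>R y + (1 - \<tau>) *\<^sub>R yf"
    and yf': "yf' = yg + \<sigma> *\<^sub>R (y' - y)"
  shows "(1 / \<theta> + \<beta> / 2) * (norm (y' - ys))\<^sup>2 + \<beta> / (2 * \<sigma>) * (norm (yf' - ys))\<^sup>2
    \<le> 1 / \<theta> * (norm (y - ys))\<^sup>2 + \<beta> / 2 * (1 / \<sigma> - 1 / 2) * (norm (yf - ys))\<^sup>2
      - \<beta> / 4 * (norm (yg - ys))\<^sup>2 - (1 / \<theta> - \<beta> * \<sigma> / 2) * (norm (y' - y))\<^sup>2
      + \<beta> * (norm (gx + \<xi> - ys))\<^sup>2 - 2 * inner (x' - xs) (y' - ys) - 2 / \<nu> * inner (sg - ss) (y' - ys)"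
proof -
  have diff: "y' - y = \<theta> *\<^sub>R (\<beta> *\<^sub>R (gx + \<xi> - y') - ((1 / \<nu>) *\<^sub>R sg + x'))"
    by (subst step) (simp add: algebra_simps)
  have "(1 / \<theta>) *\<^sub>R (y' - y) = \<beta> *\<^sub>R (gx + \<xi> - y') - ((1 / \<nu>) *\<^sub>R sg + x')"
    using pos by (subst diff) simp
  also have "\<dots> = \<beta> *\<^sub>R (gx + \<xi> - y') - ((1 / \<nu>) *\<^sub>R (sg - ss) + (x' - xs))"
    using fixpt by (simp add: algebra_simps add_eq_0_iff)
  finally have "inner ((1 / \<theta>) *\<^sub>R (y' - y)) (y' - ys)
      = inner (\<beta> *\<^sub>R (gx + \<xi> - y') - ((1 / \<nu>) *\<^sub>R (sg - ss) + (x' - xs))) (y' - ys)"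
    by simp
  then have split: "1 / \<theta> * inner (y' - y) (y' - ys) = \<beta> * inner (gx + \<xi> - y') (y' - ys)
      - 1 / \<nu> * inner (sg - ss) (y' - ys) - inner (x' - xs) (y' - ys)"
    unfolding inner_diff_left[of "\<beta> *\<^sub>R _"] inner_add_left[of "(1 / \<nu>) *\<^sub>R _"] inner_scaleR_left by simp
  have prox: "2 * \<beta> * inner (gx + \<xi> - y') (y' - ys)
      \<le> \<beta> * (norm (gx + \<xi> - ys))\<^sup>2 - \<beta> * (norm (y' - ys))\<^sup>2"
  proof -
    have "\<beta> * (norm (gx + \<xi> - y'))\<^sup>2 \<ge> 0" using pos by simp
    moreover have "2 * \<beta> * inner (gx + \<xi> - y') (y' - ys) = \<beta> * (2 * inner (gx + \<xi> - y') (y' - ys))" by simp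
    ultimately show ?thesis unfolding inner_diff_norms by (simp add: algebra_simps)
  qed
  have accel: "(norm (y' - ys))\<^sup>2 \<ge> 1 / 2 * (norm (yg - ys))\<^sup>2 + 1 / \<sigma> * (norm (yf' - ys))\<^sup>2
      - (1 / \<sigma> - 1 / 2) * (norm (yf - ys))\<^sup>2 - \<sigma> * (norm (y' - y))\<^sup>2"
  proof -
    have "1 / \<sigma> \<ge> 1" using pos by simp
    then have "1 / \<tau> \<ge> 1" using par(2) by linarith
    have "(norm (y' - ys))\<^sup>2 = (norm (y' - yg))\<^sup>2 + (norm (yg - ys))\<^sup>2
        + 2 * inner (y' - y) (yg - ys) + 2 * inner (y - yg) (yg - ys)"
      by (simp add: power2_norm_eq_inner inner_simps inner_commute algebra_simps)
    moreover have "2 * inner (y' - y) (yg - ys)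
      = 1 / \<sigma> * (norm (yf' - ys))\<^sup>2 - 1 / \<sigma> * (norm (yg - ys))\<^sup>2 - \<sigma> * (norm (y' - y))\<^sup>2"
      unfolding yf' using pos
      by (simp add: power2_norm_eq_inner inner_simps inner_commute algebra_simps add_divide_distrib diff_divide_distrib)
    moreover have "2 * inner (y - yg) (yg - ys) \<ge> (1 / \<tau> - 1) * ((norm (yg - ys))\<^sup>2 - (norm (yf - ys))\<^sup>2)"
      using par(1) \<open>1 / \<tau> \<ge> 1\<close> yg by (rule momentum_inner_ge)
    moreover have "(1 / \<tau> - 1) * ((norm (yg - ys))\<^sup>2 - (norm (yf - ys))\<^sup>2)
      = 1 / \<sigma> * (norm (yg - ys))\<^sup>2 - 1 / 2 * (norm (yg - ys))\<^sup>2 - (1 / \<sigma> - 1 / 2) * (norm (yf - ys))\<^sup>2"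
      unfolding par(2) by (simp add: algebra_simps)
    moreover have "(norm (y' - yg))\<^sup>2 \<ge> 0" by simp
    ultimately show ?thesis by linarith
  qed
  have accel': "\<beta> / 2 * (norm (y' - ys))\<^sup>2 \<ge> \<beta> / 4 * (norm (yg - ys))\<^sup>2 + \<beta> / (2 * \<sigma>) * (norm (yf' - ys))\<^sup>2
      - \<beta> / 2 * (1 / \<sigma> - 1 / 2) * (norm (yf - ys))\<^sup>2 - \<beta> * \<sigma> / 2 * (norm (y' - y))\<^sup>2"
    using mult_left_mono[OF accel, of "\<beta> / 2"] pos by (simp add: algebra_simps)
  have "1 / \<theta> * (norm (y' - ys))\<^sup>2
      = 1 / \<theta> * (norm (y - ys))\<^sup>2 - 1 / \<theta> * (norm (y' - y))\<^sup>2 + 2 * (1 / \<theta> * inner (y' - y) (y' - ys))"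
    unfolding three_point_norm[of y' ys y] by (simp add: algebra_simps)
  with split prox accel' show ?thesis
    by (simp add: algebra_simps)
qed

lemma contraction_norm_le:
  fixes p w :: "'a::real_inner"
  assumes "1 \<le> chi" "(norm (p - w))\<^sup>2 \<le> (1 - 1 / chi) * (norm p)\<^sup>2"
  shows "norm w \<le> 2 * norm p"
proof -
  have "(1 - 1 / chi) * (norm p)\<^sup>2 \<le> 1 * (norm p)\<^sup>2"
    using assms by (intro mult_right_mono) auto
  then have "(norm (p - w))\<^sup>2 \<le> (norm p)\<^sup>2" using assms(2) by linarith
  then have "norm (p - w) \<le> norm p" by (rule power2_le_imp_le) simp
  moreover have "norm w \<le> norm p + norm (p - w)" using norm_triangle_ineq4[of p "p - w"] by simp
  ultimately show ?thesis by linarith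
qed

text \<open>
  Acceleration for the quadratic \<open>|s - ss|\<^sup>2\<close>, where \<open>s\<close> stands for \<open>y + z\<close> and \<open>p\<close> for the
  projection of \<open>sg\<close> onto the vectors with sum zero. The block \<open>y\<close> moves by \<open>\<sigma> * \<Delta>\<close>; the
  block \<open>z\<close> moves by the gossip image \<open>w\<close> of \<open>sg\<close>, and since \<open>sg - ss - p\<close> is a consensus vector,
  this move alone decreases the quadratic by \<open>|p|\<^sup>2 / \<chi>\<close>. One half of that pays for the
  interaction of \<open>w\<close> with \<open>\<Delta>\<close>, the other half is left over.
\<close>

lemma coupling_step:
  fixes s sg sf sf' ss p w \<Delta> :: "'a::real_inner"
  assumes pos: "1 \<le> chi" "0 < \<sigma>" "\<sigma> \<le> 1"
    and par: "\<tau> > 0" "1 / \<tau> = 1 / \<sigma> + 1 / 2"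
    and sg: "sg = \<tau> *\<^sub>R s + (1 - \<tau>) *\<^sub>R sf"
    and sf': "sf' = sg + \<sigma> *\<^sub>R \<Delta> - w"
    and gossip: "(norm (p - w))\<^sup>2 \<le> (1 - 1 / chi) * (norm p)\<^sup>2"
    and orth: "inner (sg - ss - p) p = 0" "inner (sg - ss - p) w = 0"
  shows "- 2 * inner (sg - ss) (s + \<Delta> - ss)
    \<le> (1 / \<sigma> - 1 / 2) * (norm (sf - ss))\<^sup>2 - 1 / \<sigma> * (norm (sf' - ss))\<^sup>2 - 3 / 2 * (norm (sg - ss))\<^sup>2
      - 1 / (2 * chi * \<sigma>) * (norm p)\<^sup>2 + 9 * chi * \<sigma> * (norm \<Delta>)\<^sup>2"
proof -
  have "1 / \<sigma> \<ge> 1" using pos by simp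
  then have "1 / \<tau> \<ge> 1" using par(2) by linarith
  have consensus: "(norm (sg - ss - w))\<^sup>2 \<le> (norm (sg - ss))\<^sup>2 - 1 / chi * (norm p)\<^sup>2"
  proof -
    have "(norm (sg - ss - w))\<^sup>2 = (norm (sg - ss - p))\<^sup>2 + (norm (p - w))\<^sup>2 + 2 * inner (sg - ss - p) (p - w)"
      by (simp add: power2_norm_eq_inner inner_simps inner_commute algebra_simps)
    moreover have "(norm (sg - ss))\<^sup>2 = (norm (sg - ss - p))\<^sup>2 + (norm p)\<^sup>2 + 2 * inner (sg - ss - p) p"
      by (simp add: power2_norm_eq_inner inner_simps inner_commute algebra_simps)
    moreover have "inner (sg - ss - p) (p - w) = 0" using orth by (simp only: inner_diff_right)
    ultimately show ?thesis using gossip orth(1) by (simp add: algebra_simps)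
  qed
  \<comment> \<open>As \<open>norm w \<le> 2 * norm p\<close>, the weight \<open>1 / (8 * chi)\<close> spends one half of the gain \<open>1 / chi\<close>.\<close>
  have cross: "- 2 * \<sigma> * inner w \<Delta> \<le> 1 / (2 * chi) * (norm p)\<^sup>2 + 8 * chi * \<sigma>\<^sup>2 * (norm \<Delta>)\<^sup>2"
  proof -
    have "- 2 * \<sigma> * inner w \<Delta> = 2 * inner (- w) (\<sigma> *\<^sub>R \<Delta>)" by simp
    also have "\<dots> \<le> 1 / (8 * chi) * (norm (- w))\<^sup>2 + 1 / (1 / (8 * chi)) * (norm (\<sigma> *\<^sub>R \<Delta>))\<^sup>2"
      using pos by (intro young_inner) simp
    also have "\<dots> = 1 / (8 * chi) * (norm w)\<^sup>2 + 8 * chi * \<sigma>\<^sup>2 * (norm \<Delta>)\<^sup>2"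
      using pos by (simp add: power_mult_distrib)
    also have "1 / (8 * chi) * (norm w)\<^sup>2 \<le> 1 / (8 * chi) * (2 * norm p)\<^sup>2"
      using contraction_norm_le[OF pos(1) gossip] pos by (intro mult_left_mono power_mono) auto
    also have "\<dots> = 1 / (2 * chi) * (norm p)\<^sup>2" by (simp add: power_mult_distrib)
    finally show ?thesis by simp
  qed
  have "(norm (sf' - ss))\<^sup>2 = (norm (sg - ss - w))\<^sup>2 + 2 * \<sigma> * inner (sg - ss) \<Delta> - 2 * \<sigma> * inner w \<Delta>
      + \<sigma>\<^sup>2 * (norm \<Delta>)\<^sup>2"
  proof -
    have "sf' - ss = (sg - ss - w) + \<sigma> *\<^sub>R \<Delta>" unfolding sf' by simp
    then show ?thesis unfolding norm_add_sq norm_scaleR_sq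
      by (simp only: norm_add_sq norm_scaleR_sq) (simp add: inner_diff_left algebra_simps)
  qed
  moreover have "\<sigma>\<^sup>2 * (norm \<Delta>)\<^sup>2 \<le> chi * \<sigma>\<^sup>2 * (norm \<Delta>)\<^sup>2"
    using pos by (simp add: mult_right_mono)
  ultimately have "(norm (sf' - ss))\<^sup>2 \<le> (norm (sg - ss))\<^sup>2 - 1 / (2 * chi) * (norm p)\<^sup>2
      + 2 * \<sigma> * inner (sg - ss) \<Delta> + 9 * chi * \<sigma>\<^sup>2 * (norm \<Delta>)\<^sup>2"
    using consensus cross by (simp add: algebra_simps)
  from mult_left_mono[OF this, of "1 / \<sigma>"] pos
  have descent: "- 2 * inner (sg - ss) \<Delta> \<le> 1 / \<sigma> * (norm (sg - ss))\<^sup>2 - 1 / \<sigma> * (norm (sf' - ss))\<^sup>2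
      - 1 / (2 * chi * \<sigma>) * (norm p)\<^sup>2 + 9 * chi * \<sigma> * (norm \<Delta>)\<^sup>2"
    by (simp add: algebra_simps power2_eq_square add_divide_distrib diff_divide_distrib)
  have mom: "2 * inner (s - sg) (sg - ss) \<ge> (1 / \<tau> - 1) * ((norm (sg - ss))\<^sup>2 - (norm (sf - ss))\<^sup>2)"
    using par(1) \<open>1 / \<tau> \<ge> 1\<close> sg by (rule momentum_inner_ge)
  have "- 2 * inner (sg - ss) (s + \<Delta> - ss)
      = - 2 * (norm (sg - ss))\<^sup>2 - 2 * inner (s - sg) (sg - ss) - 2 * inner (sg - ss) \<Delta>"
    by (simp add: power2_norm_eq_inner inner_simps inner_commute algebra_simps)
  moreover have "(1 / \<tau> - 1) * ((norm (sg - ss))\<^sup>2 - (norm (sf - ss))\<^sup>2)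
      = 1 / \<sigma> * (norm (sg - ss))\<^sup>2 - 1 / 2 * (norm (sg - ss))\<^sup>2 - (1 / \<sigma> - 1 / 2) * (norm (sf - ss))\<^sup>2"
    unfolding par(2) by (simp add: algebra_simps)
  ultimately show ?thesis using mom descent by linarith
qed

text \<open>
  Here \<open>mm\<close> is the projection of the error memory. In \<open>z - mm\<close> the gossip image \<open>w\<close> cancels: apart
  from the damping by \<open>\<delta>\<close>, that difference makes an exact projected gradient step of size \<open>\<gamma>\<close>
  along \<open>- p / \<nu>\<close>. The price is the error of \<open>mm\<close>, which contracts by \<open>1 - 1 / \<chi>\<close> and receives \<open>(\<gamma>
  / \<nu>) * p\<close>; Young's inequality with weight \<open>2 * \<chi>\<close> keeps half of that contraction.
\<close>

lemma consensus_step: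
  fixes z z' zg zs sg ss mm mm' p w :: "'a::real_inner"
  assumes pos: "1 \<le> chi" "0 < \<gamma>" "0 < \<delta>" "0 < \<nu>" "12 * \<gamma> * \<delta> * chi \<le> 1"
    and step_z: "z' = z + (\<gamma> * \<delta>) *\<^sub>R (zg - z) - w"
    and step_m: "mm' = (\<gamma> / \<nu>) *\<^sub>R p + mm - w"
    and gossip: "(norm ((\<gamma> / \<nu>) *\<^sub>R p + mm - w))\<^sup>2 \<le> (1 - 1 / chi) * (norm ((\<gamma> / \<nu>) *\<^sub>R p + mm))\<^sup>2"
    and orth: "inner (sg - ss - p) (z - zs) = 0"
  shows "1 / \<gamma> * (norm (z' - mm' - zs))\<^sup>2 + 2 / \<gamma> * (norm mm')\<^sup>2
    \<le> (1 / \<gamma> - \<delta> / 2) * (norm (z - mm - zs))\<^sup>2 + 2 / \<gamma> * (1 - 1 / (4 * chi)) * (norm mm)\<^sup>2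
      + \<delta> * (norm (zg - zs))\<^sup>2 + 10 * \<gamma> * chi / \<nu>\<^sup>2 * (norm p)\<^sup>2 - 2 / \<nu> * inner (sg - ss) (z - zs)"
proof -
  have step_hat: "z' - mm' - zs = (z - mm - zs) + \<gamma> *\<^sub>R (\<delta> *\<^sub>R (zg - z) - (1 / \<nu>) *\<^sub>R p)"
    unfolding step_z step_m by (simp add: algebra_simps)
  have gd: "\<gamma> * \<delta> \<le> 1 / 12"
  proof -
    have "12 * \<gamma> * \<delta> * 1 \<le> 12 * \<gamma> * \<delta> * chi" using pos by (intro mult_left_mono) auto
    then show ?thesis using pos(5) by linarith
  qed
  define q where "q = (norm p)\<^sup>2 / \<nu>\<^sup>2"
  have q0: "q \<ge> 0" by (simp add: q_def)
  have memory: "(norm mm')\<^sup>2 \<le> (1 - 1 / (2 * chi)) * (norm mm)\<^sup>2 + 2 * chi * \<gamma>\<^sup>2 * q"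
  proof -
    have "2 * inner ((\<gamma> / \<nu>) *\<^sub>R p) mm
        \<le> 2 * chi * (norm ((\<gamma> / \<nu>) *\<^sub>R p))\<^sup>2 + 1 / (2 * chi) * (norm mm)\<^sup>2"
      using pos by (intro young_inner) simp
    moreover have "(norm ((\<gamma> / \<nu>) *\<^sub>R p))\<^sup>2 = \<gamma>\<^sup>2 * q"
      unfolding norm_scaleR_sq by (simp add: q_def power_divide)
    ultimately have "(norm ((\<gamma> / \<nu>) *\<^sub>R p + mm))\<^sup>2
        \<le> (1 + 2 * chi) * (\<gamma>\<^sup>2 * q) + (1 + 1 / (2 * chi)) * (norm mm)\<^sup>2"
      unfolding norm_add_sq by (simp add: algebra_simps)
    then have "(1 - 1 / chi) * (norm ((\<gamma> / \<nu>) *\<^sub>R p + mm))\<^sup>2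
        \<le> (1 - 1 / chi) * ((1 + 2 * chi) * (\<gamma>\<^sup>2 * q) + (1 + 1 / (2 * chi)) * (norm mm)\<^sup>2)"
      using pos by (intro mult_left_mono) auto
    also have "\<dots> = ((1 - 1 / chi) * (1 + 2 * chi)) * (\<gamma>\<^sup>2 * q) + ((1 - 1 / chi) * (1 + 1 / (2 * chi))) * (norm mm)\<^sup>2"
      by (simp add: algebra_simps)
    also have "\<dots> \<le> (2 * chi) * (\<gamma>\<^sup>2 * q) + (1 - 1 / (2 * chi)) * (norm mm)\<^sup>2"
    proof (intro add_mono mult_right_mono)
      show "(1 - 1 / chi) * (1 + 2 * chi) \<le> 2 * chi" using pos(1) by (simp add: field_simps)
      show "(1 - 1 / chi) * (1 + 1 / (2 * chi)) \<le> 1 - 1 / (2 * chi)" using pos(1) by (simp add: field_simps)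
    qed (use q0 in auto)
    finally show ?thesis using gossip unfolding step_m by simp
  qed
  have mem_cross: "2 / \<nu> * inner p mm \<le> 1 / (4 * \<gamma> * chi) * (norm mm)\<^sup>2 + 4 * \<gamma> * chi * q"
  proof -
    have "2 * inner mm ((1 / \<nu>) *\<^sub>R p) \<le> 1 / (4 * \<gamma> * chi) * (norm mm)\<^sup>2
        + 1 / (1 / (4 * \<gamma> * chi)) * (norm ((1 / \<nu>) *\<^sub>R p))\<^sup>2"
      using pos by (intro young_inner) simp
    moreover have "(norm ((1 / \<nu>) *\<^sub>R p))\<^sup>2 = q"
      unfolding norm_scaleR_sq by (simp add: q_def power_divide)
    moreover have "2 / \<nu> * inner p mm = 2 * inner mm ((1 / \<nu>) *\<^sub>R p)"
      unfolding inner_scaleR_right inner_commute[of mm p] by simp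
    moreover have "1 / (1 / (4 * \<gamma> * chi)) = 4 * \<gamma> * chi" by simp
    ultimately show ?thesis by metis
  qed
  have damp: "2 * inner (zg - z) (z - mm - zs)
      \<le> (norm (zg - zs))\<^sup>2 - 1 / 2 * (norm (z - mm - zs))\<^sup>2 - 1 / 2 * (norm (zg - z))\<^sup>2 + 3 * (norm mm)\<^sup>2"
  proof -
    have "2 * inner (zg - z) (z - mm - zs) = 2 * inner (zg - z) (z - zs) + 2 * inner (zg - z) (- mm)"
      by (simp add: inner_simps algebra_simps)
    moreover have "2 * inner (zg - z) (- mm) \<le> 1 / 2 * (norm (zg - z))\<^sup>2 + 1 / (1 / 2) * (norm (- mm))\<^sup>2"
      by (intro young_inner) simp
    moreover have "(norm (z - mm - zs))\<^sup>2 \<le> 2 * (norm (z - zs))\<^sup>2 + 2 * (norm mm)\<^sup>2"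
      using norm_diff_sq_le[of "z - zs" mm] by (simp add: algebra_simps)
    ultimately show ?thesis unfolding inner_diff_norms by simp
  qed
  have quad: "(norm (\<delta> *\<^sub>R (zg - z) - (1 / \<nu>) *\<^sub>R p))\<^sup>2 \<le> 2 * \<delta>\<^sup>2 * (norm (zg - z))\<^sup>2 + 2 * q"
  proof -
    have "(norm (\<delta> *\<^sub>R (zg - z) - (1 / \<nu>) *\<^sub>R p))\<^sup>2
       \<le> 2 * (norm (\<delta> *\<^sub>R (zg - z)))\<^sup>2 + 2 * (norm ((1 / \<nu>) *\<^sub>R p))\<^sup>2"
      by (rule norm_diff_sq_le)
    moreover have "(norm (\<delta> *\<^sub>R (zg - z)))\<^sup>2 = \<delta>\<^sup>2 * (norm (zg - z))\<^sup>2" "(norm ((1 / \<nu>) *\<^sub>R p))\<^sup>2 = q"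
      unfolding norm_scaleR_sq by (simp_all add: q_def power_divide)
    ultimately show ?thesis by linarith
  qed
  have orth': "inner p (z - zs) = inner (sg - ss) (z - zs)"
    using orth by (simp add: inner_diff_left)
  have "(norm (z' - mm' - zs))\<^sup>2 = (norm (z - mm - zs))\<^sup>2
      + 2 * \<gamma> * inner (\<delta> *\<^sub>R (zg - z) - (1 / \<nu>) *\<^sub>R p) (z - mm - zs)
      + \<gamma>\<^sup>2 * (norm (\<delta> *\<^sub>R (zg - z) - (1 / \<nu>) *\<^sub>R p))\<^sup>2"
    unfolding step_hat norm_add_sq norm_scaleR_sq inner_scaleR_right
    by (simp only: inner_commute[of "z - mm - zs"] add.assoc add.commute mult.assoc)
  then have "1 / \<gamma> * (norm (z' - mm' - zs))\<^sup>2 = 1 / \<gamma> * (norm (z - mm - zs))\<^sup>2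
      + 2 * inner (\<delta> *\<^sub>R (zg - z) - (1 / \<nu>) *\<^sub>R p) (z - mm - zs)
      + \<gamma> * (norm (\<delta> *\<^sub>R (zg - z) - (1 / \<nu>) *\<^sub>R p))\<^sup>2"
    using pos by (simp add: field_simps power2_eq_square)
  also have "inner (\<delta> *\<^sub>R (zg - z) - (1 / \<nu>) *\<^sub>R p) (z - mm - zs)
     = \<delta> * inner (zg - z) (z - mm - zs) - 1 / \<nu> * inner (sg - ss) (z - zs) + 1 / \<nu> * inner p mm"
    unfolding orth'[symmetric] by (simp add: inner_simps algebra_simps diff_divide_distrib add_divide_distrib)
  finally have main: "1 / \<gamma> * (norm (z' - mm' - zs))\<^sup>2 = 1 / \<gamma> * (norm (z - mm - zs))\<^sup>2
      + \<delta> * (2 * inner (zg - z) (z - mm - zs)) - 2 / \<nu> * inner (sg - ss) (z - zs) + 2 / \<nu> * inner p mm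
      + \<gamma> * (norm (\<delta> *\<^sub>R (zg - z) - (1 / \<nu>) *\<^sub>R p))\<^sup>2"
    by simp
  have quad': "\<gamma> * (norm (\<delta> *\<^sub>R (zg - z) - (1 / \<nu>) *\<^sub>R p))\<^sup>2 \<le> \<delta> / 2 * (norm (zg - z))\<^sup>2 + 2 * \<gamma> * chi * q"
  proof -
    have "\<gamma> * (norm (\<delta> *\<^sub>R (zg - z) - (1 / \<nu>) *\<^sub>R p))\<^sup>2 \<le> \<gamma> * (2 * \<delta>\<^sup>2 * (norm (zg - z))\<^sup>2 + 2 * q)"
      using quad pos by (intro mult_left_mono) auto
    also have "\<dots> = (2 * (\<gamma> * \<delta>)) * (\<delta> * (norm (zg - z))\<^sup>2) + (2 * \<gamma> * q) * 1"
      by (simp add: algebra_simps power2_eq_square)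
    also have "\<dots> \<le> (1 / 2) * (\<delta> * (norm (zg - z))\<^sup>2) + (2 * \<gamma> * q) * chi"
      using gd pos q0 by (intro add_mono mult_right_mono mult_left_mono) auto
    finally show ?thesis by (simp add: algebra_simps)
  qed
  have damp': "\<delta> * (2 * inner (zg - z) (z - mm - zs)) \<le> \<delta> * (norm (zg - zs))\<^sup>2 - \<delta> / 2 * (norm (z - mm - zs))\<^sup>2
      - \<delta> / 2 * (norm (zg - z))\<^sup>2 + 3 * \<delta> * (norm mm)\<^sup>2"
    using mult_left_mono[OF damp, of \<delta>] pos by (simp add: algebra_simps)
  have memory': "2 / \<gamma> * (norm mm')\<^sup>2 \<le> 2 / \<gamma> * (norm mm)\<^sup>2 - 1 / (\<gamma> * chi) * (norm mm)\<^sup>2 + 4 * \<gamma> * chi * q"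
    using mult_left_mono[OF memory, of "2 / \<gamma>"] pos by (simp add: field_simps power2_eq_square)
  have small: "3 * \<delta> * (norm mm)\<^sup>2 \<le> 1 / (4 * \<gamma> * chi) * (norm mm)\<^sup>2"
    using pos by (intro mult_right_mono) (auto simp: field_simps)
  have final: "2 / \<gamma> * (1 - 1 / (4 * chi)) * (norm mm)\<^sup>2 = 2 / \<gamma> * (norm mm)\<^sup>2 - 1 / (\<gamma> * chi) * (norm mm)\<^sup>2
      + 1 / (4 * \<gamma> * chi) * (norm mm)\<^sup>2 + 1 / (4 * \<gamma> * chi) * (norm mm)\<^sup>2"
    using pos by (simp add: field_simps)
  have fq: "10 * \<gamma> * chi / \<nu>\<^sup>2 * (norm p)\<^sup>2 = 10 * \<gamma> * chi * q" by (simp add: q_def)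
  have dd: "(1 / \<gamma> - \<delta> / 2) * (norm (z - mm - zs))\<^sup>2
     = 1 / \<gamma> * (norm (z - mm - zs))\<^sup>2 - \<delta> / 2 * (norm (z - mm - zs))\<^sup>2"
    by (simp add: algebra_simps)
  show ?thesis unfolding fq final dd
    using main quad' damp' memory' small mem_cross by linarith
qed


text \<open>
  The form in which each summand of the Lyapunov function is contracted: \<open>c\<close> is its weight before
  the step and \<open>a\<close> what the step inequalities leave of it.
\<close>

lemma contraction_from_slack:
  fixes r c a n :: real
  assumes "r * c \<le> c - a" "0 \<le> n"
  shows "a * n \<le> (1 - r) * (c * n)"
proof -
  have "a \<le> (1 - r) * c" using assms(1) by (simp add: left_diff_distrib)
  from mult_right_mono[OF this assms(2)] show ?thesis by (simp add: mult.assoc)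
qed

text \<open>
  Pure bookkeeping in real numbers: every variable stands for a squared distance, a Bregman
  distance or an inner product in the four step inequalities. Those inequalities are added, the
  one for the coupling divided by \<open>\<nu>\<close>; the products \<open>xy\<close>, \<open>sy\<close> and \<open>sz\<close> cancel. The parameters
  make the remaining positive multiples of \<open>|y' - y|\<^sup>2\<close>, \<open>|p|\<^sup>2\<close>, \<open>|zg - z\<^sup>*|\<^sup>2\<close> and of the
  squared gradient smaller than the negative ones. The rate is limited by the block \<open>z\<close>, where \<open>\<gamma>
  * \<delta> / 2 = \<rho>\<close>.
\<close>

lemma lyapunov_combine:
  fixes L t chi :: real
  assumes pos: "0 < L" "0 < t" "t \<le> 1 / 2" "1 \<le> chi"
    and par: "\<alpha> = 2 * L * t\<^sup>2" "\<eta> = 1 / (8 * L * t)" "\<nu> = 2 * L * t\<^sup>2" "\<theta> = L * t" "\<beta> = 1 / (8 * L)"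
      "\<sigma> = t / (8 * chi)" "\<gamma> = L * t / (2 * chi)" "\<delta> = 1 / (64 * L)" "\<rho> = t / (256 * chi)"
    and nonneg: "0 \<le> nx" "0 \<le> Df" "0 \<le> Dw" "0 \<le> Dg" "0 \<le> ny" "0 \<le> nyf" "0 \<le> nz" "0 \<le> nm"
      "0 \<le> nsf" "0 \<le> nsg" "0 \<le> np" "0 \<le> dy"
    and primal: "(1 / \<eta> + \<alpha>) * nx' + 2 / t * Df' \<le> 1 / \<eta> * nx + (1 / t - 3 / 2) * Df
      + (1 / t + 1 / 2) * (Dw - B) - Dg + 2 * \<eta> * n\<xi> - 2 * x\<xi> + 2 * xy"
    and dual: "(1 / \<theta> + \<beta> / 2) * ny' + \<beta> / (2 * \<sigma>) * nyf' \<le> 1 / \<theta> * ny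
      + \<beta> / 2 * (1 / \<sigma> - 1 / 2) * nyf - \<beta> / 4 * nyg - (1 / \<theta> - \<beta> * \<sigma> / 2) * dy
      + \<beta> * ng - 2 * xy - 2 / \<nu> * sy"
    and coupling: "- 2 * (sy + sz) \<le> (1 / \<sigma> - 1 / 2) * nsf - 1 / \<sigma> * nsf' - 3 / 2 * nsg
      - 1 / (2 * chi * \<sigma>) * np + 9 * chi * \<sigma> * dy"
    and consensus: "1 / \<gamma> * nz' + 2 / \<gamma> * nm' \<le> (1 / \<gamma> - \<delta> / 2) * nz + 2 / \<gamma> * (1 - 1 / (4 * chi)) * nm
      + \<delta> * nzg + 10 * \<gamma> * chi / \<nu>\<^sup>2 * np - 2 / \<nu> * sz"
    and zg: "nzg \<le> 2 * nsg + 2 * nyg"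
    and noise: "ng = gg + 2 * g\<xi> + n\<xi>" "gg \<le> 2 * L * Dg"
  shows "(1 / \<eta> + \<alpha>) * nx' + 2 / t * Df' + (1 / t + 1) * Df + (1 / \<theta> + \<beta> / 2) * ny' + \<beta> / (2 * \<sigma>) * nyf'
      + 1 / \<gamma> * nz' + 2 / \<gamma> * nm' + 1 / (\<nu> * \<sigma>) * nsf'
    \<le> (1 - \<rho>) * ((1 / \<eta> + \<alpha>) * nx + 2 / t * Df + (1 / t + 1) * Dw + (1 / \<theta> + \<beta> / 2) * ny
        + \<beta> / (2 * \<sigma>) * nyf + 1 / \<gamma> * nz + 2 / \<gamma> * nm + 1 / (\<nu> * \<sigma>) * nsf)
      + (2 * \<eta> + \<beta>) * n\<xi> - (1 / t + 1 / 2) * B + (2 * \<beta> * g\<xi> - 2 * x\<xi>)"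
proof -
  have nu: "\<nu> > 0" using pos par by simp
  have rho: "0 \<le> \<rho>" "\<rho> \<le> t / 256"
    unfolding par using pos by (simp_all add: field_simps)
  have tt: "t * t \<le> t / 2" using mult_left_mono[OF pos(3), of t] pos by simp
  have coupling': "- (2 / \<nu>) * (sy + sz) \<le> 1 / (\<nu> * \<sigma>) * nsf - 1 / (2 * \<nu>) * nsf - 1 / (\<nu> * \<sigma>) * nsf'
      - 3 / (2 * \<nu>) * nsg - 1 / (2 * chi * \<sigma> * \<nu>) * np + 9 * chi * \<sigma> / \<nu> * dy"
  proof -
    have "(1 / \<nu>) * (- 2 * (sy + sz)) \<le> (1 / \<nu>) * ((1 / \<sigma> - 1 / 2) * nsf - 1 / \<sigma> * nsf' - 3 / 2 * nsg
      - 1 / (2 * chi * \<sigma>) * np + 9 * chi * \<sigma> * dy)"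
      using coupling nu by (intro mult_left_mono) auto
    also have "\<dots> = 1 / (\<nu> * \<sigma>) * nsf - 1 / (2 * \<nu>) * nsf - 1 / (\<nu> * \<sigma>) * nsf'
      - 3 / (2 * \<nu>) * nsg - 1 / (2 * chi * \<sigma> * \<nu>) * np + 9 * chi * \<sigma> / \<nu> * dy"
      by (simp add: distrib_left right_diff_distrib left_diff_distrib mult.assoc)
         (simp add: mult_ac)
    also have "(1 / \<nu>) * (- 2 * (sy + sz)) = - (2 / \<nu>) * (sy + sz)" using nu by (simp add: field_simps)
    finally show ?thesis .
  qed
  \<comment> \<open>each remaining positive term is dominated by a negative one\<close>
  have slack_dy: "9 * chi * \<sigma> / \<nu> * dy \<le> (1 / \<theta> - \<beta> * \<sigma> / 2) * dy"
  proof (rule mult_right_mono)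
    have 1: "9 * chi * \<sigma> / \<nu> = 9 / 16 * (1 / (L * t))"
      unfolding par using pos by (simp add: field_simps power2_eq_square)
    have "\<beta> * \<sigma> / 2 = (t * t / (128 * chi)) * (1 / (L * t))"
      unfolding par using pos by (simp add: field_simps)
    moreover have "(t * t / (128 * chi)) * (1 / (L * t)) \<le> 1 / 4 * (1 / (L * t))"
    proof (rule mult_right_mono)
      have "t * t \<le> 1 * 1" using pos by (intro mult_mono) auto
      then have "t * t / (128 * chi) \<le> 1 / (128 * 1)" using pos by (intro frac_le) auto
      then show "t * t / (128 * chi) \<le> 1 / 4" by simp
    qed (use pos in simp)
    ultimately have 2: "\<beta> * \<sigma> / 2 \<le> 1 / 4 * (1 / (L * t))" by linarith
    define k where "k = 1 / (L * t)"
    have k: "k > 0" "1 / \<theta> = k" using pos par(4) by (simp_all add: k_def)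
    show "9 * chi * \<sigma> / \<nu> \<le> 1 / \<theta> - \<beta> * \<sigma> / 2"
      unfolding 1 k(2) k_def[symmetric] using 2[folded k_def] k(1) by linarith
  qed (use nonneg in simp)
  have slack_np: "10 * \<gamma> * chi / \<nu>\<^sup>2 * np \<le> 1 / (2 * chi * \<sigma> * \<nu>) * np"
  proof (rule mult_right_mono)
    have "10 * \<gamma> * chi / \<nu>\<^sup>2 = 5 / 4 * (1 / (L * t * t * t))" "1 / (2 * chi * \<sigma> * \<nu>) = 2 * (1 / (L * t * t * t))"
      unfolding par using pos by (simp_all add: field_simps power2_eq_square)
    moreover have "5 / 4 * (1 / (L * t * t * t)) \<le> 2 * (1 / (L * t * t * t))"
      using pos by (intro mult_right_mono) auto
    ultimately show "10 * \<gamma> * chi / \<nu>\<^sup>2 \<le> 1 / (2 * chi * \<sigma> * \<nu>)" by simp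
  qed (use nonneg in simp)
  have slack_zg: "\<delta> * nzg \<le> 3 / (2 * \<nu>) * nsg + \<beta> / 4 * nyg"
  proof -
    have "\<delta> * nzg \<le> \<delta> * (2 * nsg + 2 * nyg)" using zg pos par by (intro mult_left_mono) auto
    also have "\<dots> = 2 * \<delta> * nsg + \<beta> / 4 * nyg" unfolding par using pos by (simp add: field_simps)
    also have "2 * \<delta> * nsg \<le> 3 / (2 * \<nu>) * nsg"
    proof (rule mult_right_mono)
      have "t * t \<le> 1 * 1" using pos by (intro mult_mono) auto
      then show "2 * \<delta> \<le> 3 / (2 * \<nu>)" unfolding par using pos by (simp add: field_simps power2_eq_square)
    qed (use nonneg in simp)
    finally show ?thesis by simp
  qed
  have slack_g: "\<beta> * gg \<le> Dg"
  proof -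
    have "\<beta> * gg \<le> \<beta> * (2 * L * Dg)" using noise pos par by (intro mult_left_mono) auto
    also have "\<dots> = Dg / 4" using pos par by simp
    finally show ?thesis using nonneg by linarith
  qed
  have ng: "\<beta> * ng = \<beta> * gg + 2 * \<beta> * g\<xi> + \<beta> * n\<xi>" by (simp add: noise algebra_simps)
  have c_x: "1 / \<eta> * nx \<le> (1 - \<rho>) * ((1 / \<eta> + \<alpha>) * nx)"
  proof -
    have "\<rho> * (1 / \<eta> + \<alpha>) \<le> \<alpha>"
    proof -
      have "1 / \<eta> + \<alpha> \<le> 16 * L * t" unfolding par using pos tt by (simp add: field_simps power2_eq_square)
      then have "\<rho> * (1 / \<eta> + \<alpha>) \<le> (t / 256) * (16 * L * t)"
        using rho pos par by (intro mult_mono) auto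
      also have "\<dots> \<le> \<alpha>" unfolding par using pos by (simp add: field_simps power2_eq_square)
      finally show ?thesis .
    qed
    then have "\<rho> * (1 / \<eta> + \<alpha>) \<le> (1 / \<eta> + \<alpha>) - 1 / \<eta>" by simp
    then show ?thesis using nonneg(1) by (rule contraction_from_slack)
  qed
  have c_f: "(1 / t - 3 / 2) * Df + (1 / t + 1) * Df \<le> (1 - \<rho>) * (2 / t * Df)"
  proof -
    have "\<rho> * (2 / t) \<le> (t / 256) * (2 / t)" using rho pos by (intro mult_right_mono) auto
    then have "\<rho> * (2 / t) \<le> 1 / 2" using pos by simp
    then have "\<rho> * (2 / t) \<le> 2 / t - ((1 / t - 3 / 2) + (1 / t + 1))" by simp
    from contraction_from_slack[OF this nonneg(2)] show ?thesis by (simp only: distrib_right)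
  qed
  have c_w: "(1 / t + 1 / 2) * (Dw - B) \<le> (1 - \<rho>) * ((1 / t + 1) * Dw) - (1 / t + 1 / 2) * B"
  proof -
    have "1 / t + 1 \<le> 2 / t" using pos by (simp add: field_simps)
    then have "\<rho> * (1 / t + 1) \<le> (t / 256) * (2 / t)" using rho pos by (intro mult_mono) auto
    also have "\<dots> = 1 / 128" using pos by simp
    finally have "\<rho> * (1 / t + 1) \<le> 1 / 2" by linarith
    then have "\<rho> * (1 / t + 1) \<le> (1 / t + 1) - (1 / t + 1 / 2)" by simp
    from contraction_from_slack[OF this nonneg(3)] show ?thesis by (simp only: right_diff_distrib)
  qed
  have c_y: "1 / \<theta> * ny \<le> (1 - \<rho>) * ((1 / \<theta> + \<beta> / 2) * ny)"
  proof -
    have "1 / \<theta> + \<beta> / 2 \<le> 2 / (L * t)" unfolding par using pos by (simp add: field_simps)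
    then have "\<rho> * (1 / \<theta> + \<beta> / 2) \<le> (t / 256) * (2 / (L * t))"
      using rho pos par by (intro mult_mono) auto
    also have "\<dots> \<le> \<beta> / 2" unfolding par using pos by (simp add: field_simps)
    finally have "\<rho> * (1 / \<theta> + \<beta> / 2) \<le> (1 / \<theta> + \<beta> / 2) - 1 / \<theta>" by simp
    then show ?thesis using nonneg(5) by (rule contraction_from_slack)
  qed
  have "\<rho> * (1 / \<sigma>) = 1 / 32" unfolding par using pos by (simp add: field_simps)
  then have rs: "\<rho> * (1 / \<sigma>) \<le> 1 / \<sigma> - (1 / \<sigma> - 1 / 2)" by linarith
  have c_yf: "\<beta> / 2 * (1 / \<sigma> - 1 / 2) * nyf \<le> (1 - \<rho>) * (\<beta> / (2 * \<sigma>) * nyf)"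
  proof -
    have "0 \<le> \<beta> / 2 * nyf" using nonneg pos par by simp
    from contraction_from_slack[OF rs this] show ?thesis by (simp add: mult_ac)
  qed
  have c_sf: "1 / (\<nu> * \<sigma>) * nsf - 1 / (2 * \<nu>) * nsf \<le> (1 - \<rho>) * (1 / (\<nu> * \<sigma>) * nsf)"
  proof -
    have "0 \<le> 1 / \<nu> * nsf" using nonneg nu by simp
    from contraction_from_slack[OF rs this] show ?thesis by (simp add: right_diff_distrib mult_ac)
  qed
  have c_z: "(1 / \<gamma> - \<delta> / 2) * nz \<le> (1 - \<rho>) * (1 / \<gamma> * nz)"
  proof -
    have "\<rho> / \<gamma> = \<delta> / 2" unfolding par using pos by (simp add: field_simps)
    then have "\<rho> * (1 / \<gamma>) \<le> 1 / \<gamma> - (1 / \<gamma> - \<delta> / 2)" by simp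
    then show ?thesis using nonneg(7) by (rule contraction_from_slack)
  qed
  have c_m: "2 / \<gamma> * (1 - 1 / (4 * chi)) * nm \<le> (1 - \<rho>) * (2 / \<gamma> * nm)"
  proof -
    have "\<rho> \<le> 1 / (4 * chi)" unfolding par using pos by (simp add: field_simps)
    then have "(2 / \<gamma> * nm) * (1 - 1 / (4 * chi)) \<le> (2 / \<gamma> * nm) * (1 - \<rho>)"
      using nonneg pos par by (intro mult_left_mono) auto
    then show ?thesis by (simp add: mult_ac)
  qed
  have "2 / \<nu> * sy + 2 / \<nu> * sz = - (- (2 / \<nu>) * (sy + sz))" by (simp add: distrib_left)
  with coupling' have coup: "- (2 / \<nu> * sy + 2 / \<nu> * sz) \<le> 1 / (\<nu> * \<sigma>) * nsf - 1 / (2 * \<nu>) * nsf - 1 / (\<nu> * \<sigma>) * nsf'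
      - 3 / (2 * \<nu>) * nsg - 1 / (2 * chi * \<sigma> * \<nu>) * np + 9 * chi * \<sigma> / \<nu> * dy"
    by linarith
  have lin: "(2 * \<eta> + \<beta>) * n\<xi> = 2 * \<eta> * n\<xi> + \<beta> * n\<xi>" by (rule distrib_right)
  show ?thesis
    unfolding distrib_left[of "1 - \<rho>"] lin
    using primal dual consensus coup slack_dy slack_np slack_zg slack_g ng
      c_x c_f c_w c_y c_yf c_sf c_z c_m
    by linarith
qed

section \<open>Convex and smooth functions on Euclidean space\<close>

text \<open>
  The gradient \<open>G\<close> of \<open>g\<close> is a parameter, so that it can be taken relative to a subspace.
\<close>

definition bregman :: "('a::real_inner \<Rightarrow> real) \<Rightarrow> ('a \<Rightarrow> 'a) \<Rightarrow> 'a \<Rightarrow> 'a \<Rightarrow> real" where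
  "bregman g G a b = g a - g b - inner (G b) (a - b)"

lemma bregman_three_points:
  "inner (G b - G c) (a - b) = bregman g G a c - bregman g G b c - bregman g G a b"
  by (simp add: bregman_def inner_diff_left inner_diff_right)

text \<open>
  Compare \<open>g\<close> at \<open>b\<close> with \<open>g\<close> at \<open>c = a - (G a - G b) / l\<close>, the minimizer of the quadratic upper
  bound at \<open>a\<close> after the linear part at \<open>b\<close> has been removed. Only bounds for Bregman distances
  enter, so the lemma also covers the difference of a smooth function and a quadratic.
\<close>

lemma cocoercive:
  fixes G :: "'a::real_inner \<Rightarrow> 'a"
  assumes S: "subspace S" "a \<in> S" "b \<in> S" "\<And>u. u \<in> S \<Longrightarrow> G u \<in> S"
    and l: "0 < l"
    and lower: "\<And>u v. u \<in> S \<Longrightarrow> v \<in> S \<Longrightarrow> 0 \<le> bregman g G u v"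
    and upper: "\<And>u v. u \<in> S \<Longrightarrow> v \<in> S \<Longrightarrow> bregman g G u v \<le> l / 2 * (norm (u - v))\<^sup>2"
  shows "(norm (G a - G b))\<^sup>2 \<le> 2 * l * bregman g G a b"
proof -
  define c where "c = a - (1 / l) *\<^sub>R (G a - G b)"
  have c: "c \<in> S" unfolding c_def using S by (intro subspace_diff subspace_scale) auto
  have "0 \<le> bregman g G c b" by (rule lower[OF c S(3)])
  also have "\<dots> = inner (G a - G b) (c - a) + bregman g G a b + bregman g G c a"
    using bregman_three_points[of G a b c g] by simp
  also have "bregman g G c a \<le> l / 2 * (norm (c - a))\<^sup>2" by (rule upper[OF c S(2)])
  also have "(norm (c - a))\<^sup>2 = 1 / l\<^sup>2 * (norm (G a - G b))\<^sup>2"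
    unfolding c_def by (simp add: power_divide)
  also have "inner (G a - G b) (c - a) = - (1 / l) * (norm (G a - G b))\<^sup>2"
    unfolding c_def by (simp add: power2_norm_eq_inner)
  finally show ?thesis using l by (simp add: field_simps power2_eq_square)
qed

lemma grad_in_Rd: "u \<in> Rd d \<Longrightarrow> smooth d l g \<Longrightarrow> grad d g u \<in> Rd d"
  using has_gradient_grad[of u d g] by (simp add: smooth_def has_gradient_def)

lemma segment_in_Rd: "u \<in> Rd d \<Longrightarrow> v \<in> Rd d \<Longrightarrow> u + r *\<^sub>R (v - u) \<in> Rd d"
  by (intro subspace_add subspace_scale subspace_diff subspace_Rd)

text \<open>
  Derivatives exist only within \<^term>\<open>Rd d\<close>; restricted to a line of that subspace they become
  ordinary derivatives on the reals, and one-dimensional calculus applies.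
\<close>

lemma line_derivative:
  assumes "u \<in> Rd d" "v \<in> Rd d" "smooth d l g"
  shows "((\<lambda>r. g (u + r *\<^sub>R (v - u))) has_real_derivative
           inner (grad d g (u + r *\<^sub>R (v - u))) (v - u)) (at r)"
proof -
  have "(g has_derivative inner (grad d g (u + r *\<^sub>R (v - u)))) (at (u + r *\<^sub>R (v - u)) within Rd d)"
    using has_gradient_grad[OF segment_in_Rd[OF assms(1,2)]] segment_in_Rd[OF assms(1,2)] assms(3)
    by (auto simp: smooth_def has_gradient_def)
  then have outer: "(g has_derivative inner (grad d g (u + r *\<^sub>R (v - u))))
      (at (u + r *\<^sub>R (v - u)) within (\<lambda>r. u + r *\<^sub>R (v - u)) ` UNIV)"
    by (rule has_derivative_subset) (auto intro: segment_in_Rd assms)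
  have "((\<lambda>r::real. u + r *\<^sub>R (v - u)) has_derivative (\<lambda>h. h *\<^sub>R (v - u))) (at r)"
    by (auto intro!: derivative_eq_intros)
  from has_derivative_in_compose[OF this outer]
  have "((\<lambda>r. g (u + r *\<^sub>R (v - u))) has_derivative
      (\<lambda>h. inner (grad d g (u + r *\<^sub>R (v - u))) (h *\<^sub>R (v - u)))) (at r)"
    .
  then show ?thesis
    by (rule has_derivative_imp_has_field_derivative) simp
qed

lemma smooth_bregman_le:
  assumes u: "u \<in> Rd d" "v \<in> Rd d" and g: "smooth d l g"
  shows "bregman g (grad d g) v u \<le> l / 2 * (norm (v - u))\<^sup>2"
proof -
  define \<phi> where "\<phi> r = g (u + r *\<^sub>R (v - u)) - r * inner (grad d g u) (v - u)
    - l / 2 * r\<^sup>2 * (norm (v - u))\<^sup>2" for r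
  define \<phi>' where "\<phi>' r = inner (grad d g (u + r *\<^sub>R (v - u))) (v - u) - inner (grad d g u) (v - u)
    - l * r * (norm (v - u))\<^sup>2" for r
  have der: "(\<phi> has_real_derivative \<phi>' r) (at r)" for r
    unfolding \<phi>_def[abs_def] \<phi>'_def
    by (rule derivative_eq_intros line_derivative[OF u g] refl | simp)+
  have neg: "\<phi>' r \<le> 0" if "0 \<le> r" for r
  proof -
    have "inner (grad d g (u + r *\<^sub>R (v - u)) - grad d g u) (v - u)
      \<le> norm (grad d g (u + r *\<^sub>R (v - u)) - grad d g u) * norm (v - u)"
      by (rule norm_cauchy_schwarz)
    also have "\<dots> \<le> (l * norm (u + r *\<^sub>R (v - u) - u)) * norm (v - u)"
    proof (rule mult_right_mono)
      show "norm (grad d g (u + r *\<^sub>R (v - u)) - grad d g u) \<le> l * norm (u + r *\<^sub>R (v - u) - u)"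
        using g segment_in_Rd[OF u, of r] u(1) unfolding smooth_def by blast
    qed simp
    also have "\<dots> = l * r * (norm (v - u))\<^sup>2" using that by (simp add: power2_eq_square)
    finally show ?thesis by (simp add: \<phi>'_def inner_diff_left)
  qed
  have "\<phi> 1 \<le> \<phi> 0"
    using der neg by (intro DERIV_nonpos_imp_nonincreasing[of 0 1]) auto
  then show ?thesis by (simp add: \<phi>_def bregman_def)
qed

lemma convex_bregman_nonneg:
  assumes u: "u \<in> Rd d" "v \<in> Rd d" and g: "smooth d l g" "convex_on (Rd d) g"
  shows "0 \<le> bregman g (grad d g) v u"
proof -
  define \<phi> where "\<phi> r = g (u + r *\<^sub>R (v - u))" for r
  have conv: "convex_on UNIV \<phi>"
  proof (rule convex_onI)
    fix r x y :: real assume r: "0 < r" "r < 1"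
    have "u + ((1 - r) *\<^sub>R x + r *\<^sub>R y) *\<^sub>R (v - u)
        = (1 - r) *\<^sub>R (u + x *\<^sub>R (v - u)) + r *\<^sub>R (u + y *\<^sub>R (v - u))"
      by (simp add: algebra_simps)
    then show "\<phi> ((1 - r) *\<^sub>R x + r *\<^sub>R y) \<le> (1 - r) * \<phi> x + r * \<phi> y"
      unfolding \<phi>_def using convex_onD[OF g(2), of r] r segment_in_Rd[OF u] by simp
  qed simp
  have "(\<phi> has_real_derivative inner (grad d g u) (v - u)) (at 0)"
    unfolding \<phi>_def[abs_def] using line_derivative[OF u g(1), of 0] by simp
  then have "\<phi> 1 - \<phi> 0 \<ge> inner (grad d g u) (v - u) * (1 - 0)"
    by (intro convex_on_imp_above_tangent[OF conv]) auto
  then show ?thesis by (simp add: \<phi>_def bregman_def)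
qed

lemma Rd_nontrivial:
  assumes "1 \<le> d"
  shows "\<exists>e\<in>Rd d. e \<noteq> 0"
proof -
  define e where "e = Abs_fseq (\<lambda>j. if j = 0 then 1 else 0)"
  have e: "coord e j = (if j = 0 then 1 else 0)" for j
    unfolding e_def by (subst Abs_fseq_inverse) auto
  have "e \<noteq> 0" using e[of 0] by auto
  moreover have "e \<in> Rd d" using assms by (auto simp: Rd_def e)
  ultimately show ?thesis by blast
qed

lemma smooth_nonneg:
  assumes "1 \<le> d" "smooth d l g"
  shows "0 \<le> l"
proof -
  obtain e where e: "e \<in> Rd d" "e \<noteq> 0" using Rd_nontrivial[OF assms(1)] by blast
  have "0 \<le> norm (grad d g e - grad d g 0)" by simp
  also have "\<dots> \<le> l * norm (e - 0)"
    using assms(2) e(1) subspace_0[OF subspace_Rd] unfolding smooth_def by blast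
  finally show ?thesis using e(2) by (simp add: zero_le_mult_iff)
qed

text \<open>
  Both constants bound the same Bregman distance at a nonzero vector, which exists as the
  dimension is positive.
\<close>

lemma strongly_convex_le_smooth:
  assumes "1 \<le> d" "smooth d l g" "strongly_convex d \<mu> g"
  shows "\<mu> \<le> l"
proof -
  obtain e where e: "e \<in> Rd d" "e \<noteq> 0" using Rd_nontrivial[OF assms(1)] by blast
  have z: "0 \<in> Rd d" by (rule subspace_0[OF subspace_Rd])
  have "bregman g (grad d g) e 0 \<le> l / 2 * (norm (e - 0))\<^sup>2"
    by (rule smooth_bregman_le[OF z e(1) assms(2)])
  moreover have "bregman g (grad d g) e 0 \<ge> \<mu> / 2 * (norm (e - 0))\<^sup>2"
    using assms(3) e(1) z unfolding strongly_convex_def bregman_def by (smt (verit))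
  ultimately have "\<mu> / 2 * (norm e)\<^sup>2 \<le> l / 2 * (norm e)\<^sup>2" by simp
  then show ?thesis using e(2) by simp
qed

lemma grad_F_node:
  assumes u: "u \<in> Rd d" and f: "\<forall>j<n. smooth d (Lf j) (f i j)"
  shows "grad d (F_node n f i) u = (1 / real n) *\<^sub>R (\<Sum>j<n. grad d (f i j) u)"
proof -
  have h: "has_gradient d (f i j) (grad d (f i j) u) u" if "j < n" for j
    using has_gradient_grad[OF u, of "f i j"] f that u by (auto simp: smooth_def)
  have "has_gradient d (F_node n f i) ((1 / real n) *\<^sub>R (\<Sum>j<n. grad d (f i j) u)) u"
    unfolding has_gradient_def
  proof
    show "(1 / real n) *\<^sub>R (\<Sum>j<n. grad d (f i j) u) \<in> Rd d"
      using h by (intro subspace_scale subspace_sum subspace_Rd) (auto simp: has_gradient_def)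
    have "((\<lambda>v. (1 / real n) * (\<Sum>j<n. f i j v)) has_derivative
        (\<lambda>k. (1 / real n) * (\<Sum>j<n. inner (grad d (f i j) u) k))) (at u within Rd d)"
      using h by (intro has_derivative_mult_right has_derivative_sum) (auto simp: has_gradient_def)
    then show "(F_node n f i has_derivative (\<lambda>k. inner ((1 / real n) *\<^sub>R (\<Sum>j<n. grad d (f i j) u)) k)) (at u within Rd d)"
      by (simp add: F_node_def[abs_def] inner_sum_left)
  qed
  then show ?thesis
    unfolding grad_def using has_gradient_unique[OF u] by (metis the_equality)
qed

text \<open>
  Otherwise a gradient step of length \<open>1 / (m * l)\<close> would decrease the sum below its minimum, by
  the quadratic upper bounds.
\<close>

lemma sum_grad_at_minimizer:
  fixes m :: nat
  assumes u: "is_arg_min (\<lambda>v. \<Sum>i<m. F i v) (\<lambda>v. v \<in> Rd d) u"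
    and F: "\<forall>i<m. smooth d l (F i)" and l: "0 < l"
  shows "(\<Sum>i<m. grad d (F i) u) = 0"
proof (cases "m = 0")
  case False
  have ud: "u \<in> Rd d" and min: "v \<in> Rd d \<Longrightarrow> (\<Sum>i<m. F i u) \<le> (\<Sum>i<m. F i v)" for v
    using u by (auto simp: is_arg_min_def not_less)
  define G where "G = (\<Sum>i<m. grad d (F i) u)"
  define r where "r = 1 / (real m * l)"
  define v where "v = u - r *\<^sub>R G"
  have G: "G \<in> Rd d" unfolding G_def using F by (intro subspace_sum subspace_Rd grad_in_Rd[OF ud]) auto
  have v: "v \<in> Rd d" unfolding v_def using G ud by (intro subspace_diff subspace_scale subspace_Rd)
  have "(\<Sum>i<m. F i v) \<le> (\<Sum>i<m. F i u + inner (grad d (F i) u) (v - u) + l / 2 * (norm (v - u))\<^sup>2)"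
  proof (rule sum_mono)
    fix i assume "i \<in> {..<m}"
    then have "bregman (F i) (grad d (F i)) v u \<le> l / 2 * (norm (v - u))\<^sup>2"
      using F by (intro smooth_bregman_le[OF ud v]) auto
    then show "F i v \<le> F i u + inner (grad d (F i) u) (v - u) + l / 2 * (norm (v - u))\<^sup>2"
      by (simp add: bregman_def)
  qed
  also have "\<dots> = (\<Sum>i<m. F i u) + inner G (v - u) + real m * (l / 2 * (norm (v - u))\<^sup>2)"
    by (simp add: sum.distrib G_def inner_sum_left)
  also have "inner G (v - u) = - r * (norm G)\<^sup>2"
    by (simp add: v_def power2_norm_eq_inner)
  also have "real m * (l / 2 * (norm (v - u))\<^sup>2) = r / 2 * (norm G)\<^sup>2"
    using False l by (simp add: v_def r_def power2_eq_square power_mult_distrib)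
  finally have "r / 2 * (norm G)\<^sup>2 \<le> 0" using min[OF v] by simp
  moreover have "r > 0" using False l by (simp add: r_def)
  ultimately have "(norm G)\<^sup>2 \<le> 0" by (simp add: mult_le_0_iff)
  then show ?thesis by (simp add: G_def)
qed simp

section \<open>Moments of independent samples\<close>

lemma expectation_finite:
  fixes h :: "'a \<Rightarrow> real"
  assumes "finite A" "set_pmf p \<subseteq> A"
  shows "measure_pmf.expectation p h = (\<Sum>a\<in>A. pmf p a * h a)"
  using integral_measure_pmf[OF assms(1), of p h] assms(2) by auto

lemma Pi_pmf_pair_components:
  assumes "finite A" "a \<in> A" "a' \<in> A" "a \<noteq> a'"
  shows "map_pmf (\<lambda>S. (S a, S a')) (Pi_pmf A d p) = pair_pmf (p a) (p a')"
proof -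
  have "Pi_pmf A d p = Pi_pmf (insert a (A - {a})) d p" using assms by (simp add: insert_absorb)
  also have "\<dots> = map_pmf (\<lambda>(y, S). S(a := y)) (pair_pmf (p a) (Pi_pmf (A - {a}) d p))"
    using assms by (intro Pi_pmf_insert) auto
  finally have "map_pmf (\<lambda>S. (S a, S a')) (Pi_pmf A d p)
      = map_pmf (\<lambda>(y, S). (y, S a')) (pair_pmf (p a) (Pi_pmf (A - {a}) d p))"
    using assms(4) by (simp add: map_pmf_comp case_prod_unfold)
  also have "\<dots> = pair_pmf (p a) (map_pmf (\<lambda>S. S a') (Pi_pmf (A - {a}) d p))"
    by (simp add: pair_map_pmf2 apsnd_def map_prod_def)
  also have "map_pmf (\<lambda>S. S a') (Pi_pmf (A - {a}) d p) = p a'"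
    using assms by (subst Pi_pmf_component) auto
  finally show ?thesis .
qed

text \<open>
  Inner products stand in for vector valued expectations: Bochner integrals live in complete
  spaces, and finitely supported sequences do not form one.
\<close>

lemma expectation_inner_zero_mean:
  fixes U :: "'b \<Rightarrow> 'v::real_inner"
  assumes "finite B" "set_pmf p \<subseteq> B" "(\<Sum>j\<in>B. pmf p j *\<^sub>R U j) = 0"
  shows "measure_pmf.expectation p (\<lambda>j. inner (U j) v) = 0"
proof -
  have "measure_pmf.expectation p (\<lambda>j. inner (U j) v) = inner (\<Sum>j\<in>B. pmf p j *\<^sub>R U j) v"
    by (simp add: expectation_finite[OF assms(1,2)] inner_sum_left)
  then show ?thesis using assms(3) by simp
qed

text \<open>
  Pythagoras for centered independent vectors: in the expansion of the square, independence kills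
  the mixed terms.
\<close>

lemma expectation_norm_sq_sum_independent:
  fixes U :: "'a \<Rightarrow> 'b \<Rightarrow> 'v::real_inner"
  assumes I: "finite I" "J \<subseteq> I" and B: "\<And>a. a \<in> I \<Longrightarrow> finite (set_pmf (p a))"
    and mean: "\<And>a v. a \<in> J \<Longrightarrow> measure_pmf.expectation (p a) (\<lambda>j. inner (U a j) v) = 0"
  shows "measure_pmf.expectation (Pi_pmf I d p) (\<lambda>S. (norm (\<Sum>a\<in>J. U a (S a)))\<^sup>2)
       = (\<Sum>a\<in>J. measure_pmf.expectation (p a) (\<lambda>j. (norm (U a j))\<^sup>2))"
proof -
  have J: "finite J" using I by (rule finite_subset[rotated])
  have fin: "finite (set_pmf (Pi_pmf I d p))"
    using I(1) B by (simp add: set_Pi_pmf finite_PiE_dflt)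
  \<comment> \<open>conditionally on the coordinate \<open>a'\<close>, the coordinate \<open>a\<close> still has mean zero\<close>
  have off: "measure_pmf.expectation (Pi_pmf I d p) (\<lambda>S. inner (U a (S a)) (U a' (S a'))) = 0"
    if "a \<in> J" "a' \<in> J" "a \<noteq> a'" for a a'
  proof -
    have aI: "a \<in> I" "a' \<in> I" using that I by auto
    have "measure_pmf.expectation (Pi_pmf I d p) (\<lambda>S. inner (U a (S a)) (U a' (S a')))
        = measure_pmf.expectation (map_pmf (\<lambda>S. (S a, S a')) (Pi_pmf I d p)) (\<lambda>(j, j'). inner (U a j) (U a' j'))"
      by simp
    also have "\<dots> = measure_pmf.expectation (pair_pmf (p a) (p a')) (\<lambda>(j, j'). inner (U a j) (U a' j'))"
      unfolding Pi_pmf_pair_components[OF I(1) aI that(3)] ..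
    also have "pair_pmf (p a) (p a') = bind_pmf (p a') (\<lambda>j'. map_pmf (\<lambda>j. (j, j')) (p a))"
      by (subst pair_commute_pmf) (simp add: pair_pmf_def map_bind_pmf map_pmf_def bind_assoc_pmf bind_return_pmf)
    also have "measure_pmf.expectation \<dots> (\<lambda>(j, j'). inner (U a j) (U a' j'))
       = (\<Sum>j'\<in>set_pmf (p a'). pmf (p a') j' *\<^sub>R
            measure_pmf.expectation (map_pmf (\<lambda>j. (j, j')) (p a)) (\<lambda>(j, j'). inner (U a j) (U a' j')))"
      using B aI by (intro pmf_expectation_bind) auto
    also have "\<dots> = 0" using mean[OF that(1)] by simp
    finally show ?thesis .
  qed
  have "measure_pmf.expectation (Pi_pmf I d p) (\<lambda>S. (norm (\<Sum>a\<in>J. U a (S a)))\<^sup>2)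
      = measure_pmf.expectation (Pi_pmf I d p) (\<lambda>S. \<Sum>a\<in>J. \<Sum>a'\<in>J. inner (U a (S a)) (U a' (S a')))"
    unfolding power2_norm_eq_inner inner_sum_left unfolding inner_sum_right ..
  also have "\<dots> = (\<Sum>a\<in>J. \<Sum>a'\<in>J. measure_pmf.expectation (Pi_pmf I d p) (\<lambda>S. inner (U a (S a)) (U a' (S a'))))"
    by (simp add: integrable_measure_pmf_finite[OF fin])
  also have "\<dots> = (\<Sum>a\<in>J. measure_pmf.expectation (Pi_pmf I d p) (\<lambda>S. inner (U a (S a)) (U a (S a))))"
  proof (rule sum.cong[OF refl])
    fix a assume a: "a \<in> J"
    have "(\<Sum>a'\<in>J. measure_pmf.expectation (Pi_pmf I d p) (\<lambda>S. inner (U a (S a)) (U a' (S a'))))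
        = (\<Sum>a'\<in>{a}. measure_pmf.expectation (Pi_pmf I d p) (\<lambda>S. inner (U a (S a)) (U a' (S a'))))"
      using a J off[OF a] by (intro sum.mono_neutral_right) auto
    then show "(\<Sum>a'\<in>J. measure_pmf.expectation (Pi_pmf I d p) (\<lambda>S. inner (U a (S a)) (U a' (S a'))))
        = measure_pmf.expectation (Pi_pmf I d p) (\<lambda>S. inner (U a (S a)) (U a (S a)))" by simp
  qed
  also have "\<dots> = (\<Sum>a\<in>J. measure_pmf.expectation (p a) (\<lambda>j. (norm (U a j))\<^sup>2))"
  proof (rule sum.cong[OF refl])
    fix a assume "a \<in> J"
    then have "map_pmf (\<lambda>S. S a) (Pi_pmf I d p) = p a"
      using I by (subst Pi_pmf_component) auto
    then have "measure_pmf.expectation (p a) (\<lambda>j. (norm (U a j))\<^sup>2)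
        = measure_pmf.expectation (map_pmf (\<lambda>S. S a) (Pi_pmf I d p)) (\<lambda>j. (norm (U a j))\<^sup>2)"
      by simp
    then show "measure_pmf.expectation (Pi_pmf I d p) (\<lambda>S. inner (U a (S a)) (U a (S a)))
        = measure_pmf.expectation (p a) (\<lambda>j. (norm (U a j))\<^sup>2)"
      by (simp add: power2_norm_eq_inner)
  qed
  finally show ?thesis .
qed

lemma expectation_norm_sq_centered:
  fixes X :: "'b \<Rightarrow> 'v::real_inner"
  assumes B: "finite B" "set_pmf p \<subseteq> B"
  shows "measure_pmf.expectation p (\<lambda>j. (norm (X j - (\<Sum>l\<in>B. pmf p l *\<^sub>R X l)))\<^sup>2)
     \<le> (\<Sum>j\<in>B. pmf p j * (norm (X j))\<^sup>2)"
proof -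
  define c where "c = (\<Sum>l\<in>B. pmf p l *\<^sub>R X l)"
  have "measure_pmf.expectation p (\<lambda>j. (norm (X j - c))\<^sup>2) = (\<Sum>j\<in>B. pmf p j * (norm (X j - c))\<^sup>2)"
    by (rule expectation_finite[OF B])
  also have "\<dots> = (\<Sum>j\<in>B. pmf p j * (norm (X j))\<^sup>2 - 2 * inner (pmf p j *\<^sub>R X j) c + pmf p j * (norm c)\<^sup>2)"
    by (intro sum.cong) (auto simp: power2_norm_eq_inner inner_simps inner_commute algebra_simps)
  also have "\<dots> = (\<Sum>j\<in>B. pmf p j * (norm (X j))\<^sup>2) - 2 * inner c c + (\<Sum>j\<in>B. pmf p j) * (norm c)\<^sup>2"
    by (simp only: sum.distrib sum_subtractf c_def[symmetric] sum_distrib_left[symmetric]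
        inner_sum_left[symmetric] sum_distrib_right)
  also have "(\<Sum>j\<in>B. pmf p j) = 1" by (rule sum_pmf_eq_1[OF B])
  finally show ?thesis by (simp add: c_def[symmetric] power2_norm_eq_inner)
qed

section \<open>Stacked vectors and gossip\<close>

text \<open>
  All nodes together form one vector. It is encoded in the same space of finitely supported
  sequences, with the coordinate \<open>j\<close> of node \<open>i\<close> at the position \<open>prod_encode (i, j)\<close>, so that the
  inequalities for one iteration apply to stacked vectors with their inner product.
\<close>

definition stack :: "nat \<Rightarrow> (nat \<Rightarrow> fseq) \<Rightarrow> fseq" where
  "stack m x = Abs_fseq (\<lambda>k. case prod_decode k of (i, j) \<Rightarrow> if i < m then coord (x i) j else 0)"

lemma finite_stack_support:
  fixes m :: nat and x :: "nat \<Rightarrow> fseq"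
  shows
  "finite (SIGMA i:{..<m}. {j. coord (x i) j \<noteq> 0})"
  by (intro finite_SigmaI finite_support) simp

lemma stack_support:
  "{k. (case prod_decode k of (i, j) \<Rightarrow> if i < m then coord (x i) j else 0) \<noteq> 0}
    = prod_encode ` (SIGMA i:{..<m}. {j. coord (x i) j \<noteq> 0})"
proof (intro set_eqI iffI)
  fix k assume k: "k \<in> {k. (case prod_decode k of (i, j) \<Rightarrow> if i < m then coord (x i) j else 0) \<noteq> 0}"
  obtain i j where ij: "prod_decode k = (i, j)" by force
  then have "k = prod_encode (i, j)" by (metis prod_decode_inverse)
  then show "k \<in> prod_encode ` (SIGMA i:{..<m}. {j. coord (x i) j \<noteq> 0})"
    using k ij by (auto split: if_splits)
qed auto

lemma coord_stack: "coord (stack m x) (prod_encode (i, j)) = (if i < m then coord (x i) j else 0)"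
  unfolding stack_def
  by (subst Abs_fseq_inverse) (simp_all add: stack_support finite_stack_support)

lemma stack_eqI:
  assumes "\<And>i j. coord u (prod_encode (i, j)) = (if i < m then coord (x i) j else 0)"
  shows "stack m x = u"
proof (rule fseq_eqI)
  fix k
  obtain i j where "k = prod_encode (i, j)" by (metis prod_decode_inverse surj_pair)
  then show "coord (stack m x) k = coord u k" using assms by (simp add: coord_stack)
qed

lemma stack_add: "stack m (\<lambda>i. x i + y i) = stack m x + stack m y"
  and stack_diff: "stack m (\<lambda>i. x i - y i) = stack m x - stack m y"
  and stack_scaleR: "stack m (\<lambda>i. c *\<^sub>R x i) = c *\<^sub>R stack m x"
  and stack_minus: "stack m (\<lambda>i. - x i) = - stack m x"
  by (rule stack_eqI; simp add: coord_stack)+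

lemma stack_cong: "(\<And>i. i < m \<Longrightarrow> x i = y i) \<Longrightarrow> stack m x = stack m y"
  by (rule stack_eqI) (simp add: coord_stack)

lemma inner_stack: "inner (stack m x) (stack m y) = (\<Sum>i<m. inner (x i) (y i))"
proof -
  let ?I = "SIGMA i:{..<m}. {j. coord (x i) j \<noteq> 0}"
  have sup: "{k. coord (stack m x) k \<noteq> 0} \<subseteq> prod_encode ` ?I"
  proof
    fix k assume k: "k \<in> {k. coord (stack m x) k \<noteq> 0}"
    obtain i j where "k = prod_encode (i, j)" by (metis prod_decode_inverse surj_pair)
    with k show "k \<in> prod_encode ` ?I" by (auto simp: coord_stack split: if_splits)
  qed
  have "inner (stack m x) (stack m y) = (\<Sum>k\<in>prod_encode ` ?I. coord (stack m x) k * coord (stack m y) k)"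
    by (rule inner_fseq_superset[OF finite_imageI[OF finite_stack_support] sup])
  also have "\<dots> = (\<Sum>(i, j)\<in>?I. coord (x i) j * coord (y i) j)"
    by (subst sum.reindex) (auto simp: coord_stack inj_on_def intro!: sum.cong)
  also have "\<dots> = (\<Sum>i<m. \<Sum>j | coord (x i) j \<noteq> 0. coord (x i) j * coord (y i) j)"
    by (subst sum.Sigma) (auto simp: finite_support)
  finally show ?thesis by (simp add: inner_fseq_def)
qed

lemma norm_stack: "(norm (stack m x))\<^sup>2 = (\<Sum>i<m. (norm (x i))\<^sup>2)"
  by (simp add: power2_norm_eq_inner inner_stack)

lemma inner_stack_consensus:
  assumes "(\<Sum>i<m. y i) = 0"
  shows "inner (stack m (\<lambda>_. c)) (stack m y) = 0"
  unfolding inner_stack using assms by (simp flip: inner_sum_right)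

text \<open>
  The orthogonal projection onto the vectors whose components sum to zero.
\<close>

definition disagreement :: "nat \<Rightarrow> (nat \<Rightarrow> fseq) \<Rightarrow> nat \<Rightarrow> fseq" where
  "disagreement m x i = x i - (1 / real m) *\<^sub>R (\<Sum>j<m. x j)"

lemma sum_disagreement: "1 \<le> m \<Longrightarrow> (\<Sum>i<m. disagreement m x i) = 0"
  by (simp add: disagreement_def sum_subtractf sum_constant_scaleR)

lemma disagreement_in_Rd: "\<forall>i<m. x i \<in> Rd d \<Longrightarrow> i < m \<Longrightarrow> disagreement m x i \<in> Rd d"
  unfolding disagreement_def by (intro subspace_diff subspace_scale subspace_sum subspace_Rd) auto

lemma disagreement_add: "disagreement m (\<lambda>i. x i + y i) i = disagreement m x i + disagreement m y i"
  by (simp add: disagreement_def sum.distrib algebra_simps)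

lemma disagreement_scaleR: "disagreement m (\<lambda>i. c *\<^sub>R x i) i = c *\<^sub>R disagreement m x i"
  by (simp add: disagreement_def algebra_simps flip: scaleR_sum_right)

lemma disagreement_of_sum_zero: "(\<Sum>i<m. x i) = 0 \<Longrightarrow> disagreement m x i = x i"
  by (simp add: disagreement_def)

lemma disagreement_diff: "disagreement m (\<lambda>i. x i - y i) i = disagreement m x i - disagreement m y i"
  by (simp add: disagreement_def sum_subtractf algebra_simps)

lemma mix_in_Rd: "\<forall>j<m. x j \<in> Rd d \<Longrightarrow> mix m A x i \<in> Rd d"
  unfolding mix_def by (intro subspace_sum subspace_scale subspace_Rd) auto

lemma gossip_mix_disagreement:
  assumes "gossip d m chi E W" "i < m"
  shows "mix m (W k) x i = mix m (W k) (disagreement m x) i"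
proof -
  have "mix m (W k) (\<lambda>_. 1::real) i = 0" using assms by (simp add: gossip_def)
  then have row: "(\<Sum>j<m. W k i j) = 0" by (simp add: mix_def)
  have const: "(\<Sum>j<m. W k i j *\<^sub>R c) = 0" for c :: fseq
    unfolding scaleR_sum_left[symmetric] row by simp
  show ?thesis
    unfolding mix_def disagreement_def scaleR_diff_right sum_subtractf const by simp
qed

lemma gossip_sum_mix:
  fixes x :: "nat \<Rightarrow> fseq"
  assumes "gossip d m chi E W"
  shows "(\<Sum>i<m. mix m (W k) x i) = 0"
proof -
  have col: "(\<Sum>i<m. W k i j) = 0" if "j < m" for j
  proof -
    have "(\<Sum>i<m. mix m (W k) (\<lambda>l. if l = j then 1 else 0 :: real) i) = 0"
      using assms by (simp add: gossip_def)
    moreover have "mix m (W k) (\<lambda>l. if l = j then 1 else 0 :: real) i = W k i j" for i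
      using that by (simp add: mix_def if_distrib cong: if_cong)
    ultimately show ?thesis by simp
  qed
  have "(\<Sum>i<m. mix m (W k) x i) = (\<Sum>j<m. \<Sum>i<m. W k i j *\<^sub>R x j)"
    unfolding mix_def by (rule sum.swap)
  also have "\<dots> = (\<Sum>j<m. (\<Sum>i<m. W k i j) *\<^sub>R x j)" by (simp add: scaleR_sum_left)
  finally show ?thesis using col by simp
qed

text \<open>
  A gossip matrix kills consensus vectors, so it sees only the disagreement of its argument, and
  on the disagreement it is close to the identity.
\<close>

lemma gossip_contraction:
  assumes "gossip d m chi E W" "1 \<le> m" "\<forall>i<m. x i \<in> Rd d"
  shows "(norm (stack m (disagreement m x) - stack m (mix m (W k) x)))\<^sup>2
    \<le> (1 - 1 / chi) * (norm (stack m (disagreement m x)))\<^sup>2"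
proof -
  have "stack m (disagreement m x) - stack m (mix m (W k) x)
      = stack m (\<lambda>i. disagreement m x i - mix m (W k) (disagreement m x) i)"
    unfolding stack_diff using gossip_mix_disagreement[OF assms(1)] by (metis stack_cong)
  then have "(norm (stack m (disagreement m x) - stack m (mix m (W k) x)))\<^sup>2
      = (\<Sum>i<m. (norm (mix m (W k) (disagreement m x) i - disagreement m x i))\<^sup>2)"
    by (simp add: norm_stack norm_minus_commute)
  also have "\<dots> \<le> (1 - 1 / chi) * (\<Sum>i<m. (norm (disagreement m x i))\<^sup>2)"
  proof -
    have "\<forall>x. (\<forall>i<m. x i \<in> Rd d) \<and> (\<Sum>i<m. x i) = 0 \<longrightarrow>
        (\<Sum>i<m. (norm (mix m (W k) x i - x i))\<^sup>2) \<le> (1 - 1 / chi) * (\<Sum>i<m. (norm (x i))\<^sup>2)"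
      using assms(1) unfolding gossip_def by (elim allE[of _ k] conjE)
    then show ?thesis
      using sum_disagreement[OF assms(2), of x] disagreement_in_Rd[OF assms(3)] by auto
  qed
  finally show ?thesis by (simp add: norm_stack)
qed

section \<open>The decentralized problem\<close>

text \<open>
  The step \<open>\<tau>\<^sub>2\<close>. It is half of the usual acceleration weight, so that \<open>\<tau>\<^sub>1 \<le> 1 / 2\<close> and the
  weight \<open>1 - \<tau>\<^sub>1 - \<tau>\<^sub>0\<close> stays nonnegative for \<open>\<tau>\<^sub>0 = 1 / 2\<close>.
\<close>

definition adom_step :: "real \<Rightarrow> real \<Rightarrow> real" where
  "adom_step L \<mu> = sqrt (\<mu> / L) / 2"

text \<open>
  In terms of \<open>t = \<tau>\<^sub>2\<close> one has \<open>\<mu> = 4 * L * t\<^sup>2\<close>, hence \<open>\<nu> = \<alpha> = \<mu> / 2\<close>. The weights \<open>\<tau>\<^sub>1\<close> and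
  \<open>\<sigma>\<^sub>1\<close> have the form required by the acceleration arguments, and \<open>\<sigma>\<^sub>2\<close> is smaller than \<open>\<tau>\<^sub>2\<close> by
  the order of \<open>\<chi>\<close>.
\<close>

definition adom_parameters :: "real \<Rightarrow> real \<Rightarrow> real \<Rightarrow> adom_params" where
  "adom_parameters L chi t = \<lparr>
     p_eta = 1 / (8 * L * t), p_alpha = 2 * L * t\<^sup>2, p_nu = 2 * L * t\<^sup>2,
     p_tau0 = 1 / 2, p_tau1 = 1 / (1 / t + 1 / 2), p_tau2 = t,
     p_theta = L * t, p_beta = 1 / (8 * L),
     p_sigma1 = 1 / (1 / (t / (8 * chi)) + 1 / 2), p_sigma2 = t / (8 * chi),
     p_gamma = L * t / (2 * chi), p_delta = 1 / (64 * L), p_zeta = 1,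
     p_prob1 = 1, p_prob2 = 0\<rparr>"

lemma adom_parameters_admissible:
  assumes "0 < L" "0 < t"
  shows "admissible (adom_parameters L chi t)"
proof -
  have "(1 + 1 / (8 * L * t) * (2 * L * t\<^sup>2)) * (1 + L * t * (1 / (8 * L))) + 1 / (8 * L * t) * (L * t) > 0"
    using assms by (intro add_pos_pos mult_pos_pos) auto
  then show ?thesis using assms by (simp add: admissible_def adom_parameters_def)
qed

lemma choices_pmf_always_Take_f:
  assumes "admissible P" "p_prob1 P = 1" "p_prob2 P = 0"
  shows "choices_pmf m P = return_pmf (\<lambda>i. if i < m then Take_f else Keep)"
proof -
  have "choice_pmf P = return_pmf Take_f"
  proof (rule pmf_eqI)
    show "pmf (choice_pmf P) c = pmf (return_pmf Take_f) c" for c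
      using assms by (cases c) (simp_all add: pmf_choice_pmf pmf_return)
  qed
  then show ?thesis by (simp add: choices_pmf_def lessThan_def[symmetric])
qed

locale adom_problem =
  fixes d m n b :: nat and f :: "nat \<Rightarrow> nat \<Rightarrow> fseq \<Rightarrow> real" and Lf :: "nat \<Rightarrow> nat \<Rightarrow> real"
    and L Lbar \<mu> chi :: real and E :: "nat \<Rightarrow> (nat \<times> nat) set"
    and W :: "nat \<Rightarrow> nat \<Rightarrow> nat \<Rightarrow> real" and u :: fseq
  assumes dims: "1 \<le> d" "1 \<le> m" "1 \<le> n" "1 \<le> b"
    and mu: "0 < \<mu>" and chi: "1 \<le> chi" and batch: "real b \<ge> Lbar / L"
    and components: "\<forall>i<m. \<forall>j<n. convex_on (Rd d) (f i j) \<and> smooth d (Lf i j) (f i j)"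
    and nodes: "\<forall>i<m. smooth d L (F_node n f i) \<and> strongly_convex d \<mu> (F_node n f i)"
    and Lbar: "Lbar = Max ((\<lambda>i. (1 / real n) * (\<Sum>j<n. Lf i j)) ` {..<m})"
    and gossip: "gossip d m chi E W"
    and minimizer: "is_arg_min (\<lambda>v. \<Sum>i<m. F_node n f i v) (\<lambda>v. v \<in> Rd d) u"
begin

abbreviation "t \<equiv> adom_step L \<mu>"
abbreviation "P \<equiv> adom_parameters L chi t"
abbreviation "\<nu> \<equiv> 2 * L * t\<^sup>2"
abbreviation "\<eta> \<equiv> 1 / (8 * L * t)"
abbreviation "\<theta> \<equiv> L * t"
abbreviation "\<beta> \<equiv> 1 / (8 * L)"
abbreviation "\<sigma> \<equiv> t / (8 * chi)"
abbreviation "\<gamma> \<equiv> L * t / (2 * chi)"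
abbreviation "\<delta> \<equiv> 1 / (64 * L)"
abbreviation "\<rho> \<equiv> t / (256 * chi)"

lemma mu_le_L: "\<mu> \<le> L"
  using strongly_convex_le_smooth[OF dims(1)] nodes dims(2) by (metis less_le_trans zero_less_one)

lemma L_pos: "0 < L" using mu mu_le_L by linarith

lemma t_pos: "0 < t" using mu L_pos by (simp add: adom_step_def)

lemma t_le: "t \<le> 1 / 2"
  using mu L_pos mu_le_L by (simp add: adom_step_def)

lemma mu_t: "\<mu> = 4 * L * t\<^sup>2"
  using mu L_pos by (simp add: adom_step_def power_divide)

lemma P_admissible: "admissible P"
  by (rule adom_parameters_admissible[OF L_pos t_pos])

lemma u_Rd: "u \<in> Rd d"
  using minimizer by (simp add: is_arg_min_def)

text \<open>
  One half of the strong convexity is split off; it reappears as the quadratic term of the dual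
  variables.
\<close>

definition f_reg :: "nat \<Rightarrow> fseq \<Rightarrow> real" where
  "f_reg i v = F_node n f i v - \<nu> / 2 * (norm v)\<^sup>2"

definition g_reg :: "nat \<Rightarrow> fseq \<Rightarrow> fseq" where
  "g_reg i v = grad d (F_node n f i) v - \<nu> *\<^sub>R v"

lemma bregman_f_reg:
  "bregman (f_reg i) (g_reg i) a c = bregman (F_node n f i) (grad d (F_node n f i)) a c - \<nu> / 2 * (norm (a - c))\<^sup>2"
proof -
  have "(norm a)\<^sup>2 - (norm c)\<^sup>2 - 2 * inner c (a - c) = (norm (a - c))\<^sup>2"
    by (simp add: power2_norm_eq_inner inner_simps inner_commute)
  then have "\<nu> / 2 * ((norm a)\<^sup>2 - (norm c)\<^sup>2 - 2 * inner c (a - c)) = \<nu> / 2 * (norm (a - c))\<^sup>2"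
    by simp
  moreover have "bregman (f_reg i) (g_reg i) a c = bregman (F_node n f i) (grad d (F_node n f i)) a c
      - \<nu> / 2 * ((norm a)\<^sup>2 - (norm c)\<^sup>2 - 2 * inner c (a - c))"
    unfolding bregman_def f_reg_def g_reg_def
    by (simp only: inner_diff_left inner_scaleR_left right_diff_distrib) simp
  ultimately show ?thesis by linarith
qed

lemma f_reg_lower:
  assumes "i < m" "a \<in> Rd d" "c \<in> Rd d"
  shows "L * t\<^sup>2 * (norm (a - c))\<^sup>2 \<le> bregman (f_reg i) (g_reg i) a c"
proof -
  have "\<mu> / 2 * (norm (a - c))\<^sup>2 \<le> bregman (F_node n f i) (grad d (F_node n f i)) a c"
    using nodes assms unfolding strongly_convex_def bregman_def by (smt (verit))
  moreover have "\<mu> / 2 * (norm (a - c))\<^sup>2 = 2 * (L * t\<^sup>2 * (norm (a - c))\<^sup>2)"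
    by (subst mu_t) simp
  moreover have "\<nu> / 2 * (norm (a - c))\<^sup>2 = L * t\<^sup>2 * (norm (a - c))\<^sup>2" by simp
  ultimately show ?thesis unfolding bregman_f_reg by linarith
qed

lemma f_reg_nonneg:
  assumes "i < m" "a \<in> Rd d" "c \<in> Rd d"
  shows "0 \<le> bregman (f_reg i) (g_reg i) a c"
proof -
  have "0 \<le> L * t\<^sup>2 * (norm (a - c))\<^sup>2" using L_pos by simp
  then show ?thesis using f_reg_lower[OF assms] by linarith
qed

lemma f_reg_upper:
  assumes "i < m" "a \<in> Rd d" "c \<in> Rd d"
  shows "bregman (f_reg i) (g_reg i) a c \<le> L / 2 * (norm (a - c))\<^sup>2"
proof -
  have "bregman (F_node n f i) (grad d (F_node n f i)) a c \<le> L / 2 * (norm (a - c))\<^sup>2"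
    using nodes assms by (intro smooth_bregman_le) auto
  moreover have "0 \<le> \<nu> / 2 * (norm (a - c))\<^sup>2" using L_pos by simp
  ultimately show ?thesis unfolding bregman_f_reg by linarith
qed

text \<open>
  Removing the quadratic costs at most a factor of two in Bregman distances.
\<close>

lemma bregman_F_le:
  assumes "i < m" "a \<in> Rd d" "c \<in> Rd d"
  shows "bregman (F_node n f i) (grad d (F_node n f i)) a c \<le> 2 * bregman (f_reg i) (g_reg i) a c"
  using f_reg_lower[OF assms] unfolding bregman_f_reg by (simp add: algebra_simps)

lemma g_reg_Rd: "i < m \<Longrightarrow> v \<in> Rd d \<Longrightarrow> g_reg i v \<in> Rd d"
  unfolding g_reg_def using nodes
  by (intro subspace_diff subspace_scale subspace_Rd grad_in_Rd) auto

lemma g_reg_cocoercive: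
  assumes "i < m" "a \<in> Rd d" "c \<in> Rd d"
  shows "(norm (g_reg i a - g_reg i c))\<^sup>2 \<le> 2 * L * bregman (f_reg i) (g_reg i) a c"
  by (rule cocoercive[OF subspace_Rd assms(2,3)])
     (use g_reg_Rd f_reg_nonneg f_reg_upper L_pos assms(1) in auto)

text \<open>
  The suboptimality measure for \<open>f\<close>: the linear part at the solution is subtracted because \<open>x\<^sup>*\<close>
  minimizes \<open>f - \<langle>y\<^sup>*, \<cdot>\<rangle>\<close> and not \<open>f\<close>.
\<close>

definition gap :: "(nat \<Rightarrow> fseq) \<Rightarrow> real" where
  "gap x = (\<Sum>i<m. bregman (f_reg i) (g_reg i) (x i) u)"

definition ref_gap :: "(nat \<Rightarrow> fseq) \<Rightarrow> (nat \<Rightarrow> fseq) \<Rightarrow> real" where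
  "ref_gap w x = (\<Sum>i<m. bregman (f_reg i) (g_reg i) (w i) (x i))"

text \<open>
  The saddle point. The sum of its two dual components is a consensus vector, see \<open>s_opt_eq\<close>.
\<close>

definition "x_opt = stack m (\<lambda>_. u)"
definition "y_opt = stack m (\<lambda>i. g_reg i u)"
definition "z_opt = stack m (\<lambda>i. - grad d (F_node n f i) u)"
definition "s_opt = stack m (\<lambda>_. - \<nu> *\<^sub>R u)"

lemma s_opt_eq: "s_opt = y_opt + z_opt"
  unfolding s_opt_def y_opt_def z_opt_def stack_add[symmetric] by (rule stack_cong) (simp add: g_reg_def)

lemma s_opt_x_opt: "(1 / \<nu>) *\<^sub>R s_opt + x_opt = 0"
proof -
  have "s_opt = - (\<nu> *\<^sub>R x_opt)"
    unfolding s_opt_def x_opt_def by (simp add: stack_minus stack_scaleR)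
  then show ?thesis using L_pos t_pos by simp
qed

lemma sum_grad_u: "(\<Sum>i<m. grad d (F_node n f i) u) = 0"
  using sum_grad_at_minimizer[OF minimizer _ L_pos] nodes by simp

lemma inner_stack_diff:
  "inner (stack m a - stack m a') (stack m c - stack m c') = (\<Sum>i<m. inner (a i - a' i) (c i - c' i))"
  unfolding stack_diff[symmetric] inner_stack ..

lemma gap_nonneg: "\<forall>i<m. x i \<in> Rd d \<Longrightarrow> 0 \<le> gap x"
  unfolding gap_def by (intro sum_nonneg f_reg_nonneg u_Rd) auto

lemma gap_three_points:
  assumes "\<forall>i<m. x i \<in> Rd d" "\<forall>i<m. a i \<in> Rd d"
  shows "inner (stack m (\<lambda>i. g_reg i (x i)) - y_opt) (stack m a - stack m x) = gap a - gap x - ref_gap a x"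
  unfolding y_opt_def inner_stack_diff gap_def ref_gap_def sum_subtractf[symmetric]
  by (intro sum.cong refl bregman_three_points)

lemma ref_gap_nonneg: "\<forall>i<m. x i \<in> Rd d \<Longrightarrow> \<forall>i<m. a i \<in> Rd d \<Longrightarrow> 0 \<le> ref_gap a x"
  unfolding ref_gap_def by (intro sum_nonneg f_reg_nonneg) auto

lemma ref_gap_le:
  assumes "\<forall>i<m. x i \<in> Rd d" "\<forall>i<m. a i \<in> Rd d"
  shows "ref_gap a x \<le> L / 2 * (norm (stack m a - stack m x))\<^sup>2"
  unfolding ref_gap_def stack_diff[symmetric] norm_stack sum_distrib_left
  using assms by (intro sum_mono f_reg_upper) auto

lemma gap_optimality:
  assumes "\<forall>i<m. x i \<in> Rd d"
  shows "inner (stack m (\<lambda>i. g_reg i (x i)) - y_opt) (stack m x - x_opt)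
     \<ge> gap x + L * t\<^sup>2 * (norm (stack m x - x_opt))\<^sup>2"
proof -
  have "gap x + L * t\<^sup>2 * (norm (stack m x - x_opt))\<^sup>2
      = (\<Sum>i<m. bregman (f_reg i) (g_reg i) (x i) u + L * t\<^sup>2 * (norm (u - x i))\<^sup>2)"
    unfolding gap_def x_opt_def stack_diff[symmetric] norm_stack
    by (simp add: sum.distrib sum_distrib_left norm_minus_commute)
  also have "\<dots> \<le> (\<Sum>i<m. bregman (f_reg i) (g_reg i) (x i) u + bregman (f_reg i) (g_reg i) u (x i))"
    using assms u_Rd by (intro sum_mono add_left_mono f_reg_lower) auto
  also have "\<dots> = (\<Sum>i<m. inner (g_reg i (x i) - g_reg i u) (x i - u))"
    by (intro sum.cong) (auto simp: bregman_def inner_diff_left inner_diff_right)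
  finally show ?thesis unfolding y_opt_def x_opt_def inner_stack_diff .
qed

lemma gap_cocoercive:
  assumes "\<forall>i<m. x i \<in> Rd d"
  shows "(norm (stack m (\<lambda>i. g_reg i (x i)) - y_opt))\<^sup>2 \<le> 2 * L * gap x"
  unfolding y_opt_def stack_diff[symmetric] norm_stack gap_def sum_distrib_left
  using assms u_Rd by (intro sum_mono g_reg_cocoercive) auto

end

section \<open>Descent along a fixed sample\<close>

text \<open>
  Applied to the coordinates beyond the dimension, where all data of the linear system vanish.
\<close>

lemma implicit_solution_zero:
  fixes x y a h e t :: real
  assumes "0 \<le> a" "0 \<le> h" "0 < e" "0 < t" "x = - a * x + e * y" "y = - h * y - t * x"
  shows "x = 0 \<and> y = 0"
proof -
  have 1: "(1 + a) * x = e * y" "(1 + h) * y = - t * x" using assms(5,6) by (simp_all add: algebra_simps)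
  have "((1 + a) * (1 + h) + e * t) * x = (1 + h) * ((1 + a) * x) + e * t * x" by (simp add: algebra_simps)
  also have "\<dots> = e * ((1 + h) * y) + e * t * x" unfolding 1(1) by (simp add: algebra_simps)
  also have "\<dots> = 0" unfolding 1(2) by simp
  finally have "((1 + a) * (1 + h) + e * t) * x = 0" .
  moreover have "(1 + a) * (1 + h) + e * t > 0" using assms by (intro add_nonneg_pos mult_pos_pos) auto
  ultimately have "x = 0" by simp
  then show ?thesis using 1(2) assms(2) by simp
qed

context adom_problem
begin

lemma P_simps:
  "p_eta P = \<eta>" "p_alpha P = \<nu>" "p_nu P = \<nu>" "p_tau0 P = 1 / 2" "p_tau1 P = 1 / (1 / t + 1 / 2)" "p_tau2 P = t"
  "p_theta P = \<theta>" "p_beta P = \<beta>" "p_sigma1 P = 1 / (1 / \<sigma> + 1 / 2)" "p_sigma2 P = \<sigma>"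
  "p_gamma P = \<gamma>" "p_delta P = \<delta>" "p_zeta P = 1" "p_prob1 P = 1" "p_prob2 P = 0"
  by (simp_all add: adom_parameters_def)

abbreviation "\<tau> \<equiv> 1 / (1 / t + 1 / 2)"
abbreviation "\<sigma>' \<equiv> 1 / (1 / \<sigma> + 1 / 2)"

definition "x_query st = (\<lambda>i. \<tau> *\<^sub>R s_x st i + (1 / 2) *\<^sub>R s_w st i + (1 - \<tau> - 1 / 2) *\<^sub>R s_xf st i)"
definition "y_query st = (\<lambda>i. \<sigma>' *\<^sub>R s_y st i + (1 - \<sigma>') *\<^sub>R s_yf st i)"
definition "z_query st = (\<lambda>i. \<sigma>' *\<^sub>R s_z st i + (1 - \<sigma>') *\<^sub>R s_zf st i)"
definition "message st = (\<lambda>i. (\<gamma> * inverse \<nu>) *\<^sub>R (y_query st i + z_query st i) + s_m st i)"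

text \<open>
  The first two equations keep the new \<open>x\<close> and \<open>y\<close> on the right: the step inequalities are derived
  from this implicit form, not from the solved system.
\<close>

lemma update_components:
  fixes S ch st A
  defines "G \<equiv> stoch_grad d n b f Lf S (x_query st) (s_w st)"
  defines "st' \<equiv> update d m n b f Lf P A S ch st"
  shows "s_x st' i = s_x st i + (\<eta> * \<nu>) *\<^sub>R (x_query st i - s_x st' i)
      - \<eta> *\<^sub>R (G i - \<nu> *\<^sub>R x_query st i - s_y st' i)" (is ?X)
    and "s_y st' i = s_y st i + (\<theta> * \<beta>) *\<^sub>R (G i - \<nu> *\<^sub>R x_query st i - s_y st' i)
      - \<theta> *\<^sub>R (inverse \<nu> *\<^sub>R (y_query st i + z_query st i) + s_x st' i)" (is ?Y)
    and "s_xf st' i = x_query st i + t *\<^sub>R (s_x st' i - s_x st i)"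
    and "s_w st' i = (case ch i of Take_f \<Rightarrow> s_xf st i | Take_g \<Rightarrow> x_query st i | Keep \<Rightarrow> s_w st i)"
    and "s_yf st' i = y_query st i + \<sigma> *\<^sub>R (s_y st' i - s_y st i)"
    and "s_z st' i = s_z st i + (\<gamma> * \<delta>) *\<^sub>R (z_query st i - s_z st i) - mix m A (message st) i"
    and "s_zf st' i = z_query st i - mix m A (\<lambda>j. y_query st j + z_query st j) i"
    and "s_m st' i = message st i - mix m A (message st) i"
proof -
  define q where "q = (THE q. implicit_xy P (s_x st i) (x_query st i) (G i) (s_y st i) (y_query st i) (z_query st i) q)"
  have q: "implicit_xy P (s_x st i) (x_query st i) (G i) (s_y st i) (y_query st i) (z_query st i) q"
    unfolding q_def by (rule theI'[OF implicit_xy_unique[OF P_admissible]])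
  have x': "s_x st' i = fst q" and y': "s_y st' i = snd q"
    unfolding st'_def update_def Let_def q_def G_def
    unfolding P_simps x_query_def y_query_def z_query_def by simp_all
  show ?X ?Y
    using q unfolding implicit_xy_def P_simps x' y' by (simp_all add: case_prod_unfold)
  show "s_xf st' i = x_query st i + t *\<^sub>R (s_x st' i - s_x st i)"
    and "s_w st' i = (case ch i of Take_f \<Rightarrow> s_xf st i | Take_g \<Rightarrow> x_query st i | Keep \<Rightarrow> s_w st i)"
    and "s_yf st' i = y_query st i + \<sigma> *\<^sub>R (s_y st' i - s_y st i)"
    and "s_z st' i = s_z st i + (\<gamma> * \<delta>) *\<^sub>R (z_query st i - s_z st i) - mix m A (message st) i"
    and "s_zf st' i = z_query st i - mix m A (\<lambda>j. y_query st j + z_query st j) i"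
    and "s_m st' i = message st i - mix m A (message st) i"
    unfolding st'_def update_def Let_def message_def
    unfolding P_simps x_query_def y_query_def z_query_def by simp_all
qed

text \<open>
  The invariant of the iteration: all vectors are \<open>d\<close>-dimensional, and \<open>z\<close> and \<open>z\<^sub>f\<close> sum to zero
  over the nodes. The memory \<open>m\<close> may have a consensus component, which the gossip matrices never
  see.
\<close>

definition valid :: "adom_state \<Rightarrow> bool" where
  "valid st \<longleftrightarrow> (\<forall>i<m. s_x st i \<in> Rd d \<and> s_xf st i \<in> Rd d \<and> s_w st i \<in> Rd d \<and> s_y st i \<in> Rd d
      \<and> s_yf st i \<in> Rd d \<and> s_z st i \<in> Rd d \<and> s_zf st i \<in> Rd d \<and> s_m st i \<in> Rd d)
    \<and> (\<Sum>i<m. s_z st i) = 0 \<and> (\<Sum>i<m. s_zf st i) = 0"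

lemma query_in_Rd:
  assumes "valid st" "i < m"
  shows "x_query st i \<in> Rd d" "y_query st i \<in> Rd d" "z_query st i \<in> Rd d" "message st i \<in> Rd d"
  using assms unfolding valid_def message_def x_query_def y_query_def z_query_def
  by (auto intro!: subspace_add subspace_scale subspace_Rd)

lemma stoch_grad_in_Rd:
  assumes "i < m" "x i \<in> Rd d" "w i \<in> Rd d" "\<forall>s<b. S (i, s) < n"
  shows "stoch_grad d n b f Lf S x w i \<in> Rd d"
  unfolding stoch_grad_def Let_def using assms components nodes
  by (intro subspace_add subspace_scale subspace_sum subspace_diff subspace_Rd grad_in_Rd) auto

lemma valid_update:
  assumes v: "valid st" and S: "\<forall>i<m. \<forall>s<b. S (i, s) < n"
  shows "valid (update d m n b f Lf P (W k) S ch st)"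
proof -
  define st' where "st' = update d m n b f Lf P (W k) S ch st"
  note upd = update_components[where A = "W k" and S = S and ch = ch and st = st, folded st'_def]
  have st: "s_x st i \<in> Rd d" "s_xf st i \<in> Rd d" "s_w st i \<in> Rd d" "s_y st i \<in> Rd d"
    "s_yf st i \<in> Rd d" "s_z st i \<in> Rd d" "s_zf st i \<in> Rd d" "s_m st i \<in> Rd d" if "i < m" for i
    using v that by (auto simp: valid_def)
  note q = query_in_Rd[OF v]
  have xy: "s_x st' i \<in> Rd d \<and> s_y st' i \<in> Rd d" if i: "i < m" for i
  proof -
    have G: "stoch_grad d n b f Lf S (x_query st) (s_w st) i \<in> Rd d"
      using S i q st by (intro stoch_grad_in_Rd) auto
    have "coord (s_x st' i) j = 0 \<and> coord (s_y st' i) j = 0" if j: "d \<le> j" for j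
    proof (rule implicit_solution_zero)
      have 0: "coord v j = 0" if "v \<in> Rd d" for v using that j by (simp add: Rd_def)
      note z = 0[OF st(1)[OF i]] 0[OF st(4)[OF i]] 0[OF q(1)[OF i]] 0[OF q(2)[OF i]] 0[OF q(3)[OF i]] 0[OF G]
      show "coord (s_x st' i) j = - (\<eta> * \<nu>) * coord (s_x st' i) j + \<eta> * coord (s_y st' i) j"
        by (subst upd(1)) (simp add: z)
      show "coord (s_y st' i) j = - (\<theta> * \<beta>) * coord (s_y st' i) j - \<theta> * coord (s_x st' i) j"
        by (subst upd(2)) (simp add: z)
    qed (use L_pos t_pos in auto)
    then show ?thesis by (auto simp: Rd_def)
  qed
  have mixR: "mix m (W k) (message st) i \<in> Rd d" "mix m (W k) (\<lambda>j. y_query st j + z_query st j) i \<in> Rd d" for i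
    using q by (intro mix_in_Rd; auto intro!: subspace_add subspace_Rd)+
  have sums: "(\<Sum>i<m. z_query st i) = 0"
    using v by (simp add: z_query_def valid_def sum.distrib flip: scaleR_sum_right)
  have "(\<Sum>i<m. s_z st' i) = 0"
    unfolding upd(6) using sums gossip_sum_mix[OF gossip] v
    by (simp add: valid_def sum.distrib sum_subtractf flip: scaleR_sum_right)
  moreover have "(\<Sum>i<m. s_zf st' i) = 0"
    unfolding upd(7) using sums gossip_sum_mix[OF gossip] by (simp add: sum_subtractf)
  moreover have "s_x st' i \<in> Rd d \<and> s_xf st' i \<in> Rd d \<and> s_w st' i \<in> Rd d \<and> s_y st' i \<in> Rd d
      \<and> s_yf st' i \<in> Rd d \<and> s_z st' i \<in> Rd d \<and> s_zf st' i \<in> Rd d \<and> s_m st' i \<in> Rd d" if i: "i < m" for i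
    unfolding upd(3-8) using xy[OF i] st[OF i] q[OF i] mixR[of i]
    by (auto intro!: subspace_add subspace_diff subspace_scale subspace_Rd split: ref_choice.split)
  ultimately show ?thesis unfolding st'_def[symmetric] valid_def by blast
qed

text \<open>
  The memory enters only through its disagreement, once to correct \<open>z\<close> and once as an error of its
  own. The reference point has its own weight \<open>1 / t + 1\<close>, slightly more than \<open>primal_step\<close> needs,
  so that this summand contracts too.
\<close>

definition lyapunov :: "adom_state \<Rightarrow> real" where
  "lyapunov st = (1 / \<eta> + \<nu>) * (norm (stack m (s_x st) - x_opt))\<^sup>2 + 2 / t * gap (s_xf st)
    + (1 / t + 1) * gap (s_w st)
    + (1 / \<theta> + \<beta> / 2) * (norm (stack m (s_y st) - y_opt))\<^sup>2
    + \<beta> / (2 * \<sigma>) * (norm (stack m (s_yf st) - y_opt))\<^sup>2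
    + 1 / \<gamma> * (norm (stack m (s_z st) - stack m (disagreement m (s_m st)) - z_opt))\<^sup>2
    + 2 / \<gamma> * (norm (stack m (disagreement m (s_m st))))\<^sup>2
    + 1 / (\<nu> * \<sigma>) * (norm (stack m (s_yf st) + stack m (s_zf st) - s_opt))\<^sup>2"

definition noise :: "(nat \<times> nat \<Rightarrow> nat) \<Rightarrow> adom_state \<Rightarrow> nat \<Rightarrow> fseq" where
  "noise S st i = stoch_grad d n b f Lf S (x_query st) (s_w st) i - grad d (F_node n f i) (x_query st i)"

text \<open>
  The vector that multiplies the noise linearly: the first part comes from the squared gradient in
  the step of \<open>y\<close>, the second one from the step of \<open>x\<close>. It depends on the state only, so the
  product has mean zero.
\<close>

definition noise_direction :: "adom_state \<Rightarrow> nat \<Rightarrow> fseq" where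
  "noise_direction st i = (2 * \<beta>) *\<^sub>R (g_reg i (x_query st i) - g_reg i u) - 2 *\<^sub>R (s_x st i - u)"

text \<open>
  Instantiates the four step inequalities with the stacked vectors, for one fixed outcome of the
  sampling. What the sampling contributes is kept explicit: a square, and a term that is linear in
  the noise.
\<close>

lemma pathwise_descent:
  assumes v: "valid st" and S: "\<forall>i<m. \<forall>s<b. S (i, s) < n" and ch: "\<forall>i<m. ch i = Take_f"
  shows "lyapunov (update d m n b f Lf P (W k) S ch st) \<le> (1 - \<rho>) * lyapunov st
    + (2 * \<eta> + \<beta>) * (norm (stack m (noise S st)))\<^sup>2 - (1 / t + 1 / 2) * ref_gap (s_w st) (x_query st)
    + inner (stack m (noise S st)) (stack m (noise_direction st))"
proof -
  define st' where "st' = update d m n b f Lf P (W k) S ch st"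
  note upd = update_components[where A = "W k" and S = S and ch = ch and st = st, folded st'_def]
  have v': "valid st'" unfolding st'_def by (rule valid_update[OF v S])
  define X where "X = stack m (s_x st)"
  define X' where "X' = stack m (s_x st')"
  define XF where "XF = stack m (s_xf st)"
  define XF' where "XF' = stack m (s_xf st')"
  define V where "V = stack m (s_w st)"
  define XG where "XG = stack m (x_query st)"
  define GX where "GX = stack m (\<lambda>i. g_reg i (x_query st i))"
  define N where "N = stack m (noise S st)"
  define Y where "Y = stack m (s_y st)"
  define Y' where "Y' = stack m (s_y st')"
  define YF where "YF = stack m (s_yf st)"
  define YF' where "YF' = stack m (s_yf st')"
  define YG where "YG = stack m (y_query st)"
  define Z where "Z = stack m (s_z st)"
  define Z' where "Z' = stack m (s_z st')"
  define ZF where "ZF = stack m (s_zf st)"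
  define ZF' where "ZF' = stack m (s_zf st')"
  define ZG where "ZG = stack m (z_query st)"
  define M where "M = stack m (disagreement m (s_m st))"
  define M' where "M' = stack m (disagreement m (s_m st'))"
  define Q where "Q = stack m (disagreement m (\<lambda>i. y_query st i + z_query st i))"
  define WQ where "WQ = stack m (mix m (W k) (\<lambda>i. y_query st i + z_query st i))"
  define WR where "WR = stack m (mix m (W k) (message st))"
  note defs = X_def X'_def XF_def XF'_def V_def XG_def GX_def N_def Y_def Y'_def YF_def YF'_def YG_def
    Z_def Z'_def ZF_def ZF'_def ZG_def M_def M'_def Q_def WQ_def WR_def
  note stacks = stack_add stack_diff stack_scaleR
  have Rd: "\<forall>i<m. x_query st i \<in> Rd d" "\<forall>i<m. s_w st i \<in> Rd d" "\<forall>i<m. s_xf st i \<in> Rd d"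
    "\<forall>i<m. s_xf st' i \<in> Rd d"
    using v v' query_in_Rd[OF v] by (auto simp: valid_def)
  have Rd_s: "\<forall>i<m. y_query st i + z_query st i \<in> Rd d" "\<forall>i<m. message st i \<in> Rd d"
    using query_in_Rd[OF v] by (auto intro!: subspace_add subspace_Rd)
  have G: "stoch_grad d n b f Lf S (x_query st) (s_w st) i - \<nu> *\<^sub>R x_query st i = g_reg i (x_query st i) + noise S st i" for i
    by (simp add: g_reg_def noise_def)

  have X': "X' = X + (\<eta> * \<nu>) *\<^sub>R (XG - X') - \<eta> *\<^sub>R (GX + N - Y')"
    unfolding defs stacks[symmetric] by (rule stack_cong, subst upd(1)) (simp only: G)
  have Y': "Y' = Y + (\<theta> * \<beta>) *\<^sub>R (GX + N - Y') - \<theta> *\<^sub>R ((1 / \<nu>) *\<^sub>R (YG + ZG) + X')"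
    unfolding defs stacks[symmetric] by (rule stack_cong, subst upd(2)) (simp only: G inverse_eq_divide)
  have XG: "XG = \<tau> *\<^sub>R X + (1 / 2) *\<^sub>R V + (1 / 2 - \<tau>) *\<^sub>R XF"
    unfolding defs stacks[symmetric] by (rule stack_cong) (simp add: x_query_def)
  have XF': "XF' = XG + t *\<^sub>R (X' - X)"
    unfolding defs stacks[symmetric] by (rule stack_cong) (simp only: upd(3))
  have YG: "YG = \<sigma>' *\<^sub>R Y + (1 - \<sigma>') *\<^sub>R YF"
    unfolding defs stacks[symmetric] by (rule stack_cong) (simp add: y_query_def)
  have ZG: "ZG = \<sigma>' *\<^sub>R Z + (1 - \<sigma>') *\<^sub>R ZF"
    unfolding defs stacks[symmetric] by (rule stack_cong) (simp add: z_query_def)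
  have YF': "YF' = YG + \<sigma> *\<^sub>R (Y' - Y)"
    unfolding defs stacks[symmetric] by (rule stack_cong) (simp only: upd(5))
  have ZF': "ZF' = ZG - WQ"
    unfolding defs stacks[symmetric] by (rule stack_cong) (simp only: upd(7))
  have Z': "Z' = Z + (\<gamma> * \<delta>) *\<^sub>R (ZG - Z) - WR"
    unfolding defs stacks[symmetric] by (rule stack_cong) (simp only: upd(6))
  have R: "stack m (disagreement m (message st)) = (\<gamma> / \<nu>) *\<^sub>R Q + M"
    unfolding defs stacks[symmetric] message_def
    by (rule stack_cong) (simp only: disagreement_add disagreement_scaleR divide_inverse)
  have M': "M' = (\<gamma> / \<nu>) *\<^sub>R Q + M - WR"
    unfolding R[symmetric] unfolding defs stacks[symmetric]
  proof (rule stack_cong)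
    fix i
    have "disagreement m (s_m st') i = disagreement m (\<lambda>i. message st i - mix m (W k) (message st) i) i"
      unfolding disagreement_def upd(8) ..
    then show "disagreement m (s_m st') i = disagreement m (message st) i - mix m (W k) (message st) i"
      unfolding disagreement_diff using disagreement_of_sum_zero[OF gossip_sum_mix[OF gossip, of k "message st"]] by simp
  qed
  have contraction_Q: "(norm (Q - WQ))\<^sup>2 \<le> (1 - 1 / chi) * (norm Q)\<^sup>2"
    unfolding defs by (rule gossip_contraction[OF gossip dims(2) Rd_s(1)])
  have contraction_R: "(norm ((\<gamma> / \<nu>) *\<^sub>R Q + M - WR))\<^sup>2 \<le> (1 - 1 / chi) * (norm ((\<gamma> / \<nu>) *\<^sub>R Q + M))\<^sup>2"
    unfolding R[symmetric] unfolding WR_def by (rule gossip_contraction[OF gossip dims(2) Rd_s(2)])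
  \<comment> \<open>Both \<open>s_opt\<close> and the difference between a vector and its disagreement are in consensus.\<close>
  have consensus_part: "YG + ZG - s_opt - Q
      = stack m (\<lambda>_. (1 / real m) *\<^sub>R (\<Sum>j<m. y_query st j + z_query st j) + \<nu> *\<^sub>R u)"
    unfolding defs s_opt_def stacks[symmetric] by (rule stack_cong) (simp add: disagreement_def)
  have orth: "inner (YG + ZG - s_opt - Q) Q = 0" "inner (YG + ZG - s_opt - Q) WQ = 0"
    "inner (YG + ZG - s_opt - Q) (Z - z_opt) = 0"
    unfolding consensus_part unfolding Q_def WQ_def Z_def z_opt_def stacks[symmetric]
    by (rule inner_stack_consensus,
      use sum_disagreement[OF dims(2)] gossip_sum_mix[OF gossip] v sum_grad_u in
        \<open>simp add: valid_def sum.distrib sum_negf\<close>)+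

  have pos: "0 < \<eta>" "0 < \<theta>" "0 < \<beta>" "0 < \<sigma>" "0 < \<gamma>" "0 < \<delta>" "0 < \<nu>" "0 < \<tau>" "0 < \<sigma>'"
    using L_pos t_pos chi by (auto intro!: divide_pos_pos add_pos_pos mult_pos_pos)
  have \<sigma>1: "\<sigma> \<le> 1"
    using t_le chi t_pos by (simp add: divide_le_eq)
  have damping: "12 * \<gamma> * \<delta> * chi \<le> 1"
    using L_pos chi t_le t_pos by (simp add: field_simps)
  have taus: "1 / \<tau> = 1 / t + 1 / 2" "1 / \<sigma>' = 1 / \<sigma> + 1 / 2" by simp_all

  note XP = primal_step[OF L_pos t_pos t_le refl refl pos(8) taus(1) X' XG XF'
      gap_optimality[OF Rd(1), folded defs]
      gap_three_points[OF Rd(1,2), folded defs]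
      _ _, where Df = "gap (s_xf st)" and Df' = "gap (s_xf st')"]
  have primal: "(1 / \<eta> + \<nu>) * (norm (X' - x_opt))\<^sup>2 + 2 / t * gap (s_xf st')
    \<le> 1 / \<eta> * (norm (X - x_opt))\<^sup>2 + (1 / t - 3 / 2) * gap (s_xf st)
      + (1 / t + 1 / 2) * (gap (s_w st) - ref_gap (s_w st) (x_query st)) - gap (x_query st)
      + 2 * \<eta> * (norm N)\<^sup>2 - 2 * inner N (X - x_opt) + 2 * inner (Y' - y_opt) (X' - x_opt)"
  proof (rule XP)
    show "inner (GX - y_opt) (XF - XG) \<le> gap (s_xf st) - gap (x_query st)"
      unfolding defs gap_three_points[OF Rd(1,3)] using ref_gap_nonneg[OF Rd(1,3)] by simp
    show "gap (s_xf st') - gap (x_query st) - L / 2 * (norm (XF' - XG))\<^sup>2 \<le> inner (GX - y_opt) (XF' - XG)"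
      unfolding defs gap_three_points[OF Rd(1,4)] using ref_gap_le[OF Rd(1,4)] by simp
  qed
  note dual = dual_step[OF pos(2,3,4) \<sigma>1 pos(7) pos(9) taus(2) Y' s_opt_x_opt YG YF', of y_opt]
  have sg: "YG + ZG = \<sigma>' *\<^sub>R (Y + Z) + (1 - \<sigma>') *\<^sub>R (YF + ZF)"
    unfolding YG ZG by (simp add: algebra_simps)
  have sf': "YF' + ZF' = (YG + ZG) + \<sigma> *\<^sub>R (Y' - Y) - WQ"
    unfolding YF' ZF' by simp
  note coupling = coupling_step[OF chi pos(4) \<sigma>1 pos(9) taus(2) sg sf' contraction_Q orth(1,2)]
  have "inner (YG + ZG - s_opt) (Y + Z + (Y' - Y) - s_opt)
      = inner (YG + ZG - s_opt) (Y' - y_opt) + inner (YG + ZG - s_opt) (Z - z_opt)"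
    unfolding inner_add_right[symmetric] by (simp add: s_opt_eq algebra_simps)
  with coupling have coupling': "- 2 * (inner (YG + ZG - s_opt) (Y' - y_opt) + inner (YG + ZG - s_opt) (Z - z_opt))
      \<le> (1 / \<sigma> - 1 / 2) * (norm (YF + ZF - s_opt))\<^sup>2 - 1 / \<sigma> * (norm (YF' + ZF' - s_opt))\<^sup>2
        - 3 / 2 * (norm (YG + ZG - s_opt))\<^sup>2 - 1 / (2 * chi * \<sigma>) * (norm Q)\<^sup>2 + 9 * chi * \<sigma> * (norm (Y' - Y))\<^sup>2"
    by metis
  note consensus = consensus_step[OF chi pos(5,6,7) damping Z' M' contraction_R orth(3)]
  have zg: "(norm (ZG - z_opt))\<^sup>2 \<le> 2 * (norm (YG + ZG - s_opt))\<^sup>2 + 2 * (norm (YG - y_opt))\<^sup>2"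
    using norm_diff_sq_le[of "YG + ZG - s_opt" "YG - y_opt"] by (simp add: s_opt_eq algebra_simps)
  have ng: "(norm (GX + N - y_opt))\<^sup>2 = (norm (GX - y_opt))\<^sup>2 + 2 * inner N (GX - y_opt) + (norm N)\<^sup>2"
    using norm_add_sq[of "GX - y_opt" N] by (simp add: algebra_simps inner_commute)
  have cross: "2 * inner (Y' - y_opt) (X' - x_opt) = 2 * inner (X' - x_opt) (Y' - y_opt)"
    by (simp add: inner_commute)
  have lyap: "lyapunov st' = (1 / \<eta> + \<nu>) * (norm (X' - x_opt))\<^sup>2 + 2 / t * gap (s_xf st') + (1 / t + 1) * gap (s_xf st)
      + (1 / \<theta> + \<beta> / 2) * (norm (Y' - y_opt))\<^sup>2 + \<beta> / (2 * \<sigma>) * (norm (YF' - y_opt))\<^sup>2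
      + 1 / \<gamma> * (norm (Z' - M' - z_opt))\<^sup>2 + 2 / \<gamma> * (norm M')\<^sup>2 + 1 / (\<nu> * \<sigma>) * (norm (YF' + ZF' - s_opt))\<^sup>2"
  proof -
    have "gap (s_w st') = gap (s_xf st)"
      unfolding gap_def by (rule sum.cong) (use ch in \<open>auto simp: upd(4)\<close>)
    then show ?thesis unfolding lyapunov_def defs by simp
  qed
  have "lyapunov st' \<le> (1 - \<rho>) * lyapunov st
      + (2 * \<eta> + \<beta>) * (norm N)\<^sup>2 - (1 / t + 1 / 2) * ref_gap (s_w st) (x_query st)
      + (2 * \<beta> * inner N (GX - y_opt) - 2 * inner N (X - x_opt))"
    unfolding lyap unfolding lyapunov_def defs[symmetric]
    by (rule lyapunov_combine[OF L_pos t_pos t_le chi refl refl refl refl refl refl refl refl refl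
        _ _ _ _ _ _ _ _ _ _ _ _ primal dual[folded cross] coupling' consensus zg ng
        gap_cocoercive[OF Rd(1), folded defs]])
       (use gap_nonneg Rd ref_gap_nonneg[OF Rd(1,2)] in auto)
  moreover have "stack m (noise_direction st) = (2 * \<beta>) *\<^sub>R (GX - y_opt) - 2 *\<^sub>R (X - x_opt)"
    unfolding defs x_opt_def y_opt_def stacks[symmetric] by (rule stack_cong) (simp add: noise_direction_def)
  ultimately show ?thesis unfolding st'_def N_def by (simp add: inner_diff_right)
qed

end

section \<open>Bias and variance of the gradient estimator\<close>

lemma sum_singleton_Times: "(\<Sum>a\<in>{i} \<times> B. h a) = (\<Sum>s\<in>B. h (i, s))"
proof -
  have "{i} \<times> B = Pair i ` B" by auto
  then show ?thesis by (simp add: sum.reindex inj_on_def)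
qed

lemma sum_bregman_F_node:
  assumes "c \<in> Rd d" "\<forall>j<n. smooth d (Lf j) (f i j)"
  shows "(1 / real n) * (\<Sum>j<n. bregman (f i j) (grad d (f i j)) a c)
    = bregman (F_node n f i) (grad d (F_node n f i)) a c"
  using assms by (simp add: bregman_def grad_F_node F_node_def sum_subtractf inner_sum_left right_diff_distrib)

text \<open>
  For a strongly convex \<open>F\<^sub>i\<close> it follows that the constants \<open>L\<^sub>i\<^sub>j\<close> of the node do not all vanish,
  so that the sampling probabilities are well defined.
\<close>

lemma smooth_F_node:
  assumes f: "\<forall>j<n. smooth d (Lf j) (f i j)"
    and diff: "\<forall>v\<in>Rd d. F_node n f i differentiable (at v within Rd d)"
  shows "smooth d ((1 / real n) * (\<Sum>j<n. Lf j)) (F_node n f i)"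
  unfolding smooth_def
proof (intro conjI ballI)
  fix v w assume vw: "v \<in> Rd d" "w \<in> Rd d"
  have "norm (grad d (F_node n f i) v - grad d (F_node n f i) w)
      = (1 / real n) * norm (\<Sum>j<n. grad d (f i j) v - grad d (f i j) w)"
    unfolding grad_F_node[where f = f and i = i, OF vw(1) f] grad_F_node[where f = f and i = i, OF vw(2) f] scaleR_diff_right[symmetric] sum_subtractf[symmetric]
    by simp
  also have "\<dots> \<le> (1 / real n) * (\<Sum>j<n. Lf j * norm (v - w))"
  proof (intro mult_left_mono order.trans[OF norm_sum] sum_mono)
    show "norm (grad d (f i j) v - grad d (f i j) w) \<le> Lf j * norm (v - w)" if "j \<in> {..<n}" for j
      using f that vw unfolding smooth_def by blast
  qed simp
  finally show "norm (grad d (F_node n f i) v - grad d (F_node n f i) w)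
      \<le> (1 / real n) * (\<Sum>j<n. Lf j) * norm (v - w)"
    by (simp add: sum_distrib_right)
qed (use diff in auto)

context adom_problem
begin

lemma Lf_nonneg: "i < m \<Longrightarrow> j < n \<Longrightarrow> 0 \<le> Lf i j"
  using smooth_nonneg[OF dims(1)] components by blast

lemma components_smooth: "i < m \<Longrightarrow> \<forall>j<n. smooth d (Lf i j) (f i j)"
  using components by blast

lemma grad_node:
  assumes "i < m" "v \<in> Rd d"
  shows "grad d (F_node n f i) v = (1 / real n) *\<^sub>R (\<Sum>j<n. grad d (f i j) v)"
  by (rule grad_F_node[where f = f and i = i, OF assms(2) components_smooth[OF assms(1)]])

lemma sum_Lf_pos:
  assumes "i < m"
  shows "0 < (\<Sum>j<n. Lf i j)"
proof -
  have "smooth d ((1 / real n) * (\<Sum>j<n. Lf i j)) (F_node n f i)"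
    using nodes assms by (intro smooth_F_node components_smooth) (auto simp: smooth_def)
  then have "\<mu> \<le> (1 / real n) * (\<Sum>j<n. Lf i j)"
    using nodes assms by (intro strongly_convex_le_smooth[OF dims(1)]) auto
  then have "0 < (1 / real n) * (\<Sum>j<n. Lf i j)" using mu by linarith
  then show ?thesis by (simp add: zero_less_divide_iff)
qed

lemma mean_Lf_le_Lbar: "i < m \<Longrightarrow> (1 / real n) * (\<Sum>j<n. Lf i j) \<le> Lbar"
  unfolding Lbar by (rule Max_ge) auto

lemma pmf_index: "i < m \<Longrightarrow> pmf (index_pmf n Lf i) j = (if j < n then index_prob n Lf i j else 0)"
  by (rule pmf_index_pmf) (use Lf_nonneg sum_Lf_pos in auto)

lemma set_index: "i < m \<Longrightarrow> set_pmf (index_pmf n Lf i) \<subseteq> {..<n}"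
  by (auto simp: set_pmf_eq pmf_index split: if_splits)

definition sample :: "(nat \<Rightarrow> fseq) \<Rightarrow> (nat \<Rightarrow> fseq) \<Rightarrow> nat \<Rightarrow> nat \<Rightarrow> fseq" where
  "sample x w i j = (1 / (real n * index_prob n Lf i j)) *\<^sub>R (grad d (f i j) (x i) - grad d (f i j) (w i))"

definition grad_shift :: "(nat \<Rightarrow> fseq) \<Rightarrow> (nat \<Rightarrow> fseq) \<Rightarrow> nat \<Rightarrow> fseq" where
  "grad_shift x w i = grad d (F_node n f i) (x i) - grad d (F_node n f i) (w i)"

lemma grad_constant_of_Lf_zero:
  assumes "i < m" "j < n" "Lf i j = 0" "v \<in> Rd d" "w \<in> Rd d"
  shows "grad d (f i j) v = grad d (f i j) w"
proof -
  have "norm (grad d (f i j) v - grad d (f i j) w) \<le> Lf i j * norm (v - w)"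
    using components_smooth[OF assms(1)] assms unfolding smooth_def by blast
  then show ?thesis using assms(3) by simp
qed

text \<open>
  Importance weights make the estimator unbiased. An index with \<open>L\<^sub>i\<^sub>j = 0\<close> is never drawn, but
  then \<open>f\<^sub>i\<^sub>j\<close> has a constant gradient and nothing is lost.
\<close>

lemma sample_mean:
  assumes i: "i < m" and xw: "x i \<in> Rd d" "w i \<in> Rd d"
  shows "(\<Sum>j<n. pmf (index_pmf n Lf i) j *\<^sub>R sample x w i j) = grad_shift x w i"
proof -
  have "(\<Sum>j<n. pmf (index_pmf n Lf i) j *\<^sub>R sample x w i j)
      = (\<Sum>j<n. (1 / real n) *\<^sub>R (grad d (f i j) (x i) - grad d (f i j) (w i)))"
  proof (rule sum.cong[OF refl])
    fix j assume "j \<in> {..<n}"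
    then have j: "j < n" by simp
    show "pmf (index_pmf n Lf i) j *\<^sub>R sample x w i j = (1 / real n) *\<^sub>R (grad d (f i j) (x i) - grad d (f i j) (w i))"
    proof (cases "Lf i j = 0")
      case True
      then show ?thesis using grad_constant_of_Lf_zero[OF i j True xw] by (simp add: sample_def)
    next
      case False
      then have "index_prob n Lf i j \<noteq> 0" using sum_Lf_pos[OF i] by (simp add: index_prob_def)
      then show ?thesis using j i by (simp add: sample_def pmf_index)
    qed
  qed
  also have "\<dots> = grad_shift x w i"
    unfolding grad_shift_def grad_node[OF i xw(1)] grad_node[OF i xw(2)]
    by (simp add: scaleR_sum_right scaleR_diff_right sum_subtractf)
  finally show ?thesis .
qed

text \<open>
  With probabilities proportional to \<open>L\<^sub>i\<^sub>j\<close>, the factor \<open>L\<^sub>i\<^sub>j\<close> of cocoercivity cancels against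
  the importance weight; every component contributes its Bregman distance with the same factor,
  the mean of the \<open>L\<^sub>i\<^sub>j\<close>.
\<close>

lemma sample_second_moment:
  assumes i: "i < m" and xw: "x i \<in> Rd d" "w i \<in> Rd d"
  shows "(\<Sum>j<n. pmf (index_pmf n Lf i) j * (norm (sample x w i j))\<^sup>2)
    \<le> 2 * Lbar * bregman (F_node n f i) (grad d (F_node n f i)) (w i) (x i)"
proof -
  let ?T = "\<Sum>j<n. Lf i j"
  let ?D = "\<lambda>j. bregman (f i j) (grad d (f i j)) (w i) (x i)"
  have D: "0 \<le> ?D j" if "j < n" for j
    using components i that xw by (intro convex_bregman_nonneg[where l = "Lf i j"]) auto
  have T: "0 < ?T" by (rule sum_Lf_pos[OF i])
  have "(\<Sum>j<n. pmf (index_pmf n Lf i) j * (norm (sample x w i j))\<^sup>2)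
     \<le> (\<Sum>j<n. 2 * ((1 / real n) * ?T) * ((1 / real n) * ?D j))"
  proof (rule sum_mono)
    fix j assume "j \<in> {..<n}"
    then have j: "j < n" by simp
    show "pmf (index_pmf n Lf i) j * (norm (sample x w i j))\<^sup>2 \<le> 2 * ((1 / real n) * ?T) * ((1 / real n) * ?D j)"
    proof (cases "Lf i j = 0")
      case True
      then show ?thesis using D[OF j] T by (simp add: sample_def grad_constant_of_Lf_zero[OF i j True xw])
    next
      case False
      then have l: "0 < Lf i j" using Lf_nonneg[OF i j] by simp
      have coc: "(norm (grad d (f i j) (w i) - grad d (f i j) (x i)))\<^sup>2 \<le> 2 * Lf i j * ?D j"
      proof (rule cocoercive[OF subspace_Rd xw(2,1) _ l])
        have c: "smooth d (Lf i j) (f i j)" "convex_on (Rd d) (f i j)" using components i j by auto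
        show "grad d (f i j) a \<in> Rd d" if "a \<in> Rd d" for a by (rule grad_in_Rd[OF that c(1)])
        show "0 \<le> bregman (f i j) (grad d (f i j)) a c" if "a \<in> Rd d" "c \<in> Rd d" for a c
          by (rule convex_bregman_nonneg[OF that(2,1) c])
        show "bregman (f i j) (grad d (f i j)) a c \<le> Lf i j / 2 * (norm (a - c))\<^sup>2"
          if "a \<in> Rd d" "c \<in> Rd d" for a c
          by (rule smooth_bregman_le[OF that(2,1) c(1)])
      qed
      have "pmf (index_pmf n Lf i) j * (norm (sample x w i j))\<^sup>2
          = (?T / (Lf i j * (real n)\<^sup>2)) * (norm (grad d (f i j) (w i) - grad d (f i j) (x i)))\<^sup>2"
        unfolding sample_def norm_scaleR_sq norm_minus_commute[of "grad d (f i j) (x i)"]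
        using i j l T by (simp add: pmf_index index_prob_def power2_eq_square field_simps)
      also have "\<dots> \<le> (?T / (Lf i j * (real n)\<^sup>2)) * (2 * Lf i j * ?D j)"
        using coc l T by (intro mult_left_mono) auto
      also have "\<dots> = 2 * ((1 / real n) * ?T) * ((1 / real n) * ?D j)"
        using l by (simp add: power2_eq_square)
      finally show ?thesis .
    qed
  qed
  also have "\<dots> = 2 * ((1 / real n) * ?T) * bregman (F_node n f i) (grad d (F_node n f i)) (w i) (x i)"
    unfolding sum_distrib_left[symmetric] sum_bregman_F_node[where f = f and i = i, OF xw(1) components_smooth[OF i]] ..
  also have "\<dots> \<le> 2 * Lbar * bregman (F_node n f i) (grad d (F_node n f i)) (w i) (x i)"
  proof (intro mult_right_mono mult_left_mono mean_Lf_le_Lbar i)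
    have "0 \<le> bregman (f_reg i) (g_reg i) (w i) (x i)" by (rule f_reg_nonneg[OF i xw(2,1)])
    moreover have "0 \<le> \<nu> / 2 * (norm (w i - x i))\<^sup>2" using L_pos by simp
    ultimately show "0 \<le> bregman (F_node n f i) (grad d (F_node n f i)) (w i) (x i)"
      unfolding bregman_f_reg by linarith
  qed simp
  finally show ?thesis .
qed

lemma noise_eq:
  "noise S st i = (1 / real b) *\<^sub>R
     (\<Sum>s<b. sample (x_query st) (s_w st) i (S (i, s)) - grad_shift (x_query st) (s_w st) i)"
proof -
  have "(1 / real b) *\<^sub>R (\<Sum>s<b. c) = c" for c :: fseq
    using dims(4) by (simp add: sum_constant_scaleR)
  then show ?thesis
    by (simp add: noise_def stoch_grad_def sample_def grad_shift_def Let_def sum_subtractf scaleR_diff_right)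
qed

lemma finite_index: "i < m \<Longrightarrow> finite (set_pmf (index_pmf n Lf i))"
  using set_index finite_subset by blast

lemma set_batch:
  "set_pmf (batch_pmf m n b Lf) = PiE_dflt ({..<m} \<times> {..<b}) 0 (set_pmf \<circ> (\<lambda>(i, s). index_pmf n Lf i))"
  unfolding batch_pmf_def by (rule set_Pi_pmf) simp

lemma finite_batch: "finite (set_pmf (batch_pmf m n b Lf))"
  unfolding set_batch by (rule finite_PiE_dflt) (auto simp: finite_index)

lemma batch_index_lt:
  assumes "S \<in> set_pmf (batch_pmf m n b Lf)"
  shows "\<forall>i<m. \<forall>s<b. S (i, s) < n"
proof (intro allI impI)
  fix i s assume lt: "i < m" "s < b"
  have "S (i, s) \<in> set_pmf (index_pmf n Lf i)"
    using assms lt unfolding set_batch PiE_dflt_def by auto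
  then show "S (i, s) < n" using set_index[OF lt(1)] by auto
qed

lemma sample_centered:
  assumes i: "i < m" and xw: "x i \<in> Rd d" "w i \<in> Rd d"
  shows "measure_pmf.expectation (index_pmf n Lf i) (\<lambda>j. inner (sample x w i j - grad_shift x w i) v) = 0"
proof (rule expectation_inner_zero_mean[OF _ set_index[OF i]])
  have "(\<Sum>j<n. pmf (index_pmf n Lf i) j) = 1" by (rule sum_pmf_eq_1[OF _ set_index[OF i]]) simp
  then show "(\<Sum>j<n. pmf (index_pmf n Lf i) j *\<^sub>R (sample x w i j - grad_shift x w i)) = 0"
    by (simp add: scaleR_diff_right sum_subtractf sample_mean[where x = x and w = w, OF i xw] flip: scaleR_sum_left)
qed simp

lemma noise_mean:
  assumes v: "valid st"
  shows "measure_pmf.expectation (batch_pmf m n b Lf) (\<lambda>S. inner (stack m (noise S st)) (stack m y)) = 0"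
proof -
  let ?B = "batch_pmf m n b Lf" and ?x = "x_query st" and ?w = "s_w st"
  have 0: "measure_pmf.expectation ?B (\<lambda>S. inner (sample ?x ?w i (S (i, s)) - grad_shift ?x ?w i) (y i)) = 0"
    if "i < m" "s < b" for i s
  proof -
    have "measure_pmf.expectation ?B (\<lambda>S. inner (sample ?x ?w i (S (i, s)) - grad_shift ?x ?w i) (y i))
        = measure_pmf.expectation (map_pmf (\<lambda>S. S (i, s)) ?B)
            (\<lambda>j. inner (sample ?x ?w i j - grad_shift ?x ?w i) (y i))"
      by simp
    also have "map_pmf (\<lambda>S. S (i, s)) ?B = index_pmf n Lf i"
      unfolding batch_pmf_def using that by (subst Pi_pmf_component) auto
    also have "measure_pmf.expectation (index_pmf n Lf i)
            (\<lambda>j. inner (sample ?x ?w i j - grad_shift ?x ?w i) (y i)) = 0"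
      using v query_in_Rd[OF v] that by (intro sample_centered) (auto simp: valid_def)
    finally show ?thesis .
  qed
  have "measure_pmf.expectation ?B (\<lambda>S. inner (stack m (noise S st)) (stack m y))
      = measure_pmf.expectation ?B (\<lambda>S. \<Sum>i<m. (1 / real b) *
          (\<Sum>s<b. inner (sample ?x ?w i (S (i, s)) - grad_shift ?x ?w i) (y i)))"
    unfolding inner_stack noise_eq inner_scaleR_left inner_sum_left ..
  also have "\<dots> = (\<Sum>i<m. (1 / real b) *
          (\<Sum>s<b. measure_pmf.expectation ?B (\<lambda>S. inner (sample ?x ?w i (S (i, s)) - grad_shift ?x ?w i) (y i))))"
    by (simp add: integrable_measure_pmf_finite[OF finite_batch])
  also have "\<dots> = 0" by (simp add: 0)
  finally show ?thesis .
qed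

text \<open>
  Averaging \<open>b\<close> independent samples divides the second moment by \<open>b\<close>, and \<open>Lbar / b \<le> L\<close>.
\<close>

lemma noise_variance:
  assumes v: "valid st"
  shows "measure_pmf.expectation (batch_pmf m n b Lf) (\<lambda>S. (norm (stack m (noise S st)))\<^sup>2)
    \<le> 4 * L * ref_gap (s_w st) (x_query st)"
proof -
  let ?B = "batch_pmf m n b Lf" and ?x = "x_query st" and ?w = "s_w st"
  let ?U = "\<lambda>(i, s) j. sample ?x ?w i j - grad_shift ?x ?w i"
  have node: "measure_pmf.expectation ?B (\<lambda>S. (norm (noise S st i))\<^sup>2)
      \<le> 4 * L * bregman (f_reg i) (g_reg i) (?w i) (?x i)" if i: "i < m" for i
  proof -
    let ?I = "index_pmf n Lf i" and ?D = "bregman (F_node n f i) (grad d (F_node n f i)) (?w i) (?x i)"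
    have xw: "?x i \<in> Rd d" "?w i \<in> Rd d" using v query_in_Rd[OF v] i by (auto simp: valid_def)
    have J: "{i} \<times> {..<b} \<subseteq> {..<m} \<times> {..<b}" using i by auto
    have "(\<Sum>s<b. sample ?x ?w i (S (i, s)) - grad_shift ?x ?w i) = (\<Sum>a\<in>{i} \<times> {..<b}. ?U a (S a))" for S
      by (simp add: sum_singleton_Times)
    then have "measure_pmf.expectation ?B (\<lambda>S. (norm (noise S st i))\<^sup>2)
        = (1 / real b)\<^sup>2 * measure_pmf.expectation ?B (\<lambda>S. (norm (\<Sum>a\<in>{i} \<times> {..<b}. ?U a (S a)))\<^sup>2)"
      unfolding noise_eq norm_scaleR_sq by simp
    also have "measure_pmf.expectation ?B (\<lambda>S. (norm (\<Sum>a\<in>{i} \<times> {..<b}. ?U a (S a)))\<^sup>2)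
        = (\<Sum>a\<in>{i} \<times> {..<b}. measure_pmf.expectation ((\<lambda>(i, s). index_pmf n Lf i) a) (\<lambda>j. (norm (?U a j))\<^sup>2))"
      unfolding batch_pmf_def
      by (rule expectation_norm_sq_sum_independent[OF _ J])
         (use i xw in \<open>auto simp: finite_index sample_centered\<close>)
    also have "\<dots> = real b * measure_pmf.expectation ?I (\<lambda>j. (norm (sample ?x ?w i j - grad_shift ?x ?w i))\<^sup>2)"
      by (simp add: sum_singleton_Times)
    finally have eq: "measure_pmf.expectation ?B (\<lambda>S. (norm (noise S st i))\<^sup>2)
        = (1 / real b) * measure_pmf.expectation ?I (\<lambda>j. (norm (sample ?x ?w i j - grad_shift ?x ?w i))\<^sup>2)"
      using dims(4) by (simp add: power2_eq_square)
    have "measure_pmf.expectation ?I (\<lambda>j. (norm (sample ?x ?w i j - grad_shift ?x ?w i))\<^sup>2)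
        \<le> (\<Sum>j<n. pmf ?I j * (norm (sample ?x ?w i j))\<^sup>2)"
      using expectation_norm_sq_centered[OF _ set_index[OF i], of "sample ?x ?w i"]
      by (simp add: sample_mean[where x = ?x and w = ?w, OF i xw])
    also have "\<dots> \<le> 2 * Lbar * ?D" by (rule sample_second_moment[where x = ?x and w = ?w, OF i xw])
    finally have "measure_pmf.expectation ?B (\<lambda>S. (norm (noise S st i))\<^sup>2) \<le> (1 / real b) * (2 * Lbar * ?D)"
      unfolding eq by (intro mult_left_mono) auto
    also have "\<dots> = (Lbar / real b) * (2 * ?D)" by simp
    also have "\<dots> \<le> L * (2 * (2 * bregman (f_reg i) (g_reg i) (?w i) (?x i)))"
    proof (rule mult_mono)
      show "Lbar / real b \<le> L" using batch L_pos dims(4) by (simp add: field_simps)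
      show "2 * ?D \<le> 2 * (2 * bregman (f_reg i) (g_reg i) (?w i) (?x i))"
        using bregman_F_le[OF i xw(2,1)] by simp
      have "0 \<le> bregman (f_reg i) (g_reg i) (?w i) (?x i)" by (rule f_reg_nonneg[OF i xw(2,1)])
      moreover have "0 \<le> \<nu> / 2 * (norm (?w i - ?x i))\<^sup>2" using L_pos by simp
      ultimately show "0 \<le> 2 * ?D" unfolding bregman_f_reg by linarith
    qed (use L_pos in simp)
    finally show ?thesis by simp
  qed
  have "measure_pmf.expectation ?B (\<lambda>S. (norm (stack m (noise S st)))\<^sup>2)
      = (\<Sum>i<m. measure_pmf.expectation ?B (\<lambda>S. (norm (noise S st i))\<^sup>2))"
    unfolding norm_stack by (simp add: integrable_measure_pmf_finite[OF finite_batch])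
  also have "\<dots> \<le> (\<Sum>i<m. 4 * L * bregman (f_reg i) (g_reg i) (?w i) (?x i))"
    by (intro sum_mono node) simp
  finally show ?thesis by (simp add: ref_gap_def sum_distrib_left)
qed

end

section \<open>Linear convergence in expectation\<close>

context adom_problem
begin

abbreviation "iteration k st \<equiv> map_pmf (\<lambda>(S, ch). update d m n b f Lf P (W k) S ch st)
  (pair_pmf (batch_pmf m n b Lf) (choices_pmf m P))"

lemma iteration_eq:
  "iteration k st = map_pmf (\<lambda>S. update d m n b f Lf P (W k) S (\<lambda>i. if i < m then Take_f else Keep) st)
     (batch_pmf m n b Lf)"
  unfolding choices_pmf_always_Take_f[OF P_admissible P_simps(14,15)] pair_return_pmf2
  by (simp add: map_pmf_comp)

lemma finite_iteration: "finite (set_pmf (iteration k st))"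
  unfolding iteration_eq by (simp add: finite_batch)

lemma valid_iteration: "valid st \<Longrightarrow> st' \<in> set_pmf (iteration k st) \<Longrightarrow> valid st'"
  unfolding iteration_eq by (auto intro!: valid_update dest: batch_index_lt)

text \<open>
  The variance of the noise uses up exactly the negative Bregman distance, since \<open>(2 * \<eta> + \<beta>) * (4
  * L) = 1 / t + 1 / 2\<close>.
\<close>

lemma expected_descent:
  assumes v: "valid st"
  shows "measure_pmf.expectation (iteration k st) lyapunov \<le> (1 - \<rho>) * lyapunov st"
proof -
  let ?B = "batch_pmf m n b Lf" and ?R = "ref_gap (s_w st) (x_query st)"
  let ?up = "\<lambda>S. update d m n b f Lf P (W k) S (\<lambda>i. if i < m then Take_f else Keep) st"
  let ?n = "\<lambda>S. (norm (stack m (noise S st)))\<^sup>2"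
  let ?c = "\<lambda>S. inner (stack m (noise S st)) (stack m (noise_direction st))"
  note int = integrable_measure_pmf_finite[OF finite_batch]
  have "measure_pmf.expectation (iteration k st) lyapunov = measure_pmf.expectation ?B (\<lambda>S. lyapunov (?up S))"
    unfolding iteration_eq by simp
  also have "\<dots> \<le> measure_pmf.expectation ?B
      (\<lambda>S. (1 - \<rho>) * lyapunov st + (2 * \<eta> + \<beta>) * ?n S - (1 / t + 1 / 2) * ?R + ?c S)"
  proof (rule integral_mono_AE[OF int int])
    show "AE S in ?B. lyapunov (?up S)
        \<le> (1 - \<rho>) * lyapunov st + (2 * \<eta> + \<beta>) * ?n S - (1 / t + 1 / 2) * ?R + ?c S"
      unfolding AE_measure_pmf_iff
      by (intro ballI pathwise_descent[OF v batch_index_lt]) simp_all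
  qed
  also have "\<dots> = (1 - \<rho>) * lyapunov st + (2 * \<eta> + \<beta>) * measure_pmf.expectation ?B ?n
      - (1 / t + 1 / 2) * ?R + measure_pmf.expectation ?B ?c"
    by (simp add: int)
  also have "\<dots> \<le> (1 - \<rho>) * lyapunov st"
  proof -
    have "0 \<le> 2 * \<eta> + \<beta>" using L_pos t_pos by simp
    then have "(2 * \<eta> + \<beta>) * measure_pmf.expectation ?B ?n \<le> (2 * \<eta> + \<beta>) * (4 * L * ?R)"
      by (intro mult_left_mono noise_variance[OF v])
    also have "\<dots> = ((2 * \<eta> + \<beta>) * (4 * L)) * ?R" by simp
    also have "(2 * \<eta> + \<beta>) * (4 * L) = 1 / t + 1 / 2" using L_pos t_pos by (simp add: field_simps)
    finally show ?thesis unfolding noise_mean[OF v] by simp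
  qed
  finally show ?thesis .
qed

lemma lyapunov_ge:
  assumes "valid st"
  shows "1 / \<eta> * (\<Sum>i<m. (norm (s_x st i - u))\<^sup>2) \<le> lyapunov st"
proof -
  have g: "0 \<le> gap (s_xf st)" "0 \<le> gap (s_w st)"
    using assms by (auto intro!: gap_nonneg simp: valid_def)
  have "(norm (stack m (s_x st) - x_opt))\<^sup>2 = (\<Sum>i<m. (norm (s_x st i - u))\<^sup>2)"
    unfolding x_opt_def stack_diff[symmetric] norm_stack ..
  moreover have "1 / \<eta> * q \<le> (1 / \<eta> + \<nu>) * q" if "0 \<le> q" for q
    using that L_pos by (intro mult_right_mono) auto
  moreover have "0 \<le> 2 / t * gap (s_xf st)" "0 \<le> (1 / t + 1) * gap (s_w st)"
    using g t_pos by simp_all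
  moreover have "0 \<le> (1 / \<theta> + \<beta> / 2) * q\<^sup>2" "0 \<le> \<beta> / (2 * \<sigma>) * q\<^sup>2" "0 \<le> 1 / \<gamma> * q\<^sup>2" "0 \<le> 2 / \<gamma> * q\<^sup>2"
    "0 \<le> 1 / (\<nu> * \<sigma>) * q\<^sup>2" for q :: real
    using L_pos t_pos chi by simp_all
  ultimately show ?thesis unfolding lyapunov_def
    by (smt (verit) zero_le_power2)
qed

lemma rho_bounds: "0 < \<rho>" "\<rho> \<le> 1"
  using t_pos t_le chi by (simp_all add: divide_le_eq)

context
  fixes x0 y0 z0 m0 :: "nat \<Rightarrow> fseq"
  assumes init: "\<forall>i<m. x0 i \<in> Rd d \<and> y0 i \<in> Rd d \<and> z0 i \<in> Rd d \<and> m0 i \<in> Rd d" and z0: "(\<Sum>i<m. z0 i) = 0"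
begin

abbreviation "law k \<equiv> adom_vr d m n b f Lf P W x0 y0 z0 m0 k"
abbreviation "st0 \<equiv> \<lparr> s_x = x0, s_xf = x0, s_w = x0, s_y = y0, s_yf = y0, s_z = z0, s_zf = z0, s_m = m0 \<rparr>"

lemma finite_law: "finite (set_pmf (law k))"
proof (induction k)
  case (Suc k)
  then show ?case using finite_iteration by simp
qed simp

lemma valid_law: "st \<in> set_pmf (law k) \<Longrightarrow> valid st"
proof (induction k arbitrary: st)
  case 0
  then show ?case using init z0 by (simp add: valid_def)
next
  case (Suc k)
  from Suc.prems obtain st1 where "st1 \<in> set_pmf (law k)" "st \<in> set_pmf (iteration k st1)"
    unfolding adom_vr.simps set_bind_pmf by blast
  then show ?case using Suc.IH valid_iteration by blast
qed

lemma expected_lyapunov_le: "measure_pmf.expectation (law k) lyapunov \<le> (1 - \<rho>) ^ k * lyapunov st0"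
proof (induction k)
  case (Suc k)
  have "measure_pmf.expectation (law (Suc k)) lyapunov
      = (\<Sum>st\<in>set_pmf (law k). pmf (law k) st *\<^sub>R measure_pmf.expectation (iteration k st) lyapunov)"
    unfolding adom_vr.simps by (rule pmf_expectation_bind[OF finite_law finite_iteration order_refl])
  also have "\<dots> \<le> (\<Sum>st\<in>set_pmf (law k). pmf (law k) st *\<^sub>R ((1 - \<rho>) * lyapunov st))"
    by (intro sum_mono scaleR_left_mono expected_descent valid_law) auto
  also have "\<dots> = (1 - \<rho>) * measure_pmf.expectation (law k) lyapunov"
    by (simp add: expectation_finite[OF finite_law order_refl] sum_distrib_left mult_ac)
  also have "\<dots> \<le> (1 - \<rho>) * ((1 - \<rho>) ^ k * lyapunov st0)"
    using rho_bounds by (intro mult_left_mono Suc.IH) simp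
  finally show ?case by simp
qed simp

lemma mean_sq_error_le: "mean_sq_error m (law k) u \<le> \<eta> * lyapunov st0 * exp (- \<rho> * real k)"
proof -
  have "mean_sq_error m (law k) u \<le> measure_pmf.expectation (law k) (\<lambda>st. \<eta> * lyapunov st)"
    unfolding mean_sq_error_def
  proof (rule integral_mono_AE[OF integrable_measure_pmf_finite[OF finite_law] integrable_measure_pmf_finite[OF finite_law]])
    show "AE st in law k. (\<Sum>i<m. (norm (s_x st i - u))\<^sup>2) \<le> \<eta> * lyapunov st"
      unfolding AE_measure_pmf_iff
    proof
      fix st assume "st \<in> set_pmf (law k)"
      from lyapunov_ge[OF valid_law[OF this]]
      show "(\<Sum>i<m. (norm (s_x st i - u))\<^sup>2) \<le> \<eta> * lyapunov st"
        using L_pos t_pos by (simp add: field_simps)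
    qed
  qed
  also have "\<dots> = \<eta> * measure_pmf.expectation (law k) lyapunov" by simp
  also have "\<dots> \<le> \<eta> * ((1 - \<rho>) ^ k * lyapunov st0)"
    using L_pos t_pos by (intro mult_left_mono expected_lyapunov_le) simp
  also have "\<dots> \<le> \<eta> * (exp (- \<rho> * real k) * lyapunov st0)"
  proof (intro mult_left_mono mult_right_mono)
    have "(1 - \<rho>) ^ k \<le> exp (- \<rho>) ^ k"
      using rho_bounds exp_ge_add_one_self[of "- \<rho>"] by (intro power_mono) auto
    also have "exp (- \<rho>) ^ k = exp (- \<rho> * real k)"
      unfolding exp_of_nat_mult[symmetric] by (simp only: mult.commute)
    finally show "(1 - \<rho>) ^ k \<le> exp (- \<rho> * real k)" .
    have "valid st0" using valid_law[of st0 0] by simp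
    then have "1 / \<eta> * (\<Sum>i<m. (norm (s_x st0 i - u))\<^sup>2) \<le> lyapunov st0" by (rule lyapunov_ge)
    moreover have "0 \<le> 1 / \<eta> * (\<Sum>i<m. (norm (s_x st0 i - u))\<^sup>2)"
      using L_pos t_pos by (intro mult_nonneg_nonneg sum_nonneg) auto
    ultimately show "0 \<le> lyapunov st0" by linarith
  qed (use L_pos t_pos in simp)
  finally show ?thesis by (simp add: mult_ac)
qed

end

lemma inverse_rho_le_complexity: "1 / \<rho> \<le> 512 * complexity n b L Lbar \<mu> chi"
proof -
  have "0 < (1 / real n) * (\<Sum>j<n. Lf 0 j)" using sum_Lf_pos[of 0] dims by simp
  then have Lbar0: "0 \<le> Lbar" using mean_Lf_le_Lbar[of 0] dims by linarith
  have "1 / t = 2 * sqrt (L / \<mu>)" unfolding adom_step_def by (simp add: real_sqrt_divide)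
  moreover have "1 / \<rho> = 256 * chi * (1 / t)" by simp
  ultimately have "1 / \<rho> = 512 * (chi * sqrt (L / \<mu>))" by simp
  also have "chi * sqrt (L / \<mu>) \<le> complexity n b L Lbar \<mu> chi"
  proof -
    have "(0 + chi) * sqrt (L / \<mu>) \<le> (sqrt (real n) / real b + real n * Lbar / ((real b)\<^sup>2 * L) + chi) * sqrt (L / \<mu>)"
      using Lbar0 L_pos mu by (intro mult_right_mono add_right_mono add_nonneg_nonneg) auto
    moreover have "0 \<le> real n / real b" by simp
    ultimately show ?thesis unfolding complexity_def add_0_left by (intro add_increasing)
  qed
  finally show ?thesis by simp
qed

end

text \<open>
  The factor \<open>exp 1\<close> in \<open>C\<close> absorbs the rounding of the number of iterations: either no iteration
  is necessary, or the logarithm is at least one.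
\<close>

lemma iterations_for_exponential_decay:
  fixes e :: "nat \<Rightarrow> real"
  assumes decay: "\<And>k. e k \<le> C0 * exp (- r * real k)" and C0: "0 \<le> C0" and r: "0 < r" "r \<le> 1" "1 / r \<le> K"
  shows "\<exists>C>0. \<forall>\<epsilon>>0. \<exists>N. real N \<le> K * max 0 (ln (C / \<epsilon>)) \<and> e N \<le> \<epsilon>"
proof (intro exI[of _ "exp 1 * (C0 + 1)"] conjI allI impI)
  show "0 < exp 1 * (C0 + 1)" using C0 by simp
  fix \<epsilon> :: real assume e: "0 < \<epsilon>"
  have K: "1 \<le> K" using r by (smt (verit) le_divide_eq_1_pos)
  show "\<exists>N. real N \<le> K * max 0 (ln (exp 1 * (C0 + 1) / \<epsilon>)) \<and> e N \<le> \<epsilon>"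
  proof (cases "C0 + 1 \<le> \<epsilon>")
    case True
    then have "e 0 \<le> \<epsilon>" using decay[of 0] by simp
    then show ?thesis using K by (intro exI[of _ 0]) simp
  next
    case False
    define l where "l = ln ((C0 + 1) / \<epsilon>)"
    have l: "0 \<le> l" using False e by (simp add: l_def)
    have ln: "ln (exp 1 * (C0 + 1) / \<epsilon>) = 1 + l"
      using C0 e by (simp add: l_def ln_mult ln_div)
    define N where "N = nat \<lceil>l / r\<rceil>"
    have N: "l / r \<le> real N" "real N \<le> l / r + 1"
      using l r by (simp_all add: N_def)
    have "real N \<le> (1 / r) * l + 1 / r" using N r by (simp add: field_simps)
    also have "\<dots> = (1 / r) * (1 + l)" by (simp add: add_divide_distrib)
    also have "\<dots> \<le> K * (1 + l)" using r l by (intro mult_right_mono) auto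
    finally have 1: "real N \<le> K * max 0 (ln (exp 1 * (C0 + 1) / \<epsilon>))" using ln l by simp
    have "e N \<le> C0 * exp (- r * real N)" by (rule decay)
    also have "\<dots> \<le> C0 * exp (- l)"
      using N(1) r C0 by (intro mult_left_mono) (auto simp: field_simps)
    also have "exp (- l) = \<epsilon> / (C0 + 1)"
      using C0 e unfolding l_def by (simp add: exp_minus)
    also have "C0 * (\<epsilon> / (C0 + 1)) \<le> \<epsilon>" using C0 e by (simp add: field_simps)
    finally show ?thesis using 1 by blast
  qed
qed

theorem theorem4p1:
  shows "\<exists>c>0. \<forall>(L::real) (Lbar::real) (\<mu>::real) (chi::real) (n::nat) (b::nat).
    0 < \<mu> \<and> 1 \<le> chi \<and> 1 \<le> n \<and> 1 \<le> b \<and> real b \<ge> Lbar / L \<longrightarrow>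
    (\<exists>P. admissible P \<and>
      (\<forall>(d::nat) (m::nat) (f :: nat \<Rightarrow> nat \<Rightarrow> fseq \<Rightarrow> real) (Lf :: nat \<Rightarrow> nat \<Rightarrow> real)
        (E :: nat \<Rightarrow> (nat \<times> nat) set) (W :: nat \<Rightarrow> nat \<Rightarrow> nat \<Rightarrow> real)
        (x0 :: nat \<Rightarrow> fseq) (y0 :: nat \<Rightarrow> fseq) (z0 :: nat \<Rightarrow> fseq) (m0 :: nat \<Rightarrow> fseq) (u :: fseq).
        1 \<le> d \<and> 1 \<le> m \<and>
        (\<forall>i<m. \<forall>j<n. convex_on (Rd d) (f i j) \<and> smooth d (Lf i j) (f i j)) \<and>
        (\<forall>i<m. smooth d L (F_node n f i) \<and> strongly_convex d \<mu> (F_node n f i)) \<and>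
        Lbar = Max ((\<lambda>i. (1 / real n) * (\<Sum>j<n. Lf i j)) ` {..<m}) \<and>
        gossip d m chi E W \<and>
        (\<forall>i<m. x0 i \<in> Rd d \<and> y0 i \<in> Rd d \<and> z0 i \<in> Rd d \<and> m0 i \<in> Rd d) \<and>
        (\<Sum>i<m. z0 i) = 0 \<and>
        is_arg_min (\<lambda>v. \<Sum>i<m. F_node n f i v) (\<lambda>v. v \<in> Rd d) u \<longrightarrow>
        (\<exists>C>0. \<forall>\<epsilon>>0. \<exists>N.
          real N \<le> c * complexity n b L Lbar \<mu> chi * max 0 (ln (C / \<epsilon>)) \<and>
          mean_sq_error m (adom_vr d m n b f Lf P W x0 y0 z0 m0 N) u \<le> \<epsilon>)))"
proof (intro exI[of _ "512::real"] conjI allI impI, goal_cases)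
  case 1
  show ?case by simp
next
  case (2 L Lbar \<mu> chi n b)
  note A = 2
  \<comment> \<open>For \<open>L \<le> 0\<close> the problem class is empty, but the parameters still have to be admissible.\<close>
  define T where "T = (if 0 < L then L else 1)"
  define P where "P = adom_parameters T chi (adom_step T \<mu>)"
  show ?case
  proof (intro exI[of _ P] conjI allI impI, goal_cases)
    case 1
    have "0 < T" by (simp add: T_def)
    moreover from this have "0 < adom_step T \<mu>" using A by (simp add: adom_step_def)
    ultimately show ?case unfolding P_def by (rule adom_parameters_admissible)
  next
    case (2 d m f Lf E W x0 y0 z0 m0 u)
    interpret adom_problem d m n b f Lf L Lbar \<mu> chi E W u
      by unfold_locales (use A 2 in auto)
    have P: "P = adom_parameters L chi (adom_step L \<mu>)" unfolding P_def T_def using L_pos by simp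
    have init: "\<forall>i<m. x0 i \<in> Rd d \<and> y0 i \<in> Rd d \<and> z0 i \<in> Rd d \<and> m0 i \<in> Rd d" "(\<Sum>i<m. z0 i) = 0"
      using 2 by auto
    show ?case unfolding P
    proof (rule iterations_for_exponential_decay[OF mean_sq_error_le[OF init] _ rho_bounds inverse_rho_le_complexity])
      have "0 \<le> mean_sq_error m (adom_vr d m n b f Lf (adom_parameters L chi (adom_step L \<mu>)) W x0 y0 z0 m0 0) u"
        unfolding mean_sq_error_def by (rule integral_nonneg_AE) (simp add: sum_nonneg)
      from order.trans[OF this mean_sq_error_le[OF init]]
      show "0 \<le> 1 / (8 * L * adom_step L \<mu>) * lyapunov \<lparr>s_x = x0, s_xf = x0, s_w = x0, s_y = y0, s_yf = y0,
          s_z = z0, s_zf = z0, s_m = m0\<rparr>" by simp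
    qed
  qed
qed

end
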